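(* Let $(X_1,\ldots,X_n)\sim N_n(\mathbf{0},\boldsymbol{\Sigma})$, where all diagonal entries of $\boldsymbol{\Sigma}$ are equal to $1$, and let $Z\sim\chi_\nu/\sqrt{\nu}$ be independent of $(X_1,\ldots,X_n)$. Let $T_i=Z^{-1}X_i$, $i=1,\ldots,n$. (i) Suppose that the off-diagonal entries of $\boldsymbol{\Sigma}$ are non-negative, and let $F_i$ be the cdf of $T_i$. If $-\infty<a_1\le\cdots\le a_n<\infty$ are such that $a_n\le 0$ and $j^{-1}F_i(a_j)$ is nondecreasing in $j=1,\ldots,n$ for all $i=1,\ldots,n$, then $$P\{T_{1:n}\ge a_1,\ldots,T_{n:n}\ge a_n\}\ \ge\ 1-\frac1n\sum_{i=1}^nF_i(a_n).$$ Likewise, if $-\infty<b_1\le\cdots\le b_n<\infty$ are such that $b_1\ge 0$ and $j^{-1}[1-F_i(b_{n-j+1})]$ is nondecreasing in $j=1,\ldots,n$ for all $i=1,\ldots,n$, then $$P\{T_{1:n}\le b_1,\ldots,T_{n:n}\le b_n\}\ \ge\ \frac1n\sum_{i=1}^nF_i(b_1).$$ (ii) Suppose that the off-diagonal entries of $-D\boldsymbol{\Sigma}^{-1}D$ are non-negative for some diagonal matrix $D$ with diagonal entries $\pm1$. Let $H_i$ be the cdf of $|T_i|$ and let $|T|_{1:n}\le\cdots\le|T|_{n:n}$ be the ordered values of $|T_1|,\ldots,|T_n|$. If $-\infty<a_1\le\cdots\le a_n<\infty$ are such that $j^{-1}H_i(a_j)$ is nondecreasing in $j=1,\ldots,n$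 for all $i=1,\ldots,n$, then $$P\{|T|_{1:n}\ge a_1,\ldots,|T|_{n:n}\ge a_n\}\ \ge\ 1-\frac1n\sum_{i=1}^nH_i(a_n).$$ Likewise, if $-\infty<b_1\le\cdots\le b_n<\infty$ are such that $j^{-1}[1-H_i(b_{n-j+1})]$ is nondecreasing in $j=1,\ldots,n$ for all $i=1,\ldots,n$, then $$P\{|T|_{1:n}\le b_1,\ldots,|T|_{n:n}\le b_n\}\ \ge\ \frac1n\sum_{i=1}^nH_i(b_1).$$
   Context: $N_n(\mathbf{0},\boldsymbol{\Sigma})$ is the $n$-variate normal distribution with mean vector $\mathbf{0}$ and covariance matrix $\boldsymbol{\Sigma}$. $Z\sim\chi_\nu/\sqrt\nu$ means that $Z>0$ and $\nu Z^2$ has the chi-square distribution with $\nu$ degrees of freedom. $T_{1:n}\le\cdots\le T_{n:n}$ denote the ordered values of $T_1,\ldots,T_n$. *)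

theory Defs
  imports "HOL-Probability.Probability"
begin

text \<open>
  The \<open>n\<close>-variate normal distribution: \<open>X\<close> is \<open>N(m, S)\<close> iff it has the law of \<open>m + A Z\<close>, where
  \<open>A A\<^sup>T = S\<close> and \<open>Z\<close> has independent standard normal components. This also covers
  singular covariance matrices \<open>S\<close>, for which there is no Lebesgue density.
\<close>

definition multivariate_normal ::
    "'a measure \<Rightarrow> ('a \<Rightarrow> real ^ 'n) \<Rightarrow> real ^ 'n \<Rightarrow> real ^ 'n ^ 'n \<Rightarrow> bool" where
  "multivariate_normal M X m S \<longleftrightarrow>
     X \<in> borel_measurable M \<and>
     (\<exists>A :: real ^ 'n ^ 'n. A ** transpose A = S \<and>
        distr M borel X =
        distr (\<Pi>\<^sub>M i\<in>(UNIV :: 'n set). std_normal_distribution) borel (\<lambda>z. m + A *v (\<chi> i. z i)))"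

definition chi_square_density :: "real \<Rightarrow> real \<Rightarrow> real" where
  "chi_square_density \<nu> x =
     (if x > 0 then x powr (\<nu> / 2 - 1) * exp (- x / 2) / (2 powr (\<nu> / 2) * Gamma (\<nu> / 2)) else 0)"

text \<open>The distribution \<open>\<chi>\<^sub>\<nu> / sqrt \<nu>\<close>.\<close>

definition scaled_chi :: "'a measure \<Rightarrow> ('a \<Rightarrow> real) \<Rightarrow> real \<Rightarrow> bool" where
  "scaled_chi M Z \<nu> \<longleftrightarrow>
     Z \<in> borel_measurable M \<and>
     (AE \<omega> in M. Z \<omega> > 0) \<and>
     distributed M lborel (\<lambda>\<omega>. \<nu> * (Z \<omega>)\<^sup>2) (chi_square_density \<nu>)"

text \<open>
  The library's \<open>indep_var\<close> requires both random variables to have the same value type, so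
  independence of a vector and a scalar is stated through the generated sigma-algebras.
\<close>

definition independent_rv ::
    "'a measure \<Rightarrow> ('a \<Rightarrow> 'b::topological_space) \<Rightarrow> ('a \<Rightarrow> 'c::topological_space) \<Rightarrow> bool" where
  "independent_rv M X Y \<longleftrightarrow>
     prob_space.indep_set M {X -` A \<inter> space M | A. A \<in> sets borel}
                            {Y -` B \<inter> space M | B. B \<in> sets borel}"

text \<open>The \<open>j\<close>-th smallest value of a finite family, with \<open>j\<close> counted from \<open>1\<close>.\<close>

definition order_stat :: "('n::finite \<Rightarrow> real) \<Rightarrow> nat \<Rightarrow> real" where
  "order_stat x j = sorted_list_of_multiset (image_mset x (mset_set UNIV)) ! (j - 1)"

end

theory Submission
  imports Defs
begin

text \<open>
  Let \<open>E\<^sub>j\<close> be the event that, for some \<open>k \<ge> j\<close>, at least \<open>k\<close> of the \<open>T\<^sub>i\<close> lie in the \<open>k\<close>-th critical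
  region \<open>D\<^sub>k\<close>. Summation by parts reduces all four bounds to the claim that \<open>P(E\<^sub>j | T\<^sub>i \<in> D)\<close>
  decreases as \<open>D\<close> grows. For fixed \<open>i\<close> write \<open>X\<^sub>i = u \<zeta>\<close> and \<open>Z = \<zeta>\<close> with \<open>\<zeta> = sqrt (r / (\<nu> + u\<^sup>2))\<close>;
  then \<open>u = T\<^sub>i\<close> and \<open>r = X\<^sub>i\<^sup>2 + \<nu> Z\<^sup>2\<close> are independent, \<open>\<bar>X\<^sub>i\<bar>\<close> increases and \<open>Z\<close> decreases in \<open>\<bar>u\<bar>\<close>.
  It remains to see how the law of \<open>X\<close> given \<open>X\<^sub>i = x\<close> moves with \<open>x\<close>. In (i) it is the law of
  \<open>x S e\<^sub>i\<close> plus an independent vector, and \<open>S\<close> has non-negative entries. In (ii) the density of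
  \<open>\<bar>X\<bar>\<close> is a sum over signs, that is, a ferromagnetic Ising partition function with couplings
  proportional to \<open>\<bar>x\<^sub>j\<bar> \<bar>x\<^sub>k\<bar>\<close>. Ginibre's duplication argument shows that it is log-supermodular,
  and the four functions theorem turns this into stochastic monotonicity.
\<close>

section \<open>Order statistics and the Simes inequality\<close>

text \<open>The common divisor \<open>Z\<close> couples the coordinates even where \<open>S\<close>
  does not: moving \<open>T $ i\<close> changes the law of the other \<open>X $ k\<close> and also
  the factor \<open>1 / Z\<close> by which all of them are scaled. At fixed \<open>r\<close> both
  effects push the same way only if scaling away from the origin keeps a point in an outer critical
  region, or scaling towards it in an inner one. This is the role of \<open>a n \<le> 0\<close> and
  \<open>b 1 \<ge> 0\<close> in (i); regions defined through \<open>\<bar>s\<bar>\<close> have the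
  property by themselves.

  In (i) \<open>S\<close> may be singular, so conditioning on \<open>X $ i\<close> cannot go through
  a density; it is done by rotating the standard normal source until one source coordinate is
  \<open>X $ i\<close>. In (ii) the precision matrix supplies a density, and folding that density
  over sign changes is what brings in the spin sums.

  The dependence claim is stated cross-multiplied, as an inequality between products of
  probabilities, so that critical regions of probability zero fit in.\<close>

text \<open>In a sorted list the entries below \<open>c\<close> fill an initial segment of positions
  and those above \<open>c\<close> a final one, so the length of the segment decides on which side
  of \<open>c\<close> position \<open>m\<close> lies.\<close>

lemma card_sorted_nth:
  fixes xs :: "real list"
  assumes "sorted xs" "m < length xs"
  shows "xs ! m < c \<longleftrightarrow> m < length (filter (\<lambda>x. x < c) xs)"
    and "xs ! m > c \<longleftrightarrow> length xs - m \<le> length (filter (\<lambda>x. x > c) xs)"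
proof -
  have up: "xs ! k \<le> xs ! l" if "k \<le> l" "l < length xs" for k l
    using assms(1) that by (simp add: sorted_iff_nth_mono)
  have "m < card {k. k < length xs \<and> xs ! k < c}" if "xs ! m < c"
  proof -
    have "{..m} \<subseteq> {k. k < length xs \<and> xs ! k < c}"
      using up[of _ m] that assms(2) by fastforce
    from card_mono[OF _ this] show ?thesis by simp
  qed
  moreover have "card {k. k < length xs \<and> xs ! k < c} \<le> m" if "\<not> xs ! m < c"
  proof -
    have "{k. k < length xs \<and> xs ! k < c} \<subseteq> {..<m}"
      using up[of m] that by (auto simp: not_less intro: order_trans intro!: leI dest: le_less_trans)
    from card_mono[OF _ this] show ?thesis by simp
  qed
  ultimately show "xs ! m < c \<longleftrightarrow> m < length (filter (\<lambda>x. x < c) xs)"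
    by (cases "xs ! m < c") (auto simp: length_filter_conv_card)
  have "length xs - m \<le> card {k. k < length xs \<and> xs ! k > c}" if "xs ! m > c"
  proof -
    have "{m..<length xs} \<subseteq> {k. k < length xs \<and> xs ! k > c}"
      using up[of m] that by (fastforce)
    from card_mono[OF _ this] show ?thesis by simp
  qed
  moreover have "card {k. k < length xs \<and> xs ! k > c} < length xs - m" if "\<not> xs ! m > c"
  proof -
    have "{k. k < length xs \<and> xs ! k > c} \<subseteq> {Suc m..<length xs}"
      using up[of _ m] that assms(2) by (auto simp: Suc_le_eq not_less) (meson leI le_less_trans leD)
    from card_mono[OF _ this] show ?thesis using assms(2) by simp
  qed
  ultimately show "xs ! m > c \<longleftrightarrow> length xs - m \<le> length (filter (\<lambda>x. x > c) xs)"
    by (cases "xs ! m > c") (auto simp: length_filter_conv_card)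
qed

lemma length_filter_order_stat:
  fixes x :: "'n::finite \<Rightarrow> real"
  shows "length (filter P (sorted_list_of_multiset (image_mset x (mset_set UNIV)))) = card {i. P (x i)}"
proof -
  have "length (filter P (sorted_list_of_multiset (image_mset x (mset_set UNIV))))
      = size (filter_mset P (image_mset x (mset_set UNIV)))"
    by (metis mset_filter mset_sorted_list_of_multiset size_mset)
  also have "\<dots> = card {i. P (x i)}"
    by (simp add: filter_mset_image_mset filter_mset_mset_set)
  finally show ?thesis .
qed

text \<open>These trade ordered values for counts, the form in which the critical events are
  phrased. The counts are of strict inequalities, so ties need no convention.\<close>

lemma
  fixes x :: "'n::finite \<Rightarrow> real"
  assumes "j \<in> {1..CARD('n)}"
  shows order_stat_ge_iff: "order_stat x j \<ge> c \<longleftrightarrow> card {i. x i < c} < j"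
    and order_stat_le_iff: "order_stat x j \<le> c \<longleftrightarrow> card {i. x i > c} < CARD('n) - j + 1"
proof -
  let ?xs = "sorted_list_of_multiset (image_mset x (mset_set (UNIV :: 'n set)))"
  have len: "length ?xs = CARD('n)"
    using length_filter_order_stat[of "\<lambda>_. True" x] by simp
  have *: "sorted ?xs" "j - 1 < length ?xs"
    using assms len by (auto simp: sorted_sorted_list_of_multiset)
  show "order_stat x j \<ge> c \<longleftrightarrow> card {i. x i < c} < j"
    using card_sorted_nth(1)[OF *, of c] assms
    unfolding order_stat_def length_filter_order_stat by auto
  show "order_stat x j \<le> c \<longleftrightarrow> card {i. x i > c} < CARD('n) - j + 1"
    using card_sorted_nth(2)[OF *, of c] assms
    unfolding order_stat_def length_filter_order_stat len by auto
qed

text \<open>Abel summation: in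
  \<open>c 1 * g 1 + (c 2 - c 1) * g 2 + \<dots> - c m * g (Suc m)\<close> every factor except the
  last multiplies a non-negative number, so each \<open>g j\<close> with \<open>j \<le> m\<close>
  may be replaced by \<open>1\<close>.\<close>

lemma sum_telescope_le_last:
  fixes c g :: "nat \<Rightarrow> real"
  assumes "mono_on {1..m} c" "\<And>j. c j \<ge> 0" "\<And>j. g j \<le> 1" "m \<ge> 1"
  shows "(\<Sum>j=1..m. c j * (g j - g (Suc j))) \<le> c m * (1 - g (Suc m))"
  using assms(4,1)
proof (induction m rule: nat_induct_at_least)
  case base
  show ?case using assms(2)[of 1] assms(3)[of 1] by (auto intro!: mult_left_mono)
next
  case (Suc m)
  have "c m \<le> c (Suc m)"
    using Suc.prems Suc.hyps by (auto simp: mono_on_def)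
  then have "c m * (1 - g (Suc m)) \<le> c (Suc m) * (1 - g (Suc m))"
    using assms(3) by (intro mult_right_mono) (auto simp: algebra_simps)
  moreover have "(\<Sum>j=1..m. c j * (g j - g (Suc j))) \<le> c m * (1 - g (Suc m))"
    using Suc.prems by (intro Suc.IH) (auto simp: mono_on_def)
  ultimately show ?case by (simp add: algebra_simps)
qed

text \<open>Free of any distribution: \<open>A i j\<close> is the event that coordinate
  \<open>i\<close> falls in the \<open>j\<close>-th critical region. The event \<open>R 1\<close> is
  cut according to the last level \<open>j\<close> at which the count reaches \<open>j\<close>;
  Markov's inequality turns each piece into a sum over \<open>i\<close>, and for each
  \<open>i\<close> the sum over \<open>j\<close> telescopes up to an inequality. \<open>dep\<close>
  says that conditioning on the larger region makes \<open>R (Suc j)\<close> less likely.\<close>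

lemma (in prob_space) simes_inequality:
  fixes A :: "'n::finite \<Rightarrow> nat \<Rightarrow> 'a set" and n :: nat
  defines "R \<equiv> \<lambda>j. {\<omega> \<in> space M. \<exists>k\<in>{j..n}. k \<le> card {i. \<omega> \<in> A i k}}"
  assumes n: "n \<ge> 1"
    and A: "\<And>i j. A i j \<in> events" and R: "\<And>j. R j \<in> events"
    and dep: "\<And>i j. 1 \<le> j \<Longrightarrow> j < n \<Longrightarrow>
        prob (R (Suc j) \<inter> A i (Suc j)) * prob (A i j) \<le> prob (R (Suc j) \<inter> A i j) * prob (A i (Suc j))"
    and mono: "\<And>i. mono_on {1..n} (\<lambda>j. prob (A i j) / real j)"
  shows "prob (R 1) \<le> (1 / real n) * (\<Sum>i\<in>UNIV. prob (A i n))"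
proof -
  \<comment> \<open>The conditional probability of \<open>R j\<close> given \<open>A i j\<close>.
    Division by zero yields \<open>0\<close> on null events, which respects both the bound
    \<open>g i j \<le> 1\<close> and the lower estimate below; the value \<open>0\<close> beyond
    \<open>n\<close> matches \<open>R (Suc n) = {}\<close>.\<close>
  define g where "g i j = (if j \<le> n then prob (R j \<inter> A i j) / prob (A i j) else 0)" for i j
  have R_top: "R (Suc n) = {}" by (auto simp: R_def)
  have R_Suc: "R (Suc j) \<subseteq> R j" for j by (auto simp: R_def intro: bexI[of _ _] dest: Suc_leD)
  have R_split: "prob (R j) = prob (R j - R (Suc j)) + prob (R (Suc j))" for j
    using R R_Suc by (simp add: finite_measure_Diff)
  have "prob (R j) = (\<Sum>k=j..n. prob (R k - R (Suc k)))" if "j \<le> Suc n" for j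
    using that
  proof (induction rule: inc_induct)
    case base
    then show ?case by (simp add: R_top)
  next
    case (step j)
    then show ?case using R_split[of j] by (simp add: sum.atLeast_Suc_atMost)
  qed
  then have prob_R: "prob (R 1) = (\<Sum>k=1..n. prob (R k - R (Suc k)))" by simp
  \<comment> \<open>Outside \<open>R (Suc j)\<close> the witness in \<open>R j\<close> can only be
    \<open>k = j\<close>, so at least \<open>j\<close> of the events \<open>A i j\<close> occur
    there.\<close>
  have level: "prob (R j - R (Suc j)) \<le> (\<Sum>i\<in>UNIV. prob ((R j - R (Suc j)) \<inter> A i j)) / real j"
    if j: "j \<ge> 1" for j
  proof -
    have "real j * prob (R j - R (Suc j)) = (\<integral>\<omega>. real j * indicator (R j - R (Suc j)) \<omega> \<partial>M)"
      using R by (simp add: R_def measure_def)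
    also have "\<dots> \<le> (\<integral>\<omega>. (\<Sum>i\<in>UNIV. indicator ((R j - R (Suc j)) \<inter> A i j) \<omega>) \<partial>M)"
    proof (rule integral_mono)
      fix \<omega>
      show "real j * indicator (R j - R (Suc j)) \<omega>
          \<le> (\<Sum>i\<in>UNIV. indicator ((R j - R (Suc j)) \<inter> A i j) \<omega> :: real)"
      proof (cases "\<omega> \<in> R j - R (Suc j)")
        case True
        then have "j \<le> card {i. \<omega> \<in> A i j}"
          by (auto simp: R_def) (metis Suc_leI atLeastAtMost_iff le_neq_implies_less)
        moreover have "(\<Sum>i\<in>UNIV. indicator ((R j - R (Suc j)) \<inter> A i j) \<omega> :: real) = card {i. \<omega> \<in> A i j}"
          using True by (simp add: indicator_def of_bool_def sum.If_cases)
        ultimately show ?thesis using True by simp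
      qed (auto simp: sum_nonneg)
    qed (use A R in \<open>auto simp: less_top[symmetric]\<close>)
    also have "\<dots> = (\<Sum>i\<in>UNIV. prob ((R j - R (Suc j)) \<inter> A i j))"
    proof -
      have "B \<in> events \<Longrightarrow> integrable M (indicator B :: _ \<Rightarrow> real)" for B
        by (simp add: less_top[symmetric])
      then show ?thesis
        using A R by (simp add: sets.Int sets.Diff Int_absorb2 sets.sets_into_space)
    qed
    finally show ?thesis using j by (simp add: field_simps)
  qed
  have summand: "prob ((R j - R (Suc j)) \<inter> A i j) / real j \<le> prob (A i j) / real j * (g i j - g i (Suc j))"
    if j: "j \<in> {1..n}" for i j
  proof -
    have "prob ((R j - R (Suc j)) \<inter> A i j) = prob (R j \<inter> A i j) - prob (R (Suc j) \<inter> A i j)"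
      using finite_measure_Diff[of "R j \<inter> A i j" "R (Suc j) \<inter> A i j"] A R R_Suc[of j]
      by (auto simp: Int_Diff Diff_Int_distrib2)
    moreover have "prob (R j \<inter> A i j) = prob (A i j) * g i j"
    proof (cases "prob (A i j) = 0")
      case True
      then have "prob (R j \<inter> A i j) = 0"
        using finite_measure_mono[of "R j \<inter> A i j" "A i j"] A measure_nonneg[of M "R j \<inter> A i j"] by auto
      then show ?thesis using True by simp
    qed (use j in \<open>auto simp: g_def\<close>)
    \<comment> \<open>Here \<open>dep\<close> replaces conditioning on \<open>A i j\<close> by
      conditioning on \<open>A i (Suc j)\<close>; without this change the differences would not
      telescope.\<close>
    moreover have "prob (A i j) * g i (Suc j) \<le> prob (R (Suc j) \<inter> A i j)"
    proof (cases "j < n \<and> prob (A i (Suc j)) \<noteq> 0")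
      case True
      then have "prob (A i (Suc j)) > 0" by (simp add: less_le)
      with True dep[of j i] j show ?thesis by (simp add: g_def field_simps)
    qed (auto simp: g_def)
    ultimately show ?thesis
      by (simp add: field_simps divide_right_mono flip: right_diff_distrib)
  qed
  have "g i j \<le> 1" for i j
    using finite_measure_mono[of "R j \<inter> A i j" "A i j"] A
    by (auto simp: g_def divide_le_eq_1 zero_less_measure_iff)
  have col: "(\<Sum>j=1..n. prob ((R j - R (Suc j)) \<inter> A i j) / real j) \<le> prob (A i n) / real n" for i
  proof -
    have "(\<Sum>j=1..n. prob ((R j - R (Suc j)) \<inter> A i j) / real j)
        \<le> (\<Sum>j=1..n. prob (A i j) / real j * (g i j - g i (Suc j)))"
      using summand by (intro sum_mono)
    also have "\<dots> \<le> prob (A i n) / real n * (1 - g i (Suc n))"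
      using \<open>\<And>i j. g i j \<le> 1\<close> n by (intro sum_telescope_le_last mono) auto
    finally show ?thesis by (simp add: g_def)
  qed
  have "prob (R 1) \<le> (\<Sum>k=1..n. (\<Sum>i\<in>UNIV. prob ((R k - R (Suc k)) \<inter> A i k)) / real k)"
    unfolding prob_R by (intro sum_mono level) auto
  also have "\<dots> = (\<Sum>i\<in>UNIV. \<Sum>k=1..n. prob ((R k - R (Suc k)) \<inter> A i k) / real k)"
    unfolding sum_divide_distrib by (rule sum.swap)
  also have "\<dots> \<le> (\<Sum>i\<in>UNIV. prob (A i n) / real n)"
    by (intro sum_mono col)
  finally show ?thesis by (simp add: sum_divide_distrib)
qed

section \<open>The four functions theorem\<close>

text \<open>For finite values \<open>c * (c + d) - c * (a + b) = (c - a) * (c - b) + (c * d - a *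
  b)\<close>, and both terms are non-negative. If \<open>c = 0\<close>, then
  \<open>a = b = 0\<close>.\<close>

lemma ennreal_four_numbers:
  fixes a b c d :: ennreal
  assumes "a \<le> c" "b \<le> c" "a * b \<le> c * d"
  shows "a + b \<le> c + d"
proof (cases "c = \<top> \<or> d = \<top>")
  case False
  then have "a \<noteq> \<top>" "b \<noteq> \<top>" using assms by (auto simp: top_unique)
  with False obtain a' b' c' d' where
    eq: "a = ennreal a'" "b = ennreal b'" "c = ennreal c'" "d = ennreal d'"
    and nn: "a' \<ge> 0" "b' \<ge> 0" "c' \<ge> 0" "d' \<ge> 0"
    by (metis ennreal_cases)
  have *: "a' \<le> c'" "b' \<le> c'" "a' * b' \<le> c' * d'"
    using assms nn unfolding eq by (auto simp flip: ennreal_mult)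
  have "c' * (a' + b') \<le> c' * (c' + d')"
    using * mult_nonneg_nonneg[of "c' - a'" "c' - b'"] by (simp add: algebra_simps)
  then have "a' + b' \<le> c' + d'"
    using * nn by (cases "c' = 0") auto
  then show ?thesis using nn by (simp add: eq flip: ennreal_plus)
qed auto

text \<open>Maximum and minimum for the preorder by absolute value. A pair is kept or swapped
  together with its signs, so the four functions theorem can be run on the whole line instead of a
  half-line.\<close>

definition abs_max :: "real \<Rightarrow> real \<Rightarrow> real" where
  "abs_max x y = (if \<bar>x\<bar> \<le> \<bar>y\<bar> then y else x)"

definition abs_min :: "real \<Rightarrow> real \<Rightarrow> real" where
  "abs_min x y = (if \<bar>x\<bar> \<le> \<bar>y\<bar> then x else y)"

lemma abs_abs_max: "\<bar>abs_max x y\<bar> = max \<bar>x\<bar> \<bar>y\<bar>"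
  and abs_abs_min: "\<bar>abs_min x y\<bar> = min \<bar>x\<bar> \<bar>y\<bar>"
  by (auto simp: abs_max_def abs_min_def)

text \<open>Symmetrization: twice a product of integrals is the double integral of
  \<open>f x * g y + f y * g x\<close>, so it suffices to compare these sums pointwise. For
  \<open>\<bar>x\<bar> \<noteq> \<bar>y\<bar>\<close> the larger right-hand term bounds both
  left-hand terms, and the hypothesis at \<open>(x, x)\<close> and \<open>(y, y)\<close> bounds
  their product, which is the situation of four numbers above.\<close>

lemma four_functions_1:
  fixes f1 f2 f3 f4 :: "real \<Rightarrow> ennreal"
  assumes "sigma_finite_measure M"
    and [measurable]: "f1 \<in> borel_measurable M" "f2 \<in> borel_measurable M"
      "f3 \<in> borel_measurable M" "f4 \<in> borel_measurable M"
    and le: "\<And>x y. f1 x * f2 y \<le> f3 (abs_max x y) * f4 (abs_min x y)"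
  shows "(\<integral>\<^sup>+x. f1 x \<partial>M) * (\<integral>\<^sup>+x. f2 x \<partial>M) \<le> (\<integral>\<^sup>+x. f3 x \<partial>M) * (\<integral>\<^sup>+x. f4 x \<partial>M)"
proof -
  interpret sigma_finite_measure M by fact
  have pair: "(\<integral>\<^sup>+x. f x \<partial>M) * (\<integral>\<^sup>+x. g x \<partial>M) = (\<integral>\<^sup>+x. \<integral>\<^sup>+y. f x * g y \<partial>M \<partial>M)"
    if [measurable]: "f \<in> borel_measurable M" "g \<in> borel_measurable M" for f g :: "real \<Rightarrow> ennreal"
    by (simp add: nn_integral_cmult nn_integral_multc)
  have pair': "(\<integral>\<^sup>+x. f x \<partial>M) * (\<integral>\<^sup>+x. g x \<partial>M) = (\<integral>\<^sup>+x. \<integral>\<^sup>+y. f y * g x \<partial>M \<partial>M)"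
    if [measurable]: "f \<in> borel_measurable M" "g \<in> borel_measurable M" for f g :: "real \<Rightarrow> ennreal"
    using pair[OF that(2,1)] by (simp add: mult.commute)
  have double: "2 * ((\<integral>\<^sup>+x. f x \<partial>M) * (\<integral>\<^sup>+x. g x \<partial>M)) = (\<integral>\<^sup>+x. \<integral>\<^sup>+y. f x * g y + f y * g x \<partial>M \<partial>M)"
    if [measurable]: "f \<in> borel_measurable M" "g \<in> borel_measurable M" for f g :: "real \<Rightarrow> ennreal"
  proof -
    have "2 * ((\<integral>\<^sup>+x. f x \<partial>M) * (\<integral>\<^sup>+x. g x \<partial>M))
       = (\<integral>\<^sup>+x. \<integral>\<^sup>+y. f x * g y \<partial>M \<partial>M) + (\<integral>\<^sup>+x. \<integral>\<^sup>+y. f y * g x \<partial>M \<partial>M)"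
      unfolding pair[OF that, symmetric] pair'[OF that, symmetric] by (rule mult_2)
    then show ?thesis by (simp add: nn_integral_add)
  qed
  have "f1 x * f2 y + f1 y * f2 x \<le> f3 x * f4 y + f3 y * f4 x" for x y
  proof -
    consider "\<bar>x\<bar> < \<bar>y\<bar>" | "\<bar>y\<bar> < \<bar>x\<bar>" | "\<bar>x\<bar> = \<bar>y\<bar>" by linarith
    then show ?thesis
    proof cases
      case 1
      have "f1 x * f2 y + f1 y * f2 x \<le> f3 y * f4 x + f3 x * f4 y"
      proof (rule ennreal_four_numbers)
        show "f1 x * f2 y \<le> f3 y * f4 x" "f1 y * f2 x \<le> f3 y * f4 x"
          using 1 le[of x y] le[of y x] by (auto simp: abs_max_def abs_min_def)
        have "(f1 x * f2 x) * (f1 y * f2 y) \<le> (f3 x * f4 x) * (f3 y * f4 y)"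
          using mult_mono[OF le[of x x] le[of y y]] by (simp add: abs_max_def abs_min_def)
        then show "f1 x * f2 y * (f1 y * f2 x) \<le> f3 y * f4 x * (f3 x * f4 y)"
          by (simp add: mult_ac)
      qed
      then show ?thesis by (simp add: add.commute)
    next
      case 2
      show ?thesis
      proof (rule ennreal_four_numbers)
        show "f1 x * f2 y \<le> f3 x * f4 y" "f1 y * f2 x \<le> f3 x * f4 y"
          using 2 le[of x y] le[of y x] by (auto simp: abs_max_def abs_min_def)
        have "(f1 x * f2 x) * (f1 y * f2 y) \<le> (f3 x * f4 x) * (f3 y * f4 y)"
          using mult_mono[OF le[of x x] le[of y y]] by (simp add: abs_max_def abs_min_def)
        then show "f1 x * f2 y * (f1 y * f2 x) \<le> f3 x * f4 y * (f3 y * f4 x)"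
          by (simp add: mult_ac)
      qed
    next
      \<comment> \<open>At a tie \<open>abs_max\<close> returns its second argument, so exchanging
        \<open>x\<close> and \<open>y\<close> exchanges the two bounds and the terms compare one by
        one.\<close>
      case 3
      then have "f1 x * f2 y \<le> f3 y * f4 x" "f1 y * f2 x \<le> f3 x * f4 y"
        using le[of x y] le[of y x] by (auto simp: abs_max_def abs_min_def)
      then have "f1 x * f2 y + f1 y * f2 x \<le> f3 y * f4 x + f3 x * f4 y" by (rule add_mono)
      then show ?thesis by (simp add: add.commute)
    qed
  qed
  then have "2 * ((\<integral>\<^sup>+x. f1 x \<partial>M) * (\<integral>\<^sup>+x. f2 x \<partial>M)) \<le> 2 * ((\<integral>\<^sup>+x. f3 x \<partial>M) * (\<integral>\<^sup>+x. f4 x \<partial>M))"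
    by (subst (1 2) double) (auto intro!: nn_integral_mono)
  then show ?thesis by (subst (asm) ennreal_mult_le_mult_iff) auto
qed

text \<open>The continuous form of the Ahlswede-Daykin theorem. Integrating out \<open>J\<close>
  with coordinate \<open>i\<close> held fixed preserves the hypothesis, by induction, as a statement
  about functions of coordinate \<open>i\<close>; the one-dimensional case finishes. Extensional
  functions are the points of the product space, which is why the recombined points are restricted
  to \<open>J\<close>.\<close>

lemma four_functions:
  fixes f1 f2 f3 f4 :: "('i \<Rightarrow> real) \<Rightarrow> ennreal"
  defines "M \<equiv> \<lambda>_. lborel :: real measure"
  assumes "finite J"
    and "f1 \<in> borel_measurable (PiM J M)" "f2 \<in> borel_measurable (PiM J M)"
      "f3 \<in> borel_measurable (PiM J M)" "f4 \<in> borel_measurable (PiM J M)"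
    and "\<And>x y. x \<in> extensional J \<Longrightarrow> y \<in> extensional J \<Longrightarrow>
      f1 x * f2 y \<le> f3 (\<lambda>i\<in>J. abs_max (x i) (y i)) * f4 (\<lambda>i\<in>J. abs_min (x i) (y i))"
  shows "integral\<^sup>N (PiM J M) f1 * integral\<^sup>N (PiM J M) f2 \<le> integral\<^sup>N (PiM J M) f3 * integral\<^sup>N (PiM J M) f4"
  using assms(2-)
proof (induction J arbitrary: f1 f2 f3 f4)
  case empty
  interpret product_sigma_finite M
    unfolding product_sigma_finite_def M_def by (simp add: sigma_finite_lborel)
  show ?case
    using empty.prems(5)[of "\<lambda>_. undefined" "\<lambda>_. undefined"]
    by (simp add: nn_integral_empty restrict_def)
next
  case (insert i J)
  interpret product_sigma_finite M
    unfolding product_sigma_finite_def M_def by (simp add: sigma_finite_lborel)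
  note meas[measurable] = insert.prems(1-4)
  have sf: "sigma_finite_measure (PiM J M)" by (rule sigma_finite) (rule insert.hyps)
  interpret J: sigma_finite_measure "PiM J M" by fact
  have split: "integral\<^sup>N (PiM (insert i J) M) f = (\<integral>\<^sup>+ y. (\<integral>\<^sup>+ x. f (x(i := y)) \<partial>(PiM J M)) \<partial>(M i))"
    if "f \<in> borel_measurable (PiM (insert i J) M)" for f
    by (rule product_nn_integral_insert_rev) (use insert.hyps that in auto)
  have update[measurable]: "(\<lambda>x. f (x(i := y))) \<in> borel_measurable (PiM J M)"
    if [measurable]: "f \<in> borel_measurable (PiM (insert i J) M)"
    for f :: "_ \<Rightarrow> ennreal" and y
  proof -
    have [measurable]: "y \<in> space (M i)" by (simp add: M_def)
    show ?thesis by measurable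
  qed
  show ?case
    unfolding meas[THEN split]
  proof (rule four_functions_1)
    fix a b
    show "(\<integral>\<^sup>+ x. f1 (x(i := a)) \<partial>(PiM J M)) * (\<integral>\<^sup>+ x. f2 (x(i := b)) \<partial>(PiM J M))
      \<le> (\<integral>\<^sup>+ x. f3 (x(i := abs_max a b)) \<partial>(PiM J M)) * (\<integral>\<^sup>+ x. f4 (x(i := abs_min a b)) \<partial>(PiM J M))"
    proof (rule insert.IH)
      show "f1 (x(i := a)) * f2 (y(i := b))
          \<le> f3 ((\<lambda>i\<in>J. abs_max (x i) (y i))(i := abs_max a b)) * f4 ((\<lambda>i\<in>J. abs_min (x i) (y i))(i := abs_min a b))"
        if "x \<in> extensional J" "y \<in> extensional J" for x y
      proof -
        have upd: "(\<lambda>k\<in>insert i J. h ((x(i := a)) k) ((y(i := b)) k)) = (\<lambda>k\<in>J. h (x k) (y k))(i := h a b)" for h :: "real \<Rightarrow> real \<Rightarrow> real"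
          using insert.hyps by (auto simp: restrict_def)
        have "x(i := a) \<in> extensional (insert i J)" "y(i := b) \<in> extensional (insert i J)"
          using that by (auto simp: extensional_def)
        from insert.prems(5)[OF this] show ?thesis unfolding upd .
      qed
    qed (use meas in measurable)
  qed (use sigma_finite_measures in measurable)
qed

section \<open>Log-supermodularity of the sign-folded Gaussian density\<close>

definition signs :: "('n \<Rightarrow> real) set" where
  "signs = (\<Pi>\<^sub>E i\<in>UNIV. {-1, 1})"

lemma finite_signs [simp]: "finite (signs :: ('n::finite \<Rightarrow> real) set)"
  unfolding signs_def by (intro finite_PiE) auto

lemma signs_iff: "e \<in> signs \<longleftrightarrow> (\<forall>i. e i = -1 \<or> e i = 1)"
  by (auto simp: signs_def PiE_def Pi_def)

lemma signs_mult: "e \<in> signs \<Longrightarrow> d \<in> signs \<Longrightarrow> (\<lambda>i. e i * d i) \<in> signs"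
  unfolding signs_iff by (metis mult_1 mult_minus1 minus_minus)

lemma signs_square: "e \<in> signs \<Longrightarrow> e i * e i = 1"
  unfolding signs_iff by (metis mult_1 mult_minus1 minus_minus)

lemma signs_abs: "e \<in> signs \<Longrightarrow> \<bar>e i\<bar> = 1"
  unfolding signs_iff by (metis abs_1 abs_minus_cancel)

lemma sum_signs_mult:
  assumes "d \<in> signs"
  shows "(\<Sum>e\<in>signs. f (\<lambda>i. d i * e i)) = (\<Sum>e\<in>signs. f e)"
proof (rule sum.reindex_bij_witness[where i = "\<lambda>e i. d i * e i" and j = "\<lambda>e i. d i * e i"])
qed (use assms in \<open>auto simp: signs_mult signs_square simp flip: mult.assoc\<close>)

text \<open>The sum factors over the sites, and a site contributes \<open>2\<close> or
  \<open>0\<close> according to the parity of its exponent.\<close>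

lemma sum_signs_monomial_nonneg:
  fixes m :: "'n::finite \<Rightarrow> nat"
  shows "(\<Sum>e\<in>signs. \<Prod>i\<in>UNIV. e i ^ m i) \<ge> (0 :: real)"
proof -
  have "(\<Sum>e\<in>signs. \<Prod>i\<in>UNIV. e i ^ m i) = (\<Prod>i\<in>UNIV. \<Sum>s\<in>{-1, 1 :: real}. s ^ m i)"
    unfolding signs_def by (rule prod_sum_PiE[symmetric]) auto
  also have "\<dots> \<ge> 0"
    by (intro prod_nonneg) (auto simp: minus_one_power_iff)
  finally show ?thesis .
qed

text \<open>The partition function of an Ising model without external field. Ordered pairs are
  summed, so the bond between \<open>i\<close> and \<open>j\<close> has total coupling
  \<open>K i j + K j i\<close> and no symmetry of \<open>K\<close> has to be imposed.\<close>

definition ising :: "('n::finite \<Rightarrow> 'n \<Rightarrow> real) \<Rightarrow> real" where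
  "ising K = (\<Sum>e\<in>signs. exp (\<Sum>(i, j)\<in>{(i, j). i \<noteq> j}. K i j * (e i * e j)))"

lemma exp_sign: "s = -1 \<or> s = 1 \<Longrightarrow> exp (K * s) = cosh K + sinh K * (s :: real)"
  by (auto simp: cosh_def sinh_def field_simps)

text \<open>Multiplying out the factors \<open>cosh K + s sinh K\<close> one at a time only produces monomials in the
  spins, whose coefficients for \<open>K\<close> dominate those for \<open>K'\<close>.\<close>

lemma ising_monomial_mono:
  fixes K K' :: "'n::finite \<Rightarrow> 'n \<Rightarrow> real"
  assumes "finite E" "\<And>i j. (i, j) \<in> E \<Longrightarrow> \<bar>K' i j\<bar> \<le> K i j"
  shows "\<bar>\<Sum>e\<in>signs. (\<Prod>k\<in>UNIV. e k ^ m k) * (\<Prod>(i, j)\<in>E. exp (K' i j * (e i * e j)))\<bar>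
    \<le> (\<Sum>e\<in>signs. (\<Prod>k\<in>UNIV. e k ^ m k) * (\<Prod>(i, j)\<in>E. exp (K i j * (e i * e j))))"
  using assms
proof (induction E arbitrary: m)
  case empty
  then show ?case using sum_signs_monomial_nonneg[of m] by simp
next
  case (insert p E)
  obtain i j where p: "p = (i, j)" by fastforce
  \<comment> \<open>The sinh part of the factor for \<open>p\<close> multiplies the monomial by
    \<open>e i * e j\<close>. Raising the exponents one after the other also treats
    \<open>i = j\<close>, where the exponent grows by two.\<close>
  define m' where "m' = m(i := Suc (m i))"
  define m'' where "m'' = m'(j := Suc (m' j))"
  have m': "(\<Prod>k\<in>UNIV. e k ^ m' k) = e i * (\<Prod>k\<in>UNIV. e k ^ m k)" for e :: "'n \<Rightarrow> real"
    by (subst (1 2) prod.remove[of UNIV i]) (auto simp: m'_def intro!: prod.cong)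
  have m'': "(\<Prod>k\<in>UNIV. e k ^ m'' k) = e j * (\<Prod>k\<in>UNIV. e k ^ m' k)" for e :: "'n \<Rightarrow> real"
    by (subst (1 2) prod.remove[of UNIV j]) (auto simp: m''_def intro!: prod.cong)
  define G where "G K m = (\<Sum>e\<in>signs. (\<Prod>k\<in>UNIV. e k ^ m k) * (\<Prod>(i, j)\<in>E. exp (K i j * (e i * e j))))"
    for K :: "'n \<Rightarrow> 'n \<Rightarrow> real" and m :: "'n \<Rightarrow> nat"
  have expand: "(\<Sum>e\<in>signs. (\<Prod>k\<in>UNIV. e k ^ m k) * (\<Prod>(i, j)\<in>insert p E. exp (L i j * (e i * e j))))
      = cosh (L i j) * G L m + sinh (L i j) * G L m''" for L :: "'n \<Rightarrow> 'n \<Rightarrow> real"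
  proof -
    have sgn: "exp (L i j * (e i * e j)) = cosh (L i j) + sinh (L i j) * (e i * e j)" if "e \<in> signs" for e
      using that unfolding signs_iff by (intro exp_sign) (metis mult_1 mult_minus1 minus_minus)
    show ?thesis
      unfolding G_def m'' m' sum_distrib_left sum.distrib[symmetric]
    proof (intro sum.cong refl)
      fix e :: "'n \<Rightarrow> real" assume "e \<in> signs"
      then show "(\<Prod>k\<in>UNIV. e k ^ m k) * (\<Prod>(i, j)\<in>insert p E. exp (L i j * (e i * e j)))
        = cosh (L i j) * ((\<Prod>k\<in>UNIV. e k ^ m k) * (\<Prod>(i, j)\<in>E. exp (L i j * (e i * e j))))
        + sinh (L i j) * (e j * (e i * (\<Prod>k\<in>UNIV. e k ^ m k)) * (\<Prod>(i, j)\<in>E. exp (L i j * (e i * e j))))"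
        unfolding prod.insert[OF insert.hyps] unfolding p prod.case by (subst sgn) (assumption, algebra)
    qed
  qed
  have le: "\<bar>K' i j\<bar> \<le> K i j" using insert.prems p by auto
  then have "\<bar>cosh (K' i j)\<bar> \<le> cosh (K i j)" "\<bar>sinh (K' i j)\<bar> \<le> sinh (K i j)"
    using cosh_real_nonneg_le_iff[of "\<bar>K' i j\<bar>" "K i j"]
    by (auto simp: cosh_real_abs simp flip: sinh_real_abs)
  moreover have "0 \<le> K i j" using abs_ge_zero le by (rule order_trans)
  moreover have "\<bar>G K' n\<bar> \<le> G K n" for n
    unfolding G_def using insert.prems by (intro insert.IH) auto
  ultimately have "\<bar>cosh (K' i j)\<bar> * \<bar>G K' m\<bar> + \<bar>sinh (K' i j)\<bar> * \<bar>G K' m''\<bar>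
      \<le> cosh (K i j) * G K m + sinh (K i j) * G K m''"
    by (intro add_mono mult_mono) (auto intro: order_trans[OF abs_ge_zero])
  then show ?case
    unfolding expand abs_mult[symmetric] using abs_triangle_ineq order_trans by blast
qed

lemma ising_mono:
  fixes K K' :: "'n::finite \<Rightarrow> 'n \<Rightarrow> real"
  assumes "\<And>i j. i \<noteq> j \<Longrightarrow> \<bar>K' i j\<bar> \<le> K i j"
  shows "ising K' \<le> ising K"
proof -
  have "ising L = (\<Sum>e\<in>signs. (\<Prod>k\<in>UNIV. e k ^ 0) * (\<Prod>(i, j)\<in>{(i, j). i \<noteq> j}. exp (L i j * (e i * e j))))"
    for L :: "'n \<Rightarrow> 'n \<Rightarrow> real"
    unfolding ising_def by (intro sum.cong refl) (simp add: exp_sum case_prod_unfold)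
  moreover have "\<bar>\<Sum>e\<in>signs. (\<Prod>k\<in>UNIV. e k ^ 0) * (\<Prod>(i, j)\<in>{(i, j). i \<noteq> j}. exp (K' i j * (e i * e j)))\<bar>
      \<le> (\<Sum>e\<in>signs. (\<Prod>k\<in>UNIV. e k ^ 0) * (\<Prod>(i, j)\<in>{(i, j). i \<noteq> j}. exp (K i j * (e i * e j))))"
    by (rule ising_monomial_mono) (use assms in auto)
  ultimately show ?thesis by (metis abs_ge_self order_trans)
qed

text \<open>Ginibre's duplication trick: substitute \<open>e' = \<eta> e\<close> in the double sum.\<close>

lemma ising_duplicate:
  "ising K * ising L = (\<Sum>\<eta>\<in>signs. ising (\<lambda>i j. K i j + L i j * (\<eta> i * \<eta> j)))"
proof -
  let ?s = "\<lambda>K e. \<Sum>(i, j)\<in>{(i, j). i \<noteq> j}. K i j * (e i * e j)"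
  have "ising K * ising L = (\<Sum>e\<in>signs. \<Sum>\<eta>\<in>signs. exp (?s K e) * exp (?s L (\<lambda>i. e i * \<eta> i)))"
    unfolding ising_def sum_product
    by (intro sum.cong refl sum_signs_mult[symmetric])
  also have "\<dots> = (\<Sum>\<eta>\<in>signs. \<Sum>e\<in>signs. exp (?s K e) * exp (?s L (\<lambda>i. e i * \<eta> i)))"
    by (rule sum.swap)
  also have "\<dots> = (\<Sum>\<eta>\<in>signs. \<Sum>e\<in>signs. exp (?s (\<lambda>i j. K i j + L i j * (\<eta> i * \<eta> j)) e))"
    by (intro sum.cong refl)
       (simp add: exp_add[symmetric] sum.distrib[symmetric] case_prod_unfold algebra_simps)
  finally show ?thesis unfolding ising_def .
qed

text \<open>After duplication both sides are sums over \<eta> of single partition functions,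
  compared term by term through their couplings. A bond sees \<open>\<eta> i * \<eta> j = 1\<close>,
  covered by the first two hypotheses, or \<open>-1\<close>, covered by the third.\<close>

lemma ising_log_supermodular:
  assumes "\<And>i j. i \<noteq> j \<Longrightarrow> C i j + D i j \<le> A i j + B i j"
    and "\<And>i j. i \<noteq> j \<Longrightarrow> 0 \<le> C i j + D i j"
    and "\<And>i j. i \<noteq> j \<Longrightarrow> \<bar>C i j - D i j\<bar> \<le> A i j - B i j"
  shows "ising C * ising D \<le> ising A * ising B"
  unfolding ising_duplicate
proof (intro sum_mono ising_mono)
  fix \<eta> :: "'a \<Rightarrow> real" and i j :: 'a
  assume "\<eta> \<in> signs" "i \<noteq> j"
  then have "\<eta> i * \<eta> j = 1 \<or> \<eta> i * \<eta> j = -1"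
    unfolding signs_iff by (metis mult_1 mult_minus1 minus_minus)
  then show "\<bar>C i j + D i j * (\<eta> i * \<eta> j)\<bar> \<le> A i j + B i j * (\<eta> i * \<eta> j)"
    using assms[OF \<open>i \<noteq> j\<close>] by auto
qed

section \<open>The folded Gaussian density as an Ising partition function\<close>

definition quad_form :: "real ^ 'n ^ 'n \<Rightarrow> ('n::finite \<Rightarrow> real) \<Rightarrow> real" where
  "quad_form Q x = (\<Sum>i\<in>UNIV. \<Sum>j\<in>UNIV. Q $ i $ j * x i * x j)"

definition folded :: "real ^ 'n ^ 'n \<Rightarrow> ('n::finite \<Rightarrow> real) \<Rightarrow> real" where
  "folded Q x = (\<Sum>e\<in>signs. exp (- quad_form Q (\<lambda>i. e i * x i) / 2))"

lemma folded_nonneg: "folded Q x \<ge> 0"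
  unfolding folded_def by (intro sum_nonneg) auto

lemma folded_signs: "d \<in> signs \<Longrightarrow> folded Q (\<lambda>i. d i * x i) = folded Q x"
  using sum_signs_mult[of d "\<lambda>e. exp (- quad_form Q (\<lambda>i. e i * x i) / 2)"]
  unfolding folded_def by (simp add: mult_ac)

lemma folded_abs: "folded Q x = folded Q (\<lambda>i. \<bar>x i\<bar>)"
proof -
  have "(\<lambda>i. if x i < 0 then -1 else 1) \<in> signs" by (auto simp: signs_iff)
  from folded_signs[OF this, of Q x] show ?thesis
    by (simp add: if_distrib[of "\<lambda>s. s * _"] abs_if cong: if_cong)
qed

lemma sum_offdiag:
  fixes f :: "'n::finite \<Rightarrow> 'n \<Rightarrow> real"
  shows "(\<Sum>i\<in>UNIV. \<Sum>j\<in>UNIV. f i j) = (\<Sum>i\<in>UNIV. f i i) + (\<Sum>(i, j)\<in>{(i, j). i \<noteq> j}. f i j)"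
proof -
  have "(\<Sum>i\<in>UNIV. \<Sum>j\<in>UNIV. f i j) = (\<Sum>(i, j)\<in>UNIV. f i j)"
    by (simp add: sum.cartesian_product)
  also have "\<dots> = (\<Sum>(i, j)\<in>{(i, j). i = j}. f i j) + (\<Sum>(i, j)\<in>{(i, j). i \<noteq> j}. f i j)"
    by (subst sum.union_disjoint[symmetric]) (auto intro!: sum.cong)
  also have "(\<Sum>(i, j)\<in>{(i, j). i = j}. f i j) = (\<Sum>i\<in>UNIV. f i i)"
    by (rule sum.reindex_bij_witness[where j = fst and i = "\<lambda>i. (i, i)"]) auto
  finally show ?thesis .
qed

text \<open>Signs square to one, so the diagonal of the quadratic form leaves the sum and only pair
  interactions remain. The summation over all signs absorbs the gauge change by \<open>d\<close>,
  which turns the couplings into off-diagonal entries of \<open>- D Q D\<close> times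
  \<open>x i * x j / 2\<close>.\<close>

lemma folded_ising:
  assumes "d \<in> signs"
  shows "folded Q x = exp (- (\<Sum>i\<in>UNIV. Q $ i $ i * (x i)\<^sup>2) / 2)
    * ising (\<lambda>i j. - (d i * Q $ i $ j * d j) * (x i * x j) / 2)"
proof -
  have "folded Q x = folded Q (\<lambda>i. d i * x i)" by (rule folded_signs[symmetric, OF assms])
  also have "\<dots> = (\<Sum>e\<in>signs. exp (- (\<Sum>i\<in>UNIV. Q $ i $ i * (x i)\<^sup>2) / 2)
      * exp (\<Sum>(i, j)\<in>{(i, j). i \<noteq> j}. - (d i * Q $ i $ j * d j) * (x i * x j) / 2 * (e i * e j)))"
    unfolding folded_def
  proof (intro sum.cong refl)
    fix e :: "'a \<Rightarrow> real" assume e: "e \<in> signs"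
    have sq: "(\<Sum>i\<in>UNIV. Q $ i $ i * (e i * (d i * x i)) * (e i * (d i * x i))) = (\<Sum>i\<in>UNIV. Q $ i $ i * (x i)\<^sup>2)"
    proof (intro sum.cong refl)
      fix i
      have "Q $ i $ i * (e i * (d i * x i)) * (e i * (d i * x i)) = Q $ i $ i * (x i)\<^sup>2 * (e i * e i) * (d i * d i)"
        by (simp add: power2_eq_square mult_ac)
      then show "Q $ i $ i * (e i * (d i * x i)) * (e i * (d i * x i)) = Q $ i $ i * (x i)\<^sup>2"
        by (simp add: signs_square[OF e] signs_square[OF assms])
    qed
    show "exp (- quad_form Q (\<lambda>i. e i * (d i * x i)) / 2) = exp (- (\<Sum>i\<in>UNIV. Q $ i $ i * (x i)\<^sup>2) / 2)
      * exp (\<Sum>(i, j)\<in>{(i, j). i \<noteq> j}. - (d i * Q $ i $ j * d j) * (x i * x j) / 2 * (e i * e j))"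
      unfolding quad_form_def sum_offdiag sq exp_add[symmetric]
      by (simp add: add_divide_distrib sum_divide_distrib sum_negf[symmetric] case_prod_unfold mult_ac)
  qed
  finally show ?thesis unfolding ising_def sum_distrib_left .
qed

text \<open>The diagonal factor is modular, since the squares of maximum and minimum add up to the
  original squares; the spin sum carries the inequality. Only the absolute values of
  \<open>u\<close> and \<open>v\<close> are prescribed, because the folded density sees nothing
  else.\<close>

lemma folded_mtp2:
  assumes d: "d \<in> signs" and Q: "\<And>i j. i \<noteq> j \<Longrightarrow> d i * Q $ i $ j * d j \<le> 0"
    and mx: "\<And>i. \<bar>u i\<bar> = max \<bar>x i\<bar> \<bar>y i\<bar>" and mn: "\<And>i. \<bar>v i\<bar> = min \<bar>x i\<bar> \<bar>y i\<bar>"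
  shows "folded Q x * folded Q y \<le> folded Q u * folded Q v"
proof -
  let ?K = "\<lambda>x i j. - (d i * Q $ i $ j * d j) * (\<bar>x i\<bar> * \<bar>x j\<bar>) / 2"
  have ising: "ising (?K x) * ising (?K y) \<le> ising (?K u) * ising (?K v)"
  proof (rule ising_log_supermodular)
    fix i j :: 'a assume "i \<noteq> j"
    define q where "q = - (d i * Q $ i $ j * d j) / 2"
    have q: "q \<ge> 0" using Q[OF \<open>i \<noteq> j\<close>] by (simp add: q_def)
    have K: "?K z i j = q * (\<bar>z i\<bar> * \<bar>z j\<bar>)" for z by (simp add: q_def)
    \<comment> \<open>The gap is zero if the two pairs are ordered alike, and otherwise it is the
      product of their distances.\<close>
    have 1: "a * b + a' * b' \<le> max a a' * max b b' + min a a' * min b b'"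
      if "a \<ge> 0" "b \<ge> 0" "a' \<ge> 0" "b' \<ge> 0" for a a' b b' :: real
      using that mult_nonneg_nonneg[of "a' - a" "b - b'"] mult_nonneg_nonneg[of "a - a'" "b' - b"]
      by (auto simp: max_def min_def algebra_simps)
    have 2: "\<bar>a * b - a' * b'\<bar> \<le> max a a' * max b b' - min a a' * min b b'"
      if "a \<ge> 0" "b \<ge> 0" "a' \<ge> 0" "b' \<ge> 0" for a a' b b' :: real
    proof -
      have "min a a' * min b b' \<le> a * b" "min a a' * min b b' \<le> a' * b'"
        "a * b \<le> max a a' * max b b'" "a' * b' \<le> max a a' * max b b'"
        using that by (auto intro!: mult_mono)
      then show ?thesis by linarith
    qed
    show "?K x i j + ?K y i j \<le> ?K u i j + ?K v i j"
      unfolding K unfolding mx mn distrib_left[symmetric] by (intro mult_left_mono 1 q) auto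
    show "0 \<le> ?K x i j + ?K y i j" unfolding K using q by simp
    show "\<bar>?K x i j - ?K y i j\<bar> \<le> ?K u i j - ?K v i j"
      unfolding K unfolding mx mn right_diff_distrib[symmetric] abs_mult abs_of_nonneg[OF q]
      by (intro mult_left_mono 2 q) auto
  qed
  have "max a b ^ 2 + min a b ^ 2 = a ^ 2 + b ^ 2" for a b :: real by (simp add: max_def min_def)
  then have sq: "(u i)\<^sup>2 + (v i)\<^sup>2 = (x i)\<^sup>2 + (y i)\<^sup>2" for i
    using mx[of i] mn[of i] by (metis power2_abs)
  define w where "w z = exp (- (\<Sum>i\<in>UNIV. Q $ i $ i * (z i)\<^sup>2) / 2)" for z :: "'a \<Rightarrow> real"
  have "(\<Sum>i\<in>UNIV. Q $ i $ i * (x i)\<^sup>2) + (\<Sum>i\<in>UNIV. Q $ i $ i * (y i)\<^sup>2)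
      = (\<Sum>i\<in>UNIV. Q $ i $ i * (u i)\<^sup>2) + (\<Sum>i\<in>UNIV. Q $ i $ i * (v i)\<^sup>2)"
    unfolding sum.distrib[symmetric] distrib_left[symmetric] sq ..
  then have w: "w x * w y = w u * w v"
    unfolding w_def exp_add[symmetric] by (simp add: field_simps)
  have "folded Q z = w z * ising (?K z)" for z
    unfolding w_def folded_abs[of Q z] folded_ising[OF d, of Q "\<lambda>i. \<bar>z i\<bar>"] by simp
  then have factor: "folded Q z * folded Q z' = (w z * w z') * (ising (?K z) * ising (?K z'))" for z z'
    by (simp only: mult_ac)
  have "0 \<le> w u * w v" by (simp add: w_def)
  with ising show ?thesis unfolding factor w by (rule mult_left_mono)
qed

section \<open>Products of Lebesgue and of standard normal measures\<close>

lemma nn_integral_lborel_shift: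
  fixes h :: "'a::euclidean_space \<Rightarrow> ennreal"
  assumes [measurable]: "h \<in> borel_measurable borel"
  shows "(\<integral>\<^sup>+x. h (a + x) \<partial>lborel) = (\<integral>\<^sup>+x. h x \<partial>lborel)"
proof -
  have "(\<integral>\<^sup>+x. h (a + x) \<partial>lborel) = (\<integral>\<^sup>+x. h x \<partial>distr lborel borel ((+) a))"
    by (subst nn_integral_distr) auto
  then show ?thesis by (simp add: lborel_distr_plus)
qed

lemma linear_borel_measurable:
  fixes f :: "'a::euclidean_space \<Rightarrow> 'b::euclidean_space"
  shows "linear f \<Longrightarrow> f \<in> borel_measurable borel"
  by (intro borel_measurable_continuous_onI linear_continuous_on linear_conv_bounded_linear[THEN iffD1])

text \<open>The image of Lebesgue measure is translation invariant, hence proportional to Lebesgue measure.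
  (The determinant formula of the library needs a well-ordered index type.)\<close>

lemma nn_integral_lborel_linear:
  fixes f g :: "'a::euclidean_space \<Rightarrow> 'a"
  assumes f: "linear f" and fg: "\<And>x. f (g x) = x"
  shows "\<exists>c. \<forall>h. h \<in> borel_measurable borel \<longrightarrow>
    (\<integral>\<^sup>+x. h (f x) \<partial>lborel) = c * (\<integral>\<^sup>+x. h x \<partial>(lborel :: 'a measure))"
proof (intro exI allI impI)
  have [measurable]: "f \<in> borel_measurable borel" by (rule linear_borel_measurable) fact
  define B where "B = (cbox 0 One :: 'a set)"
  have [measurable]: "B \<in> sets borel" by (simp add: B_def)
  have B: "emeasure lborel B = 1" by (simp add: B_def)
  fix h :: "'a \<Rightarrow> ennreal" assume [measurable]: "h \<in> borel_measurable borel"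
  have shift: "(\<integral>\<^sup>+x. k (f x) \<partial>lborel) = (\<integral>\<^sup>+x. k (y + f x) \<partial>lborel)"
    if [measurable]: "k \<in> borel_measurable borel" for k :: "'a \<Rightarrow> ennreal" and y
    using nn_integral_lborel_shift[of "\<lambda>x. k (f x)" "g y"] by (simp add: linear_add[OF f] fg)
  \<comment> \<open>The usual uniqueness argument for Haar measure: average over translates by
    points of the unit cube, exchange the integrals, and translate until \<open>h\<close> stands
    alone. What remains is the constant.\<close>
  have "(\<integral>\<^sup>+x. h (f x) \<partial>lborel) = (\<integral>\<^sup>+y. indicator B y * (\<integral>\<^sup>+x. h (f x) \<partial>lborel) \<partial>lborel)"
    using B by (simp add: nn_integral_multc)
  also have "\<dots> = (\<integral>\<^sup>+y. \<integral>\<^sup>+x. indicator B y * h (y + f x) \<partial>lborel \<partial>lborel)"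
  proof (rule nn_integral_cong)
    fix y
    show "indicator B y * (\<integral>\<^sup>+x. h (f x) \<partial>lborel) = (\<integral>\<^sup>+x. indicator B y * h (y + f x) \<partial>lborel)"
      by (subst shift[of h y]) (simp_all add: nn_integral_cmult)
  qed
  also have "\<dots> = (\<integral>\<^sup>+x. \<integral>\<^sup>+y. indicator B y * h (y + f x) \<partial>lborel \<partial>lborel)"
    by (rule lborel_pair.Fubini') measurable
  also have "\<dots> = (\<integral>\<^sup>+x. \<integral>\<^sup>+y. indicator B (y - f x) * h y \<partial>lborel \<partial>lborel)"
  proof (rule nn_integral_cong)
    fix x
    show "(\<integral>\<^sup>+y. indicator B y * h (y + f x) \<partial>lborel) = (\<integral>\<^sup>+y. indicator B (y - f x) * h y \<partial>lborel)"
      by (subst nn_integral_lborel_shift[of "\<lambda>y. indicator B (y - f x) * h y" "f x", symmetric])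
         (simp_all add: add.commute)
  qed
  also have "\<dots> = (\<integral>\<^sup>+y. \<integral>\<^sup>+x. indicator B (y - f x) * h y \<partial>lborel \<partial>lborel)"
    by (rule lborel_pair.Fubini') measurable
  also have "\<dots> = (\<integral>\<^sup>+y. (\<integral>\<^sup>+x. indicator B (- f x) \<partial>lborel) * h y \<partial>lborel)"
  proof (rule nn_integral_cong)
    fix y
    show "(\<integral>\<^sup>+x. indicator B (y - f x) * h y \<partial>lborel) = (\<integral>\<^sup>+x. indicator B (- f x) \<partial>lborel) * h y"
      by (subst shift[of "\<lambda>x. indicator B (- x)" "- y"]) (simp_all add: nn_integral_multc)
  qed
  also have "\<dots> = (\<integral>\<^sup>+x. indicator B (- f x) \<partial>lborel) * (\<integral>\<^sup>+y. h y \<partial>lborel)"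
    by (rule nn_integral_cmult) measurable
  finally show "(\<integral>\<^sup>+x. h (f x) \<partial>lborel) = (\<integral>\<^sup>+x. indicator (cbox 0 One) (- f x) \<partial>lborel) * (\<integral>\<^sup>+y. h y \<partial>lborel)"
    unfolding B_def .
qed

section \<open>Lebesgue and standard normal measure, coordinatewise and on vectors\<close>

abbreviation lebesgue_PiM :: "'n set \<Rightarrow> ('n \<Rightarrow> real) measure" where
  "lebesgue_PiM J \<equiv> (\<Pi>\<^sub>M i\<in>J. lborel)"

abbreviation gauss_PiM :: "'n set \<Rightarrow> ('n \<Rightarrow> real) measure" where
  "gauss_PiM J \<equiv> (\<Pi>\<^sub>M i\<in>J. std_normal_distribution)"

lemma product_sigma_finite_lborel: "product_sigma_finite (\<lambda>_. lborel)"
  unfolding product_sigma_finite_def by (simp add: sigma_finite_lborel)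

lemma prob_space_std_normal: "prob_space std_normal_distribution"
  by (rule prob_space_normal_density) simp

lemma product_sigma_finite_std_normal: "product_sigma_finite (\<lambda>_. std_normal_distribution)"
  unfolding product_sigma_finite_def
  using prob_space_std_normal by (simp add: prob_space_imp_sigma_finite)

lemma measurable_vec_lambda [measurable (raw)]:
  fixes f :: "'b \<Rightarrow> 'n::finite \<Rightarrow> real"
  assumes "\<And>i. (\<lambda>x. f x i) \<in> borel_measurable M"
  shows "(\<lambda>x. \<chi> i. f x i) \<in> borel_measurable M"
  by (subst borel_measurable_euclidean_space)
     (use assms in \<open>auto simp: Basis_vec_def inner_axis\<close>)

lemma measurable_vec_nth [measurable (raw)]:
  fixes f :: "'b \<Rightarrow> real ^ 'n"
  shows "f \<in> borel_measurable M \<Longrightarrow> (\<lambda>x. f x $ i) \<in> borel_measurable M"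
  by (rule measurable_compose[OF _ borel_measurable_nth])

text \<open>Links the two models of the space: on families of coordinates single coordinates can be
  integrated out, on vectors linear maps act.\<close>

lemma distr_lebesgue_PiM: "distr (lebesgue_PiM UNIV) borel (\<lambda>z. \<chi> i. z i) = (lborel :: (real ^ 'n) measure)"
proof (rule lborel_eqI[symmetric])
  interpret product_sigma_finite "\<lambda>_::'n. lborel :: real measure" by (rule product_sigma_finite_lborel)
  fix l u :: "real ^ 'n" assume "\<And>b. b \<in> Basis \<Longrightarrow> l \<bullet> b \<le> u \<bullet> b"
  then have lu: "l $ i \<le> u $ i" for i
    using \<open>\<And>b. b \<in> Basis \<Longrightarrow> l \<bullet> b \<le> u \<bullet> b\<close>[of "axis i 1"] by (simp add: inner_axis axis_in_Basis_iff)
  have "emeasure (distr (lebesgue_PiM UNIV) borel (\<lambda>z. \<chi> i. z i)) (box l u)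
      = emeasure (lebesgue_PiM UNIV) (\<Pi>\<^sub>E i\<in>UNIV. {l $ i<..<u $ i})"
    by (subst emeasure_distr)
       (auto intro!: arg_cong2[where f = emeasure] simp: space_PiM mem_box_cart PiE_def Pi_def)
  also have "\<dots> = (\<Prod>i\<in>UNIV. ennreal (u $ i - l $ i))"
    using lu by (simp add: emeasure_PiM)
  also have "\<dots> = ennreal (\<Prod>i\<in>UNIV. u $ i - l $ i)"
    using lu by (intro prod_ennreal) simp
  also have "(\<Prod>i\<in>UNIV. u $ i - l $ i) = (\<Prod>b\<in>Basis. (u - l) \<bullet> b)"
    by (rule prod.reindex_bij_witness[symmetric, where i = "\<lambda>i. axis i 1" and j = "axis_index"])
       (auto simp: axis_index inner_axis Basis_vec_def axis_eq_axis)
  finally show "emeasure (distr (lebesgue_PiM UNIV) borel (\<lambda>z. \<chi> i. z i)) (box l u) = (\<Prod>b\<in>Basis. (u - l) \<bullet> b)" .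
qed simp

lemma gauss_PiM_density:
  fixes J :: "'n set"
  assumes J: "finite J"
  shows "gauss_PiM J = density (lebesgue_PiM J) (\<lambda>z. \<Prod>i\<in>J. ennreal (std_normal_density (z i)))"
proof (rule product_sigma_finite.PiM_eqI[OF product_sigma_finite_std_normal J, symmetric])
  interpret L: product_sigma_finite "\<lambda>_::'n. lborel :: real measure" by (rule product_sigma_finite_lborel)
  show "sets (density (lebesgue_PiM J) (\<lambda>z. \<Prod>i\<in>J. ennreal (std_normal_density (z i)))) = sets (gauss_PiM J)"
    by (simp cong: sets_PiM_cong)
  fix A :: "'n \<Rightarrow> real set" assume "\<And>i. i \<in> J \<Longrightarrow> A i \<in> sets std_normal_distribution"
  then have A: "\<And>i. i \<in> J \<Longrightarrow> A i \<in> sets borel" by simp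
  have "emeasure (density (lebesgue_PiM J) (\<lambda>z. \<Prod>i\<in>J. ennreal (std_normal_density (z i)))) (Pi\<^sub>E J A)
      = (\<integral>\<^sup>+z. (\<Prod>i\<in>J. ennreal (std_normal_density (z i))) * indicator (Pi\<^sub>E J A) z \<partial>lebesgue_PiM J)"
    using J A by (intro emeasure_density sets_PiM_I_finite) auto
  also have "\<dots> = (\<integral>\<^sup>+z. (\<Prod>i\<in>J. ennreal (std_normal_density (z i)) * indicator (A i) (z i)) \<partial>lebesgue_PiM J)"
    using J by (intro nn_integral_cong)
      (auto simp: prod.distrib space_PiM PiE_def Pi_def indicator_def prod_zero_iff split: if_splits intro!: prod_zero)
  also have "\<dots> = (\<Prod>i\<in>J. \<integral>\<^sup>+x. ennreal (std_normal_density x) * indicator (A i) x \<partial>lborel)"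
    using J A by (intro L.product_nn_integral_prod) auto
  also have "\<dots> = (\<Prod>i\<in>J. emeasure std_normal_distribution (A i))"
    using A by (intro prod.cong refl) (simp add: emeasure_density)
  finally show "emeasure (density (lebesgue_PiM J) (\<lambda>z. \<Prod>i\<in>J. ennreal (std_normal_density (z i)))) (Pi\<^sub>E J A)
      = (\<Prod>i\<in>J. emeasure std_normal_distribution (A i))" .
qed

lemma std_normal_density_prod:
  fixes z :: "'n::finite \<Rightarrow> real"
  shows "(\<Prod>i\<in>UNIV. ennreal (std_normal_density (z i)))
    = ennreal ((1 / sqrt (2 * pi)) ^ CARD('n) * exp (- (norm (\<chi> i. z i :: real ^ 'n))\<^sup>2 / 2))"
proof -
  have "(norm (\<chi> i. z i :: real ^ 'n))\<^sup>2 = (\<Sum>i\<in>UNIV. (z i)\<^sup>2)"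
    by (simp add: norm_vec_def L2_set_def sum_nonneg)
  then show ?thesis
    by (simp add: prod_ennreal normal_density_def exp_sum[symmetric] sum_divide_distrib sum_negf prod_dividef power_one_over)
qed

lemma nn_integral_gauss:
  fixes h :: "real ^ 'n \<Rightarrow> ennreal"
  assumes [measurable]: "h \<in> borel_measurable borel"
  shows "(\<integral>\<^sup>+z. h (\<chi> i. z i) \<partial>gauss_PiM UNIV)
    = ennreal ((1 / sqrt (2 * pi)) ^ CARD('n)) * (\<integral>\<^sup>+x. ennreal (exp (- (norm x)\<^sup>2 / 2)) * h x \<partial>lborel)"
proof -
  have "(\<integral>\<^sup>+z. h (\<chi> i. z i) \<partial>gauss_PiM UNIV) = (\<integral>\<^sup>+z. (\<Prod>i\<in>UNIV. ennreal (std_normal_density (z i))) * h (\<chi> i. z i) \<partial>lebesgue_PiM UNIV)"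
    unfolding gauss_PiM_density[OF finite] by (subst nn_integral_density) auto
  also have "\<dots> = (\<integral>\<^sup>+x. ennreal ((1 / sqrt (2 * pi)) ^ CARD('n)) * (ennreal (exp (- (norm x)\<^sup>2 / 2)) * h x) \<partial>distr (lebesgue_PiM UNIV) borel (\<lambda>z. \<chi> i. z i))"
    unfolding std_normal_density_prod
    by (subst nn_integral_distr) (auto simp: ennreal_mult mult_ac intro!: nn_integral_cong)
  finally show ?thesis
    unfolding distr_lebesgue_PiM by (simp add: nn_integral_cmult)
qed

text \<open>The density depends on the norm alone, so an orthogonal map can only introduce the
  constant of the linear change of variables. Testing with the constant function \<open>1\<close>
  shows \<open>c = 1\<close>, and no determinant has to be computed.\<close>

lemma nn_integral_gauss_orthogonal:
  fixes h :: "real ^ 'n \<Rightarrow> ennreal" and f :: "real ^ 'n \<Rightarrow> real ^ 'n"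
  assumes f: "orthogonal_transformation f" and [measurable]: "h \<in> borel_measurable borel"
  shows "(\<integral>\<^sup>+z. h (f (\<chi> i. z i)) \<partial>gauss_PiM UNIV) = (\<integral>\<^sup>+z. h (\<chi> i. z i) \<partial>gauss_PiM UNIV)"
proof -
  have lin: "linear f" and nrm: "norm (f x) = norm x" for x
    using f by (auto simp: orthogonal_transformation)
  then have [measurable]: "f \<in> borel_measurable borel" by (simp add: linear_borel_measurable)
  have "f (inv f x) = x" for x
    using orthogonal_transformation_surj[OF f] by (simp add: surj_f_inv_f)
  then obtain c where c: "\<And>k. k \<in> borel_measurable borel \<Longrightarrow>
      (\<integral>\<^sup>+x. k (f x) \<partial>lborel) = c * (\<integral>\<^sup>+x. k x \<partial>lborel)"
    using nn_integral_lborel_linear[OF lin] by metis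
  have rot: "(\<integral>\<^sup>+z. k (f (\<chi> i. z i)) \<partial>gauss_PiM UNIV) = c * (\<integral>\<^sup>+z. k (\<chi> i. z i) \<partial>gauss_PiM UNIV)"
    if [measurable]: "k \<in> borel_measurable borel" for k :: "real ^ 'n \<Rightarrow> ennreal"
  proof -
    have "(\<integral>\<^sup>+x. ennreal (exp (- (norm x)\<^sup>2 / 2)) * k (f x) \<partial>lborel)
        = (\<integral>\<^sup>+x. ennreal (exp (- (norm (f x))\<^sup>2 / 2)) * k (f x) \<partial>lborel)" by (simp add: nrm)
    also have "\<dots> = c * (\<integral>\<^sup>+x. ennreal (exp (- (norm x)\<^sup>2 / 2)) * k x \<partial>lborel)"
      by (rule c) measurable
    finally show ?thesis
      by (simp add: nn_integral_gauss[of k] nn_integral_gauss[of "\<lambda>x. k (f x)"] mult.left_commute)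
  qed
  have "prob_space (gauss_PiM (UNIV :: 'n set))" by (intro prob_space_PiM prob_space_std_normal)
  then have "c = 1"
    using rot[of "\<lambda>_. 1"] by (simp add: prob_space.emeasure_space_1)
  then show ?thesis using rot[of h] by simp
qed

section \<open>Polar coordinates for a studentized variable\<close>

definition zeta :: "real \<Rightarrow> real \<Rightarrow> real \<Rightarrow> real" where
  "zeta \<nu> u r = sqrt (r / (\<nu> + u\<^sup>2))"

lemma zeta_measurable [measurable]:
  assumes [measurable]: "f \<in> borel_measurable M" "g \<in> borel_measurable M"
  shows "(\<lambda>x. zeta \<nu> (f x) (g x)) \<in> borel_measurable M"
  unfolding zeta_def by measurable

lemma zeta_pos: "\<nu> > 0 \<Longrightarrow> r > 0 \<Longrightarrow> zeta \<nu> u r > 0"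
  unfolding zeta_def by (simp add: add_pos_nonneg)

lemma zeta_antimono:
  assumes "\<nu> > 0" "r > 0" "\<bar>u\<bar> \<le> \<bar>v\<bar>"
  shows "zeta \<nu> v r \<le> zeta \<nu> u r"
proof -
  have "u\<^sup>2 \<le> v\<^sup>2" using assms(3) by (simp add: abs_le_square_iff)
  then show ?thesis
    unfolding zeta_def using assms by (intro real_sqrt_le_mono divide_left_mono) (auto intro!: add_pos_nonneg mult_pos_pos)
qed

text \<open>The square of \<open>x * zeta \<nu> x r\<close> is \<open>r\<close> times
  \<open>x\<^sup>2 / (\<nu> + x\<^sup>2)\<close>, which grows with
  \<open>\<bar>x\<bar>\<close>.\<close>

lemma abs_mult_zeta_mono:
  assumes "\<nu> > 0" "r > 0" "\<bar>u\<bar> \<le> \<bar>v\<bar>"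
  shows "\<bar>u * zeta \<nu> u r\<bar> \<le> \<bar>v * zeta \<nu> v r\<bar>"
proof -
  have uv: "u\<^sup>2 \<le> v\<^sup>2" using assms(3) by (simp add: abs_le_square_iff)
  have pos: "\<nu> + u\<^sup>2 > 0" "\<nu> + v\<^sup>2 > 0" using assms by (auto intro: add_pos_nonneg)
  have "u\<^sup>2 * \<nu> \<le> v\<^sup>2 * \<nu>" using uv assms(1) by (intro mult_right_mono) auto
  then have "u\<^sup>2 / (\<nu> + u\<^sup>2) \<le> v\<^sup>2 / (\<nu> + v\<^sup>2)"
    using pos by (simp add: field_simps)
  then have "r * (u\<^sup>2 / (\<nu> + u\<^sup>2)) \<le> r * (v\<^sup>2 / (\<nu> + v\<^sup>2))"
    using assms(2) by (intro mult_left_mono) auto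
  moreover have "(x * zeta \<nu> x r)\<^sup>2 = r * (x\<^sup>2 / (\<nu> + x\<^sup>2))" for x
    unfolding zeta_def power_mult_distrib using assms by (simp add: add_nonneg_nonneg)
  ultimately show ?thesis by (simp add: abs_le_square_iff)
qed

text \<open>In the substituted variables \<open>u = x / z\<close> and \<open>r = x\<^sup>2 + \<nu> z\<^sup>2\<close> the density of a standard normal
  variable and an independent \<open>\<chi>\<^sub>\<nu> / sqrt \<nu>\<close> variable is a product.\<close>

lemma student_polar:
  assumes \<nu>: "\<nu> > 0"
  obtains w k :: "real \<Rightarrow> ennreal" where
    "w \<in> borel_measurable borel" "k \<in> borel_measurable borel" "\<And>r. r \<le> 0 \<Longrightarrow> k r = 0"
    "\<And>g. case_prod g \<in> borel_measurable (borel \<Otimes>\<^sub>M borel) \<Longrightarrow>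
      (\<integral>\<^sup>+y. \<integral>\<^sup>+x. ennreal (chi_square_density \<nu> y) * (ennreal (std_normal_density x) * g x (sqrt (y / \<nu>))) \<partial>lborel \<partial>lborel)
      = (\<integral>\<^sup>+u. \<integral>\<^sup>+r. w u * (k r * g (u * zeta \<nu> u r) (zeta \<nu> u r)) \<partial>lborel \<partial>lborel)"
proof -
  \<comment> \<open>With \<open>y\<close> standing for \<open>\<nu> * Z\<^sup>2\<close>, at fixed
    \<open>u\<close> the substitution is \<open>y = \<theta> u * r\<close>; so
    \<open>\<theta> u\<close> is also its Jacobian.\<close>
  define \<theta> where "\<theta> u = \<nu> / (\<nu> + u\<^sup>2)" for u
  have den: "\<nu> + u\<^sup>2 > 0" for u using \<nu> by (simp add: add_pos_nonneg)
  have \<theta>: "\<theta> u > 0" for u unfolding \<theta>_def using \<nu> den by simp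
  have \<theta>_zeta: "sqrt (\<theta> u * r / \<nu>) = zeta \<nu> u r" for u r
    unfolding \<theta>_def zeta_def using \<nu> by simp
  define c where "c = 2 powr (\<nu> / 2) * Gamma (\<nu> / 2)"
  have c: "c > 0" unfolding c_def using \<nu> by (simp add: Gamma_real_pos)
  have chi: "chi_square_density \<nu> y = (if y > 0 then y powr (\<nu> / 2 - 1) * exp (- y / 2) / c else 0)" for y
    by (simp add: chi_square_density_def c_def)
  then have chi_nn: "chi_square_density \<nu> y \<ge> 0" for y using c by simp
  have [measurable]: "chi_square_density \<nu> \<in> borel_measurable borel"
    unfolding chi by measurable
  \<comment> \<open>The three factors come from the Jacobian of \<open>y\<close>, the power in the
    chi-square density, and the Jacobian \<open>sqrt (y / \<nu>)\<close> of
    \<open>x = u * sqrt (y / \<nu>)\<close>. Up to constants \<open>w\<close> is the Student density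
    with \<nu> degrees of freedom and \<open>k\<close> the chi-square density with
    \<open>\<nu> + 1\<close>.\<close>
  define w where "w u = \<theta> u * (\<theta> u powr (\<nu> / 2 - 1)) * sqrt (\<theta> u)" for u
  define k where "k r = (if r > 0 then r powr (\<nu> / 2 - 1) * sqrt (r / \<nu>) * exp (- r / 2) / (c * sqrt (2 * pi)) else 0)" for r
  have w_nn: "w u \<ge> 0" for u unfolding w_def using \<theta>[of u] by simp
  have k_nn: "k r \<ge> 0" for r unfolding k_def using c \<nu> by simp
  have split: "\<theta> u * (zeta \<nu> u r * chi_square_density \<nu> (\<theta> u * r) * std_normal_density (u * zeta \<nu> u r)) = w u * k r" for u r
  proof (cases "r > 0")
    case False
    then have "\<not> \<theta> u * r > 0" using \<theta>[of u] by (simp add: zero_less_mult_iff)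
    then show ?thesis using False by (simp add: chi k_def)
  next
    case True
    then have pos: "\<theta> u * r > 0" using \<theta> by simp
    have sq: "(u * zeta \<nu> u r)\<^sup>2 = u\<^sup>2 * r / (\<nu> + u\<^sup>2)"
      unfolding zeta_def power_mult_distrib using True den[of u] by simp
    have "\<theta> u * r + (u * zeta \<nu> u r)\<^sup>2 = r"
      unfolding sq \<theta>_def using den[of u]
      by (simp add: add_divide_distrib[symmetric] distrib_right[symmetric])
    then have "exp (- (\<theta> u * r) / 2) * exp (- (u * zeta \<nu> u r)\<^sup>2 / 2) = exp (- r / 2)"
      unfolding exp_add[symmetric] by (simp add: field_simps)
    moreover have "zeta \<nu> u r = sqrt (\<theta> u) * sqrt (r / \<nu>)"
      unfolding \<theta>_zeta[symmetric] by (simp add: real_sqrt_mult real_sqrt_divide)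
    moreover have "(\<theta> u * r) powr (\<nu> / 2 - 1) = \<theta> u powr (\<nu> / 2 - 1) * r powr (\<nu> / 2 - 1)"
      using \<theta>[of u] True by (simp add: powr_mult)
    ultimately show ?thesis
      using True pos unfolding chi w_def k_def normal_density_def
      by (simp add: field_simps)
  qed
  have chi_0: "chi_square_density \<nu> y = 0" if "y \<le> 0" for y using that by (simp add: chi)
  show thesis
  proof
    show "(\<lambda>u. ennreal (w u)) \<in> borel_measurable borel" "(\<lambda>r. ennreal (k r)) \<in> borel_measurable borel"
      unfolding w_def k_def \<theta>_def by measurable
    show "ennreal (k r) = 0" if "r \<le> 0" for r using that by (simp add: k_def)
    fix g :: "real \<Rightarrow> real \<Rightarrow> ennreal"
    assume [measurable]: "case_prod g \<in> borel_measurable (borel \<Otimes>\<^sub>M borel)"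
    let ?G = "\<lambda>u y. ennreal (sqrt (y / \<nu>) * chi_square_density \<nu> y * std_normal_density (u * sqrt (y / \<nu>))) * g (u * sqrt (y / \<nu>)) (sqrt (y / \<nu>))"
    have "(\<integral>\<^sup>+y. \<integral>\<^sup>+x. ennreal (chi_square_density \<nu> y) * (ennreal (std_normal_density x) * g x (sqrt (y / \<nu>))) \<partial>lborel \<partial>lborel)
        = (\<integral>\<^sup>+y. \<integral>\<^sup>+u. ?G u y \<partial>lborel \<partial>lborel)"
    proof (rule nn_integral_cong)
      fix y :: real
      show "(\<integral>\<^sup>+x. ennreal (chi_square_density \<nu> y) * (ennreal (std_normal_density x) * g x (sqrt (y / \<nu>))) \<partial>lborel) = (\<integral>\<^sup>+u. ?G u y \<partial>lborel)"
      proof (cases "y > 0")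
        case True
        then have s: "sqrt (y / \<nu>) > 0" using \<nu> by simp
        show ?thesis
          by (subst nn_integral_real_affine[where c = "sqrt (y / \<nu>)" and t = 0])
             (use s chi_nn in \<open>auto simp: nn_integral_cmult[symmetric] ennreal_mult mult_ac intro!: nn_integral_cong\<close>)
      qed (simp add: chi_0)
    qed
    also have "\<dots> = (\<integral>\<^sup>+u. \<integral>\<^sup>+y. ?G u y \<partial>lborel \<partial>lborel)"
      by (rule lborel_pair.Fubini') measurable
    also have "\<dots> = (\<integral>\<^sup>+u. \<integral>\<^sup>+r. ennreal (w u) * (ennreal (k r) * g (u * zeta \<nu> u r) (zeta \<nu> u r)) \<partial>lborel \<partial>lborel)"
    proof (rule nn_integral_cong)
      fix u :: real
      have "(\<integral>\<^sup>+y. ?G u y \<partial>lborel) = \<theta> u * (\<integral>\<^sup>+r. ?G u (\<theta> u * r) \<partial>lborel)"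
        by (subst nn_integral_real_affine[where c = "\<theta> u" and t = 0]) (use \<theta>[of u] in auto)
      also have "\<dots> = (\<integral>\<^sup>+r. \<theta> u * ?G u (\<theta> u * r) \<partial>lborel)"
        by (rule nn_integral_cmult[symmetric]) measurable
      also have "\<dots> = (\<integral>\<^sup>+r. ennreal (w u) * (ennreal (k r) * g (u * zeta \<nu> u r) (zeta \<nu> u r)) \<partial>lborel)"
        unfolding \<theta>_zeta mult.assoc[symmetric, of "ennreal _"]
        by (simp only: ennreal_mult'[OF less_imp_le[OF \<theta>], symmetric] split ennreal_mult'[OF w_nn, symmetric])
      finally show "(\<integral>\<^sup>+y. ?G u y \<partial>lborel) = (\<integral>\<^sup>+r. ennreal (w u) * (ennreal (k r) * g (u * zeta \<nu> u r) (zeta \<nu> u r)) \<partial>lborel)" .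
    qed
    finally show "(\<integral>\<^sup>+y. \<integral>\<^sup>+x. ennreal (chi_square_density \<nu> y) * (ennreal (std_normal_density x) * g x (sqrt (y / \<nu>))) \<partial>lborel \<partial>lborel)
      = (\<integral>\<^sup>+u. \<integral>\<^sup>+r. ennreal (w u) * (ennreal (k r) * g (u * zeta \<nu> u r) (zeta \<nu> u r)) \<partial>lborel \<partial>lborel)" .
  qed
qed

text \<open>The \<open>w\<close>-average of \<open>q\<close> can only drop when \<open>B\<close> is
  enlarged by points where \<open>q\<close> is no larger than on \<open>B\<close>. Pairs inside
  \<open>B\<close> contribute equally to both sides; pairs from \<open>C - B\<close> and
  \<open>B\<close> are compared pointwise.\<close>

lemma nn_integral_ratio_mono:
  fixes w q :: "'a \<Rightarrow> ennreal"
  assumes [measurable]: "w \<in> borel_measurable N" "q \<in> borel_measurable N" "B \<in> sets N" "C \<in> sets N"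
    and "B \<subseteq> C" and q: "\<And>u v. u \<in> B \<Longrightarrow> v \<in> C - B \<Longrightarrow> q v \<le> q u"
  shows "(\<integral>\<^sup>+u. w u * q u * indicator C u \<partial>N) * (\<integral>\<^sup>+u. w u * indicator B u \<partial>N)
    \<le> (\<integral>\<^sup>+u. w u * q u * indicator B u \<partial>N) * (\<integral>\<^sup>+u. w u * indicator C u \<partial>N)"
proof -
  have split: "(\<integral>\<^sup>+u. h u * indicator C u \<partial>N) = (\<integral>\<^sup>+u. h u * indicator B u \<partial>N) + (\<integral>\<^sup>+u. h u * indicator (C - B) u \<partial>N)"
    if [measurable]: "h \<in> borel_measurable N" for h :: "'a \<Rightarrow> ennreal"
    using \<open>B \<subseteq> C\<close> by (subst nn_integral_add[symmetric]) (auto intro!: nn_integral_cong simp: indicator_def)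
  have "(\<integral>\<^sup>+v. w v * q v * indicator (C - B) v \<partial>N) * (\<integral>\<^sup>+u. w u * indicator B u \<partial>N)
      = (\<integral>\<^sup>+v. \<integral>\<^sup>+u. (w v * q v * indicator (C - B) v) * (w u * indicator B u) \<partial>N \<partial>N)"
    by (simp add: nn_integral_cmult nn_integral_multc)
  also have "\<dots> \<le> (\<integral>\<^sup>+v. \<integral>\<^sup>+u. (w v * indicator (C - B) v) * (w u * q u * indicator B u) \<partial>N \<partial>N)"
    using q by (intro nn_integral_mono) (auto simp: indicator_def mult_ac intro!: mult_right_mono)
  also have "\<dots> = (\<integral>\<^sup>+u. w u * q u * indicator B u \<partial>N) * (\<integral>\<^sup>+v. w v * indicator (C - B) v \<partial>N)"
    by (simp add: nn_integral_cmult nn_integral_multc mult.commute)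
  finally show ?thesis
    by (simp add: split distrib_left distrib_right add_left_mono)
qed

text \<open>Serves twice for the slices at \<open>X $ i = x\<close>: with \<open>t = 0\<close> for
  reflections of the other coordinates, with \<open>s = 1\<close> for the translation that completes
  a square.\<close>

lemma nn_integral_lebesgue_PiM_affine:
  fixes J :: "'n set" and s t :: "'n \<Rightarrow> real"
  assumes J: "finite J" and s: "\<And>i. \<bar>s i\<bar> = 1" and h[measurable]: "h \<in> borel_measurable (lebesgue_PiM J)"
  shows "(\<integral>\<^sup>+z. h (\<lambda>i\<in>J. t i + s i * z i) \<partial>lebesgue_PiM J) = (\<integral>\<^sup>+z. h z \<partial>lebesgue_PiM J)"
proof -
  interpret product_sigma_finite "\<lambda>_::'n. lborel :: real measure" by (rule product_sigma_finite_lborel)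
  let ?f = "\<lambda>z. \<lambda>i\<in>J. t i + s i * z i"
  have f[measurable]: "?f \<in> measurable (lebesgue_PiM J) (lebesgue_PiM J)"
    by measurable
  have "distr (lebesgue_PiM J) (lebesgue_PiM J) ?f = lebesgue_PiM J"
  proof (rule PiM_eqI[OF J])
    fix A :: "'n \<Rightarrow> real set" assume "\<And>i. i \<in> J \<Longrightarrow> A i \<in> sets lborel"
    then have A: "A i \<in> sets borel" if "i \<in> J" for i using that by simp
    have A': "(\<lambda>x. t i + s i * x) -` A i \<in> sets borel" if "i \<in> J" for i
    proof -
      have "(\<lambda>x. t i + s i * x) \<in> borel_measurable borel" by measurable
      from measurable_sets[OF this A[OF that]] show ?thesis by simp
    qed
    have "emeasure (distr (lebesgue_PiM J) (lebesgue_PiM J) ?f) (Pi\<^sub>E J A)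
        = emeasure (lebesgue_PiM J) (Pi\<^sub>E J (\<lambda>i. (\<lambda>x. t i + s i * x) -` A i))"
      using J A by (subst emeasure_distr[OF f])
        (auto intro!: sets_PiM_I_finite arg_cong2[where f = emeasure] simp: space_PiM PiE_iff)
    also have "\<dots> = (\<Prod>i\<in>J. emeasure lborel ((\<lambda>x. t i + s i * x) -` A i))"
      using J A' by (intro emeasure_PiM) auto
    also have "\<dots> = (\<Prod>i\<in>J. emeasure lborel (A i))"
    proof (intro prod.cong refl)
      fix i assume "i \<in> J"
      note A[OF this, measurable] A'[OF this, measurable]
      have "s i \<noteq> 0" using s[of i] by auto
      have "emeasure lborel (A i) = (\<integral>\<^sup>+x. indicator (A i) x \<partial>lborel)" by simp
      also have "\<dots> = (\<integral>\<^sup>+x. indicator (A i) (t i + s i * x) \<partial>lborel)"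
        by (subst nn_integral_real_affine[OF _ \<open>s i \<noteq> 0\<close>, of _ "t i"]) (auto simp: s)
      also have "\<dots> = (\<integral>\<^sup>+x. indicator ((\<lambda>x. t i + s i * x) -` A i) x \<partial>lborel)"
        by (intro nn_integral_cong) (simp add: indicator_def)
      finally show "emeasure lborel ((\<lambda>x. t i + s i * x) -` A i) = emeasure lborel (A i)" by simp
    qed
    finally show "emeasure (distr (lebesgue_PiM J) (lebesgue_PiM J) ?f) (Pi\<^sub>E J A) = (\<Prod>i\<in>J. emeasure lborel (A i))" .
  qed simp
  then have "(\<integral>\<^sup>+z. h z \<partial>lebesgue_PiM J) = (\<integral>\<^sup>+z. h z \<partial>distr (lebesgue_PiM J) (lebesgue_PiM J) ?f)" by simp
  also have "\<dots> = (\<integral>\<^sup>+z. h (?f z) \<partial>lebesgue_PiM J)"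
    by (subst nn_integral_distr) auto
  finally show ?thesis ..
qed

section \<open>Conditioning a normal vector on one coordinate\<close>

text \<open>The standard normal source may be rotated freely. Row \<open>i\<close> of
  \<open>A\<close> has length \<open>1\<close> because the variance is \<open>1\<close>, so an
  orthogonal \<open>f\<close> takes the \<open>i\<close>-th axis to it. Then source coordinate
  \<open>i\<close> is \<open>X $ i\<close> itself, and column \<open>i\<close> of
  \<open>A ** matrix f\<close> consists of the covariances with it. Singular \<open>S\<close> is
  included.\<close>

lemma multivariate_normal_rotate:
  fixes X :: "'a \<Rightarrow> real ^ 'n"
  assumes X: "multivariate_normal M X 0 S" and i: "S $ i $ i = 1"
  obtains B :: "real ^ 'n ^ 'n" where "\<And>k. B $ k $ i = S $ k $ i" "\<And>z. (B *v z) $ i = z $ i"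
    "\<And>h. h \<in> borel_measurable borel \<Longrightarrow>
      (\<integral>\<^sup>+x. h x \<partial>distr M borel X) = (\<integral>\<^sup>+z. h (B *v (\<chi> k. z k)) \<partial>gauss_PiM UNIV)"
proof -
  obtain A :: "real ^ 'n ^ 'n" where A: "A ** transpose A = S"
    and law: "distr M borel X = distr (gauss_PiM UNIV) borel (\<lambda>z. 0 + A *v (\<chi> i. z i))"
    using X unfolding multivariate_normal_def by blast
  have S: "S $ k $ l = (A $ k) \<bullet> (A $ l)" for k l
    unfolding A[symmetric] matrix_matrix_mult_def transpose_def inner_vec_def by simp
  have "norm (axis i 1 :: real ^ 'n) = norm (A $ i)"
    using i S[of i i] by (simp add: norm_eq_sqrt_inner inner_axis_axis)
  then obtain f :: "real ^ 'n \<Rightarrow> real ^ 'n" where f: "orthogonal_transformation f" "f (axis i 1) = A $ i"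
    by (rule orthogonal_transformation_exists)
  have lin: "linear f" using f by (simp add: orthogonal_transformation_linear)
  have inner_f: "f x \<bullet> f y = x \<bullet> y" for x y using f by (simp add: orthogonal_transformation_def)
  define B where "B = A ** matrix f"
  have B: "B *v z = A *v f z" for z
    by (simp add: B_def matrix_vector_mul_assoc[symmetric] matrix_works lin)
  have Ai: "(A *v z) $ k = (A $ k) \<bullet> z" for z k
    by (simp add: matrix_vector_mul_component)
  show thesis
  proof
    show "(B *v z) $ i = z $ i" for z
      unfolding B Ai f(2)[symmetric] inner_f by (simp add: inner_axis')
    show "B $ k $ i = S $ k $ i" for k
    proof -
      have "B $ k $ i = (B *v axis i 1) $ k"
        by (simp add: matrix_vector_mult_basis column_def)
      then show ?thesis by (simp add: B Ai f(2) S)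
    qed
    fix h :: "real ^ 'n \<Rightarrow> ennreal" assume [measurable]: "h \<in> borel_measurable borel"
    have [measurable]: "(\<lambda>x. A *v x) \<in> borel_measurable borel"
      by (rule linear_borel_measurable) (rule matrix_vector_mul_linear)
    have "(\<integral>\<^sup>+x. h x \<partial>distr M borel X) = (\<integral>\<^sup>+z. h (A *v (\<chi> i. z i)) \<partial>gauss_PiM UNIV)"
      unfolding law by (subst nn_integral_distr) auto
    also have "\<dots> = (\<integral>\<^sup>+z. h (A *v f (\<chi> i. z i)) \<partial>gauss_PiM UNIV)"
      by (rule nn_integral_gauss_orthogonal[OF f(1), symmetric]) measurable
    finally show "(\<integral>\<^sup>+x. h x \<partial>distr M borel X) = (\<integral>\<^sup>+z. h (B *v (\<chi> k. z k)) \<partial>gauss_PiM UNIV)"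
      by (simp add: B)
  qed
qed

lemma nn_integral_gauss_PiM_split:
  fixes h :: "('n::finite \<Rightarrow> real) \<Rightarrow> ennreal"
  assumes [measurable]: "h \<in> borel_measurable (lebesgue_PiM UNIV)"
  shows "(\<integral>\<^sup>+z. h z \<partial>gauss_PiM UNIV)
    = (\<integral>\<^sup>+x. ennreal (std_normal_density x) * (\<integral>\<^sup>+z. h (z(i := x)) \<partial>gauss_PiM (- {i})) \<partial>lborel)"
proof -
  interpret product_sigma_finite "\<lambda>_::'n. std_normal_distribution" by (rule product_sigma_finite_std_normal)
  have U: "UNIV = insert i (- {i})" by auto
  interpret J: sigma_finite_measure "gauss_PiM (- {i})" by (rule sigma_finite) simp
  have hm: "h \<in> borel_measurable (lebesgue_PiM (insert i (- {i})))" using assms U by simp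
  then have hm': "h \<in> borel_measurable (gauss_PiM (insert i (- {i})))"
    by (simp cong: measurable_cong_sets sets_PiM_cong)
  have meas: "(\<lambda>(x, z). h (z(i := x))) \<in> borel_measurable (borel \<Otimes>\<^sub>M gauss_PiM (- {i}))"
    using hm' by measurable
  have "(\<integral>\<^sup>+z. h z \<partial>gauss_PiM UNIV) = (\<integral>\<^sup>+x. (\<integral>\<^sup>+z. h (z(i := x)) \<partial>gauss_PiM (- {i})) \<partial>std_normal_distribution)"
    using product_nn_integral_insert_rev[OF _ _ hm'] by (simp flip: U)
  also have "\<dots> = (\<integral>\<^sup>+x. ennreal (std_normal_density x) * (\<integral>\<^sup>+z. h (z(i := x)) \<partial>gauss_PiM (- {i})) \<partial>lborel)"
    using meas by (subst nn_integral_density) (auto simp: split_beta')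
  finally show ?thesis .
qed

lemma nn_integral_lebesgue_PiM_split:
  fixes h :: "('n::finite \<Rightarrow> real) \<Rightarrow> ennreal"
  assumes h: "h \<in> borel_measurable (lebesgue_PiM UNIV)"
  shows "(\<integral>\<^sup>+z. h z \<partial>lebesgue_PiM UNIV) = (\<integral>\<^sup>+x. (\<integral>\<^sup>+z. h (z(i := x)) \<partial>lebesgue_PiM (- {i})) \<partial>lborel)"
proof -
  interpret product_sigma_finite "\<lambda>_::'n. lborel :: real measure" by (rule product_sigma_finite_lborel)
  have U: "UNIV = insert i (- {i})" by auto
  have "h \<in> borel_measurable (lebesgue_PiM (insert i (- {i})))" using h U by simp
  from product_nn_integral_insert_rev[OF _ _ this] show ?thesis by (simp flip: U)
qed

section \<open>Precision matrices and the density of a non-singular normal vector\<close>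

lemma matrix_inv_mult:
  fixes A :: "real ^ 'n ^ 'n"
  assumes "invertible A"
  shows "A ** matrix_inv A = mat 1" "matrix_inv A ** A = mat 1"
  using someI_ex[OF assms[unfolded invertible_def]] unfolding matrix_inv_def by auto

text \<open>\<open>transpose A ** matrix_inv S\<close> is a right inverse of \<open>A\<close>, so
  \<open>A\<close> is invertible and the precision matrix factors as
  \<open>transpose (matrix_inv A) ** matrix_inv A\<close>. Its symmetry and the form of its
  quadratic form follow.\<close>

lemma invertible_factor:
  fixes A S :: "real ^ 'n ^ 'n"
  assumes A: "A ** transpose A = S" and S: "invertible S"
  shows "x \<bullet> (matrix_inv S *v x) = (norm (matrix_inv A *v x))\<^sup>2"
    and "matrix_inv A ** A = mat 1" "A ** matrix_inv A = mat 1"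
    and "transpose (matrix_inv S) = matrix_inv S"
proof -
  have SQ: "S ** matrix_inv S = mat 1" "matrix_inv S ** S = mat 1"
    using S by (simp_all add: matrix_inv_mult)
  have "A ** (transpose A ** matrix_inv S) = mat 1"
    using SQ by (simp add: A matrix_mul_assoc)
  then have "invertible A" using invertible_right_inverse by blast
  then show AI: "matrix_inv A ** A = mat 1" "A ** matrix_inv A = mat 1"
    by (simp_all add: matrix_inv_mult)
  let ?P = "transpose (matrix_inv A) ** matrix_inv A"
  have "?P ** S = transpose (matrix_inv A) ** (matrix_inv A ** A) ** transpose A"
    unfolding A[symmetric] by (simp only: matrix_mul_assoc)
  also have "\<dots> = transpose (A ** matrix_inv A)"
    by (simp only: AI(1) matrix_mul_rid matrix_transpose_mul)
  finally have "?P ** S = mat 1" by (simp add: AI transpose_mat)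
  then have "?P ** S ** matrix_inv S = matrix_inv S" by simp
  then have P: "?P = matrix_inv S"
    by (simp add: matrix_mul_assoc[symmetric] SQ)
  show "transpose (matrix_inv S) = matrix_inv S"
    unfolding P[symmetric] by (simp add: matrix_transpose_mul)
  have "x \<bullet> (transpose (matrix_inv A) *v y) = (matrix_inv A *v x) \<bullet> y" for y
    by (metis dot_lmul_matrix inner_commute vector_transpose_matrix transpose_transpose)
  then show "x \<bullet> (matrix_inv S *v x) = (norm (matrix_inv A *v x))\<^sup>2"
    unfolding P[symmetric] power2_norm_eq_inner matrix_vector_mul_assoc[symmetric] by simp
qed

lemma quad_form_inner: "quad_form Q x = (\<chi> k. x k) \<bullet> (Q *v (\<chi> k. x k))"
  unfolding quad_form_def inner_vec_def matrix_vector_mult_def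
  by (simp add: sum_distrib_left mult_ac)

lemma quad_form_measurable [measurable (raw)]:
  assumes [measurable]: "\<And>i. (\<lambda>x. f x i) \<in> borel_measurable M"
  shows "(\<lambda>x. quad_form Q (f x)) \<in> borel_measurable M"
  unfolding quad_form_def by measurable

lemma folded_measurable [measurable (raw)]:
  assumes [measurable]: "\<And>i. (\<lambda>x. f x i) \<in> borel_measurable M"
  shows "(\<lambda>x. folded Q (f x)) \<in> borel_measurable M"
  unfolding folded_def quad_form_def by measurable

text \<open>The unspecified \<open>c\<close> absorbs the normalization and the determinant; later
  comparisons carry it on both sides.\<close>

lemma multivariate_normal_density:
  fixes X :: "'a \<Rightarrow> real ^ 'n"
  assumes X: "multivariate_normal M X 0 S" and S: "invertible S"
  obtains c where "\<And>h. h \<in> borel_measurable borel \<Longrightarrow>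
      (\<integral>\<^sup>+x. h x \<partial>distr M borel X)
      = c * (\<integral>\<^sup>+z. ennreal (exp (- quad_form (matrix_inv S) z / 2)) * h (\<chi> k. z k) \<partial>lebesgue_PiM UNIV)"
proof -
  obtain A :: "real ^ 'n ^ 'n" where A: "A ** transpose A = S"
    and law: "distr M borel X = distr (gauss_PiM UNIV) borel (\<lambda>z. 0 + A *v (\<chi> i. z i))"
    using X unfolding multivariate_normal_def by blast
  note inv = invertible_factor[OF A S]
  have lin: "linear (\<lambda>x. A *v x)" "linear (\<lambda>x. matrix_inv A *v x)" by (rule matrix_vector_mul_linear)+
  note [measurable] = lin[THEN linear_borel_measurable]
  have "A *v (matrix_inv A *v x) = x" for x by (simp add: matrix_vector_mul_assoc inv)
  then obtain d where d: "\<And>k. k \<in> borel_measurable borel \<Longrightarrow>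
      (\<integral>\<^sup>+x. k (A *v x) \<partial>lborel) = d * (\<integral>\<^sup>+x. k x \<partial>lborel)"
    using nn_integral_lborel_linear[OF lin(1)] by metis
  show thesis
  proof
    fix h :: "real ^ 'n \<Rightarrow> ennreal" assume [measurable]: "h \<in> borel_measurable borel"
    let ?c = "ennreal ((1 / sqrt (2 * pi)) ^ CARD('n))"
    have "(\<integral>\<^sup>+x. h x \<partial>distr M borel X) = (\<integral>\<^sup>+z. h (A *v (\<chi> i. z i)) \<partial>gauss_PiM UNIV)"
      unfolding law by (subst nn_integral_distr) auto
    also have "\<dots> = ?c * (\<integral>\<^sup>+x. ennreal (exp (- (norm x)\<^sup>2 / 2)) * h (A *v x) \<partial>lborel)"
      by (rule nn_integral_gauss) measurable
    also have "\<dots> = ?c * (\<integral>\<^sup>+x. ennreal (exp (- (norm (matrix_inv A *v (A *v x)))\<^sup>2 / 2)) * h (A *v x) \<partial>lborel)"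
      by (simp add: matrix_vector_mul_assoc inv)
    also have "\<dots> = ?c * (d * (\<integral>\<^sup>+x. ennreal (exp (- (norm (matrix_inv A *v x))\<^sup>2 / 2)) * h x \<partial>lborel))"
      by (subst d[of "\<lambda>x. ennreal (exp (- (norm (matrix_inv A *v x))\<^sup>2 / 2)) * h x"]) auto
    also have "(\<integral>\<^sup>+x. ennreal (exp (- (norm (matrix_inv A *v x))\<^sup>2 / 2)) * h x \<partial>lborel)
        = (\<integral>\<^sup>+x. ennreal (exp (- (norm (matrix_inv A *v x))\<^sup>2 / 2)) * h x \<partial>distr (lebesgue_PiM UNIV) borel (\<lambda>z. \<chi> i. z i))"
      by (simp add: distr_lebesgue_PiM)
    also have "\<dots> = (\<integral>\<^sup>+z. ennreal (exp (- quad_form (matrix_inv S) z / 2)) * h (\<chi> k. z k) \<partial>lebesgue_PiM UNIV)"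
      by (subst nn_integral_distr) (auto simp: quad_form_inner inv)
    finally show "(\<integral>\<^sup>+x. h x \<partial>distr M borel X)
      = (?c * d) * (\<integral>\<^sup>+z. ennreal (exp (- quad_form (matrix_inv S) z / 2)) * h (\<chi> k. z k) \<partial>lebesgue_PiM UNIV)"
      by (simp add: mult.assoc)
  qed
qed

section \<open>Studentized normal vectors\<close>

locale studentized = prob_space M for M :: "'a measure" +
  fixes X :: "'a \<Rightarrow> real ^ 'n" and Z :: "'a \<Rightarrow> real" and S :: "real ^ 'n ^ 'n" and \<nu> :: real
  assumes normal: "multivariate_normal M X 0 S"
    and diag: "S $ i $ i = 1"
    and \<nu>: "\<nu> > 0"
    and chi: "scaled_chi M Z \<nu>"
    and indep: "independent_rv M X Z"
begin

lemma measurable_X [measurable]: "X \<in> borel_measurable M"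
  using normal by (simp add: multivariate_normal_def)

lemma measurable_Z [measurable]: "Z \<in> borel_measurable M"
  using chi by (simp add: scaled_chi_def)

text \<open>The chi-square law is given for \<open>\<nu> * Z\<^sup>2\<close>, so independence from
  \<open>X\<close> is carried over to that variable through preimages, and \<open>Z\<close> is
  recovered as a square root, almost surely, since it is positive.\<close>

lemma nn_integral_law:
  assumes [measurable]: "case_prod G \<in> borel_measurable (borel \<Otimes>\<^sub>M borel)"
  shows "(\<integral>\<^sup>+\<omega>. G (X \<omega>) (Z \<omega>) \<partial>M)
    = (\<integral>\<^sup>+y. ennreal (chi_square_density \<nu> y) * (\<integral>\<^sup>+x. G x (sqrt (y / \<nu>)) \<partial>distr M borel X) \<partial>lborel)"
proof -
  define Y where "Y \<omega> = \<nu> * (Z \<omega>)\<^sup>2" for \<omega>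
  have [measurable]: "Y \<in> borel_measurable M" unfolding Y_def by measurable
  have dY: "distributed M lborel Y (chi_square_density \<nu>)"
    using chi unfolding scaled_chi_def Y_def by simp
  then have [measurable]: "(\<lambda>y. ennreal (chi_square_density \<nu> y)) \<in> borel_measurable borel"
    by (simp add: distributed_def)
  have lawY: "distr M borel Y = density lborel (\<lambda>y. ennreal (chi_square_density \<nu> y))"
    using distributed_distr_eq_density[OF dY] by (simp cong: distr_cong)
  interpret PX: prob_space "distr M borel X" by (rule prob_space_distr) simp
  interpret PY: prob_space "distr M borel Y" by (rule prob_space_distr) simp
  interpret pair_sigma_finite "distr M borel X" "distr M borel Y" ..
  have joint: "distr M borel X \<Otimes>\<^sub>M distr M borel Y = distr M (borel \<Otimes>\<^sub>M borel) (\<lambda>\<omega>. (X \<omega>, Y \<omega>))"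
  proof (rule pair_measure_eqI)
    fix A :: "(real ^ 'n) set" and B :: "real set"
    assume "A \<in> sets (distr M borel X)" "B \<in> sets (distr M borel Y)"
    then have [measurable]: "A \<in> sets borel" "B \<in> sets borel" by auto
    let ?B = "(\<lambda>z. \<nu> * z\<^sup>2) -` B"
    have "(\<lambda>z. \<nu> * z\<^sup>2) \<in> borel_measurable (borel :: real measure)" by measurable
    from measurable_sets[OF this \<open>B \<in> sets borel\<close>] have "?B \<in> sets borel" by simp
    then have "prob ((X -` A \<inter> space M) \<inter> (Z -` ?B \<inter> space M)) = prob (X -` A \<inter> space M) * prob (Z -` ?B \<inter> space M)"
      using indep unfolding independent_rv_def by (intro indep_setD) auto
    moreover have "Z -` ?B \<inter> space M = Y -` B \<inter> space M" by (auto simp: Y_def)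
    ultimately have "emeasure M ((X -` A \<inter> space M) \<inter> (Y -` B \<inter> space M)) = emeasure M (X -` A \<inter> space M) * emeasure M (Y -` B \<inter> space M)"
      by (simp add: emeasure_eq_measure ennreal_mult')
    moreover have "(\<lambda>\<omega>. (X \<omega>, Y \<omega>)) -` (A \<times> B) \<inter> space M = (X -` A \<inter> space M) \<inter> (Y -` B \<inter> space M)" by auto
    ultimately show "emeasure (distr M borel X) A * emeasure (distr M borel Y) B
        = emeasure (distr M (borel \<Otimes>\<^sub>M borel) (\<lambda>\<omega>. (X \<omega>, Y \<omega>))) (A \<times> B)"
      by (simp add: emeasure_distr)
  qed (auto intro: PX.sigma_finite_measure_axioms PY.sigma_finite_measure_axioms)
  have "AE \<omega> in M. Z \<omega> = sqrt (Y \<omega> / \<nu>)"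
    using chi \<nu> unfolding scaled_chi_def Y_def by (auto elim!: eventually_mono)
  then have "(\<integral>\<^sup>+\<omega>. G (X \<omega>) (Z \<omega>) \<partial>M) = (\<integral>\<^sup>+\<omega>. G (X \<omega>) (sqrt (Y \<omega> / \<nu>)) \<partial>M)"
    by (intro nn_integral_cong_AE) (auto elim!: eventually_mono)
  also have "\<dots> = (\<integral>\<^sup>+(x, y). G x (sqrt (y / \<nu>)) \<partial>(distr M borel X \<Otimes>\<^sub>M distr M borel Y))"
    unfolding joint by (subst nn_integral_distr) auto
  also have "\<dots> = (\<integral>\<^sup>+y. \<integral>\<^sup>+x. G x (sqrt (y / \<nu>)) \<partial>distr M borel X \<partial>distr M borel Y)"
    by (subst nn_integral_snd[symmetric]) auto
  also have "\<dots> = (\<integral>\<^sup>+y. ennreal (chi_square_density \<nu> y) * (\<integral>\<^sup>+x. G x (sqrt (y / \<nu>)) \<partial>distr M borel X) \<partial>lborel)"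
  proof -
    have [measurable]: "(\<lambda>y. \<integral>\<^sup>+x. G x (sqrt (y / \<nu>)) \<partial>distr M borel X) \<in> borel_measurable borel"
      by measurable
    show ?thesis unfolding lawY by (rule nn_integral_density) measurable
  qed
  finally show ?thesis .
qed

definition T :: "'a \<Rightarrow> real ^ 'n" where
  "T \<omega> = inverse (Z \<omega>) *\<^sub>R X \<omega>"

lemma measurable_T [measurable]: "T \<in> borel_measurable M"
  unfolding T_def by measurable

text \<open>\<open>\<kappa> x z\<close> is the conditional probability of \<open>X / z \<in> E\<close> given \<open>X $ i = x\<close>.\<close>

definition kernel :: "'n \<Rightarrow> (real ^ 'n) set \<Rightarrow> (real \<Rightarrow> real \<Rightarrow> ennreal) \<Rightarrow> bool" where
  "kernel i E \<kappa> \<longleftrightarrow> case_prod \<kappa> \<in> borel_measurable (borel \<Otimes>\<^sub>M borel) \<and>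
    (\<forall>z>0. \<forall>B\<in>sets borel.
      (\<integral>\<^sup>+x. indicator E (inverse z *\<^sub>R x) * indicator B (x $ i / z) \<partial>distr M borel X)
      = (\<integral>\<^sup>+x. ennreal (std_normal_density x) * (\<kappa> x z * indicator B (x / z)) \<partial>lborel))"

text \<open>States that \<open>X $ i\<close> is standard normal. In this form the marginal
  probabilities of \<open>T $ i\<close> pass through the same polar formula as the joint
  ones.\<close>

lemma kernel_UNIV: "kernel i UNIV (\<lambda>_ _. 1)"
proof -
  obtain B :: "real ^ 'n ^ 'n" where "\<And>k. B $ k $ i = S $ k $ i" and B: "\<And>z. (B *v z) $ i = z $ i"
    "\<And>h. h \<in> borel_measurable borel \<Longrightarrow>
      (\<integral>\<^sup>+x. h x \<partial>distr M borel X) = (\<integral>\<^sup>+z. h (B *v (\<chi> k. z k)) \<partial>gauss_PiM UNIV)"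
    by (rule multivariate_normal_rotate[OF normal diag[of i]]) (rule that)
  have "prob_space (gauss_PiM (- {i}))" by (intro prob_space_PiM prob_space_std_normal)
  then have one: "emeasure (gauss_PiM (- {i})) (space (gauss_PiM (- {i}))) = 1"
    by (rule prob_space.emeasure_space_1)
  have "(\<integral>\<^sup>+x. indicator C (x $ i / z) \<partial>distr M borel X)
      = (\<integral>\<^sup>+x. ennreal (std_normal_density x) * indicator C (x / z) \<partial>lborel)"
    if [measurable]: "C \<in> sets borel" for C z
  proof -
    have "(\<integral>\<^sup>+x. indicator C (x $ i / z) \<partial>distr M borel X) = (\<integral>\<^sup>+x. indicator C (x i / z) \<partial>gauss_PiM UNIV)"
      by (subst B(2)) (auto simp: B(1))
    also have "\<dots> = (\<integral>\<^sup>+x. ennreal (std_normal_density x) * indicator C (x / z) \<partial>lborel)"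
      by (subst nn_integral_gauss_PiM_split[of _ i]) (auto simp: one)
    finally show ?thesis .
  qed
  then show ?thesis unfolding kernel_def by simp
qed

text \<open>In polar coordinates the weight \<open>w\<close> of \<open>u = T $ i\<close> separates
  from the weight \<open>k\<close> of \<open>r\<close>. Averaging \<kappa> over \<open>r\<close>
  therefore uses the same weights for every \<open>u\<close>, and monotonicity at each fixed
  \<open>r\<close> survives in \<open>q\<close>.\<close>

lemma prob_ratio_mono:
  assumes \<kappa>: "kernel i E \<kappa>" and [measurable]: "E \<in> sets borel" "B \<in> sets borel" "C \<in> sets borel"
    and "B \<subseteq> C"
    and mono: "\<And>u v r. u \<in> B \<Longrightarrow> v \<in> C - B \<Longrightarrow> r > 0 \<Longrightarrow>
      \<kappa> (v * zeta \<nu> v r) (zeta \<nu> v r) \<le> \<kappa> (u * zeta \<nu> u r) (zeta \<nu> u r)"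
  shows "prob {\<omega> \<in> space M. T \<omega> \<in> E \<and> T \<omega> $ i \<in> C} * prob {\<omega> \<in> space M. T \<omega> $ i \<in> B}
    \<le> prob {\<omega> \<in> space M. T \<omega> \<in> E \<and> T \<omega> $ i \<in> B} * prob {\<omega> \<in> space M. T \<omega> $ i \<in> C}"
proof -
  obtain w k where [measurable]: "w \<in> borel_measurable borel" "k \<in> borel_measurable borel"
    and k0: "\<And>r. r \<le> 0 \<Longrightarrow> k r = 0" and polar: "\<And>g. case_prod g \<in> borel_measurable (borel \<Otimes>\<^sub>M borel) \<Longrightarrow>
      (\<integral>\<^sup>+y. \<integral>\<^sup>+x. ennreal (chi_square_density \<nu> y) * (ennreal (std_normal_density x) * g x (sqrt (y / \<nu>))) \<partial>lborel \<partial>lborel)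
      = (\<integral>\<^sup>+u. \<integral>\<^sup>+r. w u * (k r * g (u * zeta \<nu> u r) (zeta \<nu> u r)) \<partial>lborel \<partial>lborel)"
    by (rule student_polar[OF \<nu>]) auto
  have law: "emeasure M {\<omega> \<in> space M. T \<omega> \<in> D \<and> T \<omega> $ i \<in> A}
      = (\<integral>\<^sup>+u. w u * (\<integral>\<^sup>+r. k r * \<eta> (u * zeta \<nu> u r) (zeta \<nu> u r) \<partial>lborel) * indicator A u \<partial>lborel)"
    if \<eta>: "kernel i D \<eta>" and [measurable]: "A \<in> sets borel" "D \<in> sets borel" for \<eta> D A
  proof -
    have [measurable]: "case_prod \<eta> \<in> borel_measurable (borel \<Otimes>\<^sub>M borel)"
      using \<eta> by (simp add: kernel_def)
    have "emeasure M {\<omega> \<in> space M. T \<omega> \<in> D \<and> T \<omega> $ i \<in> A}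
        = (\<integral>\<^sup>+\<omega>. indicator {\<omega> \<in> space M. T \<omega> \<in> D \<and> T \<omega> $ i \<in> A} \<omega> \<partial>M)"
      by (rule nn_integral_indicator[symmetric]) measurable
    also have "\<dots> = (\<integral>\<^sup>+\<omega>. indicator D (inverse (Z \<omega>) *\<^sub>R X \<omega>) * indicator A (X \<omega> $ i / Z \<omega>) \<partial>M)"
      by (intro nn_integral_cong) (auto simp: indicator_def T_def field_simps)
    also have "\<dots> = (\<integral>\<^sup>+y. ennreal (chi_square_density \<nu> y) *
        (\<integral>\<^sup>+x. indicator D (inverse (sqrt (y / \<nu>)) *\<^sub>R x) * indicator A (x $ i / sqrt (y / \<nu>)) \<partial>distr M borel X) \<partial>lborel)"
      by (rule nn_integral_law) measurable
    also have "\<dots> = (\<integral>\<^sup>+y. \<integral>\<^sup>+x. ennreal (chi_square_density \<nu> y) * (ennreal (std_normal_density x)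
        * (\<eta> x (sqrt (y / \<nu>)) * indicator A (x / sqrt (y / \<nu>)))) \<partial>lborel \<partial>lborel)"
    proof (rule nn_integral_cong)
      fix y
      show "ennreal (chi_square_density \<nu> y) *
          (\<integral>\<^sup>+x. indicator D (inverse (sqrt (y / \<nu>)) *\<^sub>R x) * indicator A (x $ i / sqrt (y / \<nu>)) \<partial>distr M borel X)
        = (\<integral>\<^sup>+x. ennreal (chi_square_density \<nu> y) * (ennreal (std_normal_density x)
        * (\<eta> x (sqrt (y / \<nu>)) * indicator A (x / sqrt (y / \<nu>)))) \<partial>lborel)"
      proof (cases "y > 0")
        case True
        then have "sqrt (y / \<nu>) > 0" using \<nu> by simp
        then show ?thesis
          using \<eta> unfolding kernel_def by (subst nn_integral_cmult) auto
      qed (simp add: chi_square_density_def)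
    qed
    also have "\<dots> = (\<integral>\<^sup>+u. \<integral>\<^sup>+r. w u * (k r * (\<eta> (u * zeta \<nu> u r) (zeta \<nu> u r) * indicator A (u * zeta \<nu> u r / zeta \<nu> u r))) \<partial>lborel \<partial>lborel)"
      by (rule polar) measurable
    also have "\<dots> = (\<integral>\<^sup>+u. \<integral>\<^sup>+r. w u * (k r * \<eta> (u * zeta \<nu> u r) (zeta \<nu> u r)) * indicator A u \<partial>lborel \<partial>lborel)"
    \<comment> \<open>For \<open>r > 0\<close> the positive factor \<open>zeta \<nu> u r\<close>
      cancels in the argument of the indicator; for \<open>r \<le> 0\<close> the weight
      \<open>k\<close> vanishes.\<close>
    proof (intro nn_integral_cong)
      fix u r :: real
      show "w u * (k r * (\<eta> (u * zeta \<nu> u r) (zeta \<nu> u r) * indicator A (u * zeta \<nu> u r / zeta \<nu> u r)))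
          = w u * (k r * \<eta> (u * zeta \<nu> u r) (zeta \<nu> u r)) * indicator A u"
        using zeta_pos[OF \<nu>, of r u] k0[of r] by (cases "r > 0") (auto simp: mult_ac)
    qed
    also have "\<dots> = (\<integral>\<^sup>+u. w u * (\<integral>\<^sup>+r. k r * \<eta> (u * zeta \<nu> u r) (zeta \<nu> u r) \<partial>lborel) * indicator A u \<partial>lborel)"
      by (simp add: nn_integral_cmult nn_integral_multc)
    finally show ?thesis .
  qed
  define q where "q u = (\<integral>\<^sup>+r. k r * \<kappa> (u * zeta \<nu> u r) (zeta \<nu> u r) \<partial>lborel)" for u
  define w' where "w' u = w u * (\<integral>\<^sup>+r. k r \<partial>lborel)" for u
  have [measurable]: "case_prod \<kappa> \<in> borel_measurable (borel \<Otimes>\<^sub>M borel)"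
    using \<kappa> by (simp add: kernel_def)
  have [measurable]: "q \<in> borel_measurable borel" "w' \<in> borel_measurable borel" unfolding q_def w'_def by measurable
  let ?K = "\<integral>\<^sup>+r. k r \<partial>lborel"
  have E: "emeasure M {\<omega> \<in> space M. T \<omega> \<in> E \<and> T \<omega> $ i \<in> A} = (\<integral>\<^sup>+u. w u * q u * indicator A u \<partial>lborel)"
    if "A \<in> sets borel" for A
    using law[OF \<kappa> that] by (simp add: q_def)
  have U: "emeasure M {\<omega> \<in> space M. T \<omega> $ i \<in> A} = ?K * (\<integral>\<^sup>+u. w u * indicator A u \<partial>lborel)"
    if [measurable]: "A \<in> sets borel" for A
  proof -
    have "emeasure M {\<omega> \<in> space M. T \<omega> $ i \<in> A} = (\<integral>\<^sup>+u. w u * ?K * indicator A u \<partial>lborel)"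
      using law[OF kernel_UNIV that] by simp
    also have "\<dots> = (\<integral>\<^sup>+u. ?K * (w u * indicator A u) \<partial>lborel)"
      by (simp add: mult_ac)
    finally show ?thesis by (simp add: nn_integral_cmult)
  qed
  have "emeasure M {\<omega> \<in> space M. T \<omega> \<in> E \<and> T \<omega> $ i \<in> C} * emeasure M {\<omega> \<in> space M. T \<omega> $ i \<in> B}
      = ?K * ((\<integral>\<^sup>+u. w u * q u * indicator C u \<partial>lborel) * (\<integral>\<^sup>+u. w u * indicator B u \<partial>lborel))"
    by (simp add: E U mult_ac)
  also have "\<dots> \<le> ?K * ((\<integral>\<^sup>+u. w u * q u * indicator B u \<partial>lborel) * (\<integral>\<^sup>+u. w u * indicator C u \<partial>lborel))"
  proof (intro mult_left_mono nn_integral_ratio_mono)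
    fix u v assume uv: "u \<in> B" "v \<in> C - B"
    show "q v \<le> q u"
      unfolding q_def
    proof (rule nn_integral_mono)
      fix r
      show "k r * \<kappa> (v * zeta \<nu> v r) (zeta \<nu> v r) \<le> k r * \<kappa> (u * zeta \<nu> u r) (zeta \<nu> u r)"
        using mono[OF uv, of r] k0[of r] by (cases "r > 0") (auto intro: mult_left_mono)
    qed
  qed (use \<open>B \<subseteq> C\<close> in auto)
  also have "\<dots> = emeasure M {\<omega> \<in> space M. T \<omega> \<in> E \<and> T \<omega> $ i \<in> B} * emeasure M {\<omega> \<in> space M. T \<omega> $ i \<in> C}"
    by (simp add: E U mult_ac)
  finally show ?thesis
    by (simp add: emeasure_eq_measure ennreal_mult'[symmetric])
qed

end

text \<open>The outcomes for which the step-up test with critical regions \<open>D k\<close> rejects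
  at least \<open>j\<close> hypotheses. It is a set of points rather than an event, so that rescaled
  and conditioned vectors can be tested for membership.\<close>

definition rejection :: "(nat \<Rightarrow> real set) \<Rightarrow> nat \<Rightarrow> nat \<Rightarrow> (real ^ 'n) set" where
  "rejection D n j = {t. \<exists>k\<in>{j..n}. k \<le> card {i. t $ i \<in> D k}}"

lemma rejection_mono:
  assumes "s \<in> rejection D n j" "\<And>k i. k \<in> {j..n} \<Longrightarrow> s $ i \<in> D k \<Longrightarrow> t $ i \<in> D k"
  shows "t \<in> rejection D n j"
proof -
  obtain k where k: "k \<in> {j..n}" "k \<le> card {i. s $ i \<in> D k}"
    using assms(1) by (auto simp: rejection_def)
  note k(2)
  also have "card {i. s $ i \<in> D k} \<le> card {i. t $ i \<in> D k}"
    using assms(2)[OF k(1)] by (intro card_mono) auto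
  finally show ?thesis using k by (auto simp: rejection_def)
qed

lemma sets_card_ge [measurable]:
  fixes P :: "'n::finite \<Rightarrow> 'a \<Rightarrow> bool"
  assumes [measurable]: "\<And>i. Measurable.pred M (P i)"
  shows "Measurable.pred M (\<lambda>x. k \<le> card {i. P i x})"
proof -
  have "k \<le> card {i. P i x} \<longleftrightarrow> (\<exists>A\<in>{A. k \<le> card A}. \<forall>i\<in>A. P i x)" for x
    by (auto intro: order_trans[OF _ card_mono])
  then show ?thesis by (simp only:) measurable
qed

lemma rejection_measurable [measurable]:
  assumes [measurable]: "\<And>k. D k \<in> sets borel"
  shows "rejection D n j \<in> sets borel"
  unfolding rejection_def by measurable

lemma matrix_vector_mult_update:
  fixes B :: "real ^ 'n ^ 'n"
  shows "(B *v (\<chi> k. (z(i := x)) k)) $ l = B $ l $ i * x + (\<Sum>k\<in>-{i}. B $ l $ k * z k)"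
proof -
  have "UNIV = insert i (-{i})" by auto
  then have "(B *v (\<chi> k. (z(i := x)) k)) $ l = (\<Sum>k\<in>insert i (-{i}). B $ l $ k * (z(i := x)) k)"
    by (simp add: matrix_vector_mult_def)
  also have "\<dots> = B $ l $ i * x + (\<Sum>k\<in>-{i}. B $ l $ k * (z(i := x)) k)"
    by (subst sum.insert) auto
  also have "(\<Sum>k\<in>-{i}. B $ l $ k * (z(i := x)) k) = (\<Sum>k\<in>-{i}. B $ l $ k * z k)"
    by (intro sum.cong) auto
  finally show ?thesis .
qed

lemma measurable_fun_upd_pair [measurable]:
  "(\<lambda>q. ((snd q)(i := fst (fst q))) k) \<in> borel_measurable ((borel \<Otimes>\<^sub>M borel) \<Otimes>\<^sub>M lebesgue_PiM (- {i}))"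
  "(\<lambda>q. ((snd q)(i := fst (fst q))) k) \<in> borel_measurable ((borel \<Otimes>\<^sub>M borel) \<Otimes>\<^sub>M gauss_PiM (- {i}))"
  for i k :: "'n::finite"
proof -
  show "(\<lambda>q. ((snd q)(i := fst (fst q))) k) \<in> borel_measurable ((borel \<Otimes>\<^sub>M borel) \<Otimes>\<^sub>M lebesgue_PiM (- {i}))"
  proof (cases "k = i")
    case False
    then have [measurable]: "(\<lambda>z. z k) \<in> borel_measurable (lebesgue_PiM (- {i}))"
      by (intro measurable_component_singleton[of k _ "\<lambda>_. lborel", simplified]) auto
    show ?thesis using False by simp
  qed simp
  show "(\<lambda>q. ((snd q)(i := fst (fst q))) k) \<in> borel_measurable ((borel \<Otimes>\<^sub>M borel) \<Otimes>\<^sub>M gauss_PiM (- {i}))"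
  proof (cases "k = i")
    case False
    then have "(\<lambda>z. z k) \<in> measurable (gauss_PiM (- {i})) std_normal_distribution"
      by (intro measurable_component_singleton) auto
    then have [measurable]: "(\<lambda>z. z k) \<in> borel_measurable (gauss_PiM (- {i}))"
      by simp
    show ?thesis using False by simp
  qed simp
qed

context studentized
begin

text \<open>Isolates what each of the two parts has to supply: for each coordinate and level a
  conditional probability that is no larger at the points added in \<open>D (Suc j)\<close> than at
  those of \<open>D j\<close>.\<close>

lemma simes_T:
  assumes n: "n \<ge> 1" and [measurable]: "\<And>k. D k \<in> sets borel"
    and nested: "\<And>j. 1 \<le> j \<Longrightarrow> j < n \<Longrightarrow> D j \<subseteq> D (Suc j)"
    and kern: "\<And>i j. 1 \<le> j \<Longrightarrow> j < n \<Longrightarrow> \<exists>\<kappa>. kernel i (rejection D n (Suc j)) \<kappa> \<and>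
      (\<forall>u v r. u \<in> D j \<longrightarrow> v \<in> D (Suc j) - D j \<longrightarrow> r > 0 \<longrightarrow>
        \<kappa> (v * zeta \<nu> v r) (zeta \<nu> v r) \<le> \<kappa> (u * zeta \<nu> u r) (zeta \<nu> u r))"
    and mono: "\<And>i. mono_on {1..n} (\<lambda>j. prob {\<omega> \<in> space M. T \<omega> $ i \<in> D j} / real j)"
  shows "prob {\<omega> \<in> space M. T \<omega> \<in> rejection D n 1} \<le> (1 / real n) * (\<Sum>i\<in>UNIV. prob {\<omega> \<in> space M. T \<omega> $ i \<in> D n})"
proof -
  have R: "{\<omega> \<in> space M. T \<omega> \<in> rejection D n j}
      = {\<omega> \<in> space M. \<exists>k\<in>{j..n}. k \<le> card {i. \<omega> \<in> {\<omega> \<in> space M. T \<omega> $ i \<in> D k}}}" for j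
    by (auto simp: rejection_def)
  have Int: "{\<omega> \<in> space M. T \<omega> \<in> rejection D n j} \<inter> {\<omega> \<in> space M. T \<omega> $ i \<in> D k}
      = {\<omega> \<in> space M. T \<omega> \<in> rejection D n j \<and> T \<omega> $ i \<in> D k}" for i j k by auto
  have meas: "{\<omega> \<in> space M. T \<omega> \<in> rejection D n j} \<in> events" for j by measurable
  show ?thesis
    unfolding R
  proof (rule simes_inequality[OF n, where A = "\<lambda>i k. {\<omega> \<in> space M. T \<omega> $ i \<in> D k}"], unfold R[symmetric] Int)
    fix i j assume j: "1 \<le> j" "j < n"
    obtain \<kappa> where \<kappa>: "kernel i (rejection D n (Suc j)) \<kappa>"
      "\<And>u v r. u \<in> D j \<Longrightarrow> v \<in> D (Suc j) - D j \<Longrightarrow> r > 0 \<Longrightarrow>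
        \<kappa> (v * zeta \<nu> v r) (zeta \<nu> v r) \<le> \<kappa> (u * zeta \<nu> u r) (zeta \<nu> u r)"
      using kern[OF j] by blast
    show "prob {\<omega> \<in> space M. T \<omega> \<in> rejection D n (Suc j) \<and> T \<omega> $ i \<in> D (Suc j)} * prob {\<omega> \<in> space M. T \<omega> $ i \<in> D j}
      \<le> prob {\<omega> \<in> space M. T \<omega> \<in> rejection D n (Suc j) \<and> T \<omega> $ i \<in> D j} * prob {\<omega> \<in> space M. T \<omega> $ i \<in> D (Suc j)}"
      by (rule prob_ratio_mono[OF \<kappa>(1)]) (use nested[OF j] \<kappa>(2) in auto)
  qed (use mono meas in measurable)
qed

text \<open>After the rotation source coordinate \<open>i\<close> is \<open>X $ i\<close>, so
  conditioning is merely Fubini: fixing it at \<open>x\<close> leaves \<open>x\<close> times column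
  \<open>i\<close> of \<open>S\<close> plus a linear function of the independent remaining
  coordinates.\<close>

lemma kernel_regression:
  assumes [measurable]: "E \<in> sets borel"
  obtains B :: "real ^ 'n ^ 'n" where "\<And>k. B $ k $ i = S $ k $ i"
    "kernel i E (\<lambda>x z. \<integral>\<^sup>+y. indicator E (inverse z *\<^sub>R (B *v (\<chi> k. (y(i := x)) k))) \<partial>gauss_PiM (- {i}))"
proof -
  interpret product_sigma_finite "\<lambda>_::'n. std_normal_distribution" by (rule product_sigma_finite_std_normal)
  interpret J: sigma_finite_measure "gauss_PiM (- {i})" by (rule sigma_finite) simp
  obtain B :: "real ^ 'n ^ 'n" where Bk: "\<And>k. B $ k $ i = S $ k $ i" and B: "\<And>z. (B *v z) $ i = z $ i"
    "\<And>h. h \<in> borel_measurable borel \<Longrightarrow>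
      (\<integral>\<^sup>+x. h x \<partial>distr M borel X) = (\<integral>\<^sup>+z. h (B *v (\<chi> k. z k)) \<partial>gauss_PiM UNIV)"
    by (rule multivariate_normal_rotate[OF normal diag[of i]]) (rule that)
  have Bm: "(\<lambda>x. B *v x) \<in> borel_measurable borel"
    by (rule linear_borel_measurable) (rule matrix_vector_mul_linear)
  note [measurable] = measurable_compose[OF _ Bm]
  let ?\<kappa> = "\<lambda>x z. \<integral>\<^sup>+y. indicator E (inverse z *\<^sub>R (B *v (\<chi> k. (y(i := x)) k))) \<partial>gauss_PiM (- {i})"
  have vec: "(\<lambda>q. \<chi> k. ((snd q)(i := fst (fst q))) k :: real ^ 'n) \<in> borel_measurable ((borel \<Otimes>\<^sub>M borel) \<Otimes>\<^sub>M gauss_PiM (- {i}))"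
    by (rule measurable_vec_lambda) (rule measurable_fun_upd_pair)
  have vec_B: "(\<lambda>q. B *v (\<chi> k. ((snd q)(i := fst (fst q))) k)) \<in> borel_measurable ((borel \<Otimes>\<^sub>M borel) \<Otimes>\<^sub>M gauss_PiM (- {i}))"
    using measurable_compose[OF vec Bm] .
  have scaled[measurable]: "(\<lambda>q. inverse (snd (fst q)) *\<^sub>R (B *v (\<chi> k. ((snd q)(i := fst (fst q))) k)))
      \<in> borel_measurable ((borel \<Otimes>\<^sub>M borel) \<Otimes>\<^sub>M gauss_PiM (- {i}))"
    by (intro borel_measurable_scaleR vec_B) measurable
  have ind: "(\<lambda>q. indicator E (inverse (snd (fst q)) *\<^sub>R (B *v (\<chi> k. ((snd q)(i := fst (fst q))) k))) :: ennreal)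
      \<in> borel_measurable ((borel \<Otimes>\<^sub>M borel) \<Otimes>\<^sub>M gauss_PiM (- {i}))"
    by measurable
  have "(\<lambda>p. ?\<kappa> (fst p) (snd p)) \<in> borel_measurable (borel \<Otimes>\<^sub>M borel)"
    by (rule J.borel_measurable_nn_integral) (use ind in \<open>simp add: split_beta' del: fun_upd_apply\<close>)
  then have m: "case_prod ?\<kappa> \<in> borel_measurable (borel \<Otimes>\<^sub>M borel)"
    by (simp add: split_beta')
  have "kernel i E ?\<kappa>"
    unfolding kernel_def
  proof (intro conjI m allI impI ballI)
    fix z :: real and C :: "real set" assume [measurable]: "C \<in> sets borel"
    have [measurable]: "(\<lambda>y. indicator E (inverse z *\<^sub>R (B *v (\<chi> k. (y(i := x)) k))) :: ennreal) \<in> borel_measurable (gauss_PiM (- {i}))" for x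
      using measurable_compose[OF measurable_Pair1'[of "(x, z)" "borel \<Otimes>\<^sub>M borel" "gauss_PiM (- {i})"] scaled]
      by (simp add: space_pair_measure)
    have "(\<integral>\<^sup>+x. indicator E (inverse z *\<^sub>R x) * indicator C (x $ i / z) \<partial>distr M borel X)
        = (\<integral>\<^sup>+y. indicator E (inverse z *\<^sub>R (B *v (\<chi> k. y k))) * indicator C (y i / z) \<partial>gauss_PiM UNIV)"
      by (subst B(2)) (auto simp: B(1))
    also have "\<dots> = (\<integral>\<^sup>+x. ennreal (std_normal_density x) * (?\<kappa> x z * indicator C (x / z)) \<partial>lborel)"
      by (subst nn_integral_gauss_PiM_split[of _ i]) (auto simp: nn_integral_multc)
    finally show "(\<integral>\<^sup>+x. indicator E (inverse z *\<^sub>R x) * indicator C (x $ i / z) \<partial>distr M borel X)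
        = (\<integral>\<^sup>+x. ennreal (std_normal_density x) * (?\<kappa> x z * indicator C (x / z)) \<partial>lborel)" .
  qed
  with Bk show thesis by (rule that)
qed

text \<open>\<open>\<sigma> = -1\<close> stands for lower tails and \<open>\<sigma> = 1\<close> for
  upper ones. The conditional laws at \<open>u\<close> and \<open>v\<close> are coupled by the same
  source point \<open>y\<close>. Going from \<open>v\<close> to the more extreme \<open>u\<close>
  moves every coordinate outward, through the non-negative covariances, and then divides by a
  smaller number.\<close>

lemma simes_one_sided:
  fixes \<sigma> :: real
  assumes n: "n \<ge> 1" and S: "\<And>i j. S $ i $ j \<ge> 0" and \<sigma>: "\<bar>\<sigma>\<bar> = 1"
    and D: "\<And>k. D k \<in> sets borel"
    and nested: "\<And>j. 1 \<le> j \<Longrightarrow> j < n \<Longrightarrow> D j \<subseteq> D (Suc j)"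
    and tail: "\<And>k s. k \<in> {1..n} \<Longrightarrow> s \<in> D k \<Longrightarrow> \<sigma> * s \<ge> 0"
    and closed: "\<And>k s t. k \<in> {1..n} \<Longrightarrow> s \<in> D k \<Longrightarrow> \<sigma> * s \<le> \<sigma> * t \<Longrightarrow> t \<in> D k"
    and mono: "\<And>i. mono_on {1..n} (\<lambda>j. prob {\<omega> \<in> space M. T \<omega> $ i \<in> D j} / real j)"
  shows "prob {\<omega> \<in> space M. T \<omega> \<in> rejection D n 1} \<le> (1 / real n) * (\<Sum>i\<in>UNIV. prob {\<omega> \<in> space M. T \<omega> $ i \<in> D n})"
proof (rule simes_T[OF n D nested _ mono])
  fix i :: 'n and j assume j: "1 \<le> j" "j < n"
  obtain B :: "real ^ 'n ^ 'n" where B: "\<And>k. B $ k $ i = S $ k $ i"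
    "kernel i (rejection D n (Suc j)) (\<lambda>x z. \<integral>\<^sup>+y. indicator (rejection D n (Suc j)) (inverse z *\<^sub>R (B *v (\<chi> k. (y(i := x)) k))) \<partial>gauss_PiM (- {i}))"
    by (rule kernel_regression[OF rejection_measurable[OF D]]) (rule that)
  show "\<exists>\<kappa>. kernel i (rejection D n (Suc j)) \<kappa> \<and>
      (\<forall>u v r. u \<in> D j \<longrightarrow> v \<in> D (Suc j) - D j \<longrightarrow> r > 0 \<longrightarrow>
        \<kappa> (v * zeta \<nu> v r) (zeta \<nu> v r) \<le> \<kappa> (u * zeta \<nu> u r) (zeta \<nu> u r))"
  proof (intro exI conjI allI impI)
    fix u v r :: real assume u: "u \<in> D j" and v: "v \<in> D (Suc j) - D j" and r: "r > 0"
    let ?zu = "zeta \<nu> u r" and ?zv = "zeta \<nu> v r"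
    have uv: "0 \<le> \<sigma> * v" "\<sigma> * v < \<sigma> * u"
      using tail[of "Suc j" v] closed[of j u v] u v j by (auto simp: not_le[symmetric])
    have abs_\<sigma>: "\<bar>x\<bar> = \<bar>\<sigma> * x\<bar>" for x using \<sigma> by (simp add: abs_mult)
    have "\<bar>v\<bar> \<le> \<bar>u\<bar>" unfolding abs_\<sigma>[of u] abs_\<sigma>[of v] using uv by simp
    note z = zeta_antimono[OF \<nu> r this] zeta_pos[OF \<nu> r, of u] zeta_pos[OF \<nu> r, of v]
    have "\<bar>\<sigma> * v * ?zv\<bar> \<le> \<bar>\<sigma> * u * ?zu\<bar>"
      using abs_mult_zeta_mono[OF \<nu> r \<open>\<bar>v\<bar> \<le> \<bar>u\<bar>\<close>] \<sigma> by (simp add: abs_mult)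
    then have x: "\<sigma> * (v * ?zv) \<le> \<sigma> * (u * ?zu)"
      using uv z by (simp add: mult.assoc[symmetric])
    show "(\<integral>\<^sup>+y. indicator (rejection D n (Suc j)) (inverse ?zv *\<^sub>R (B *v (\<chi> k. (y(i := v * ?zv)) k))) \<partial>gauss_PiM (- {i}))
        \<le> (\<integral>\<^sup>+y. indicator (rejection D n (Suc j)) (inverse ?zu *\<^sub>R (B *v (\<chi> k. (y(i := u * ?zu)) k))) \<partial>gauss_PiM (- {i}))"
    proof (rule nn_integral_mono)
      fix y :: "'n \<Rightarrow> real"
      let ?pv = "B *v (\<chi> k. (y(i := v * ?zv)) k)" and ?pu = "B *v (\<chi> k. (y(i := u * ?zu)) k)"
      have "inverse ?zu *\<^sub>R ?pu \<in> rejection D n (Suc j)" if "inverse ?zv *\<^sub>R ?pv \<in> rejection D n (Suc j)"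
        using that
      proof (rule rejection_mono)
        fix k l assume k: "k \<in> {Suc j..n}" and *: "(inverse ?zv *\<^sub>R ?pv) $ l \<in> D k"
        then have k': "k \<in> {1..n}" by auto
        \<comment> \<open>The sign matters here: a smaller divisor moves a coordinate outward only
          if it already lies on the side of zero selected by \<sigma>, which \<open>tail\<close>
          guarantees inside a critical region.\<close>
        have "inverse ?zv * 0 \<le> inverse ?zv * (\<sigma> * ?pv $ l)"
          using tail[OF k' *] by (simp add: mult.left_commute del: fun_upd_apply)
        moreover have "0 < inverse ?zv" using z by simp
        ultimately have nn: "0 \<le> \<sigma> * ?pv $ l"
          by (simp only: mult_le_cancel_left_pos)
        have "B $ l $ i * (\<sigma> * (v * ?zv)) \<le> B $ l $ i * (\<sigma> * (u * ?zu))"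
          using x S[of l i] by (simp only: B mult_left_mono)
        then have "\<sigma> * ?pv $ l \<le> \<sigma> * ?pu $ l"
          unfolding matrix_vector_mult_update by (simp add: algebra_simps)
        then have "inverse ?zv * (\<sigma> * ?pv $ l) \<le> inverse ?zu * (\<sigma> * ?pu $ l)"
          by (rule mult_mono[OF le_imp_inverse_le[OF z(1,2)]]) (use nn z in \<open>simp_all only: inverse_nonnegative_iff_nonnegative less_imp_le\<close>)
        then show "(inverse ?zu *\<^sub>R ?pu) $ l \<in> D k"
          by (intro closed[OF k' *]) (simp add: mult.left_commute)
      qed
      then show "indicator (rejection D n (Suc j)) (inverse ?zv *\<^sub>R ?pv)
          \<le> (indicator (rejection D n (Suc j)) (inverse ?zu *\<^sub>R ?pu) :: ennreal)"
        by (simp add: indicator_def)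
    qed
  qed (rule B)
qed

end

section \<open>The sign-folded conditional density\<close>

text \<open>Completing the square. With \<open>Q\<close> the precision matrix, \<open>v\<close> is
  the column \<open>S e\<^sub>i\<close>; since \<open>Q *v v\<close> is the \<open>i\<close>-th
  axis, \<open>v\<close> is \<open>Q\<close>-orthogonal to every vector whose entry \<open>i\<close>
  vanishes.\<close>

lemma quad_form_column:
  fixes Q :: "real ^ 'n ^ 'n"
  assumes sym: "transpose Q = Q" and v: "Q *v v = axis i 1" "v $ i = 1"
  shows "quad_form Q (z(i := x)) = x\<^sup>2 + quad_form Q ((\<lambda>k. z k - x * v $ k)(i := 0))"
proof -
  define w where "w = (\<chi> k. ((\<lambda>k. z k - x * v $ k)(i := 0)) k)"
  have p: "(\<chi> k. (z(i := x)) k) = x *\<^sub>R v + w"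
    using v(2) by (simp add: w_def vec_eq_iff)
  have "v \<bullet> (Q *v w) = (Q *v v) \<bullet> w"
    by (metis dot_lmul_matrix transpose_matrix_vector sym)
  moreover have "w $ i = 0" by (simp add: w_def)
  ultimately have "quad_form Q (z(i := x)) = x\<^sup>2 + w \<bullet> (Q *v w)"
    using v unfolding quad_form_inner p
    by (simp add: matrix_vector_right_distrib matrix_vector_mult_scaleR inner_add_left inner_add_right inner_axis inner_axis' power2_eq_square)
  then show ?thesis by (simp add: quad_form_inner w_def)
qed

lemma folded_four_functions:
  fixes Q :: "real ^ 'n ^ 'n" and G1 G2 G3 G4 :: "('n \<Rightarrow> real) set" and i :: 'n
  assumes d: "d \<in> signs" and Q: "\<And>i j. i \<noteq> j \<Longrightarrow> d i * Q $ i $ j * d j \<le> 0"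
    and G: "G1 \<in> sets (lebesgue_PiM (-{i}))" "G2 \<in> sets (lebesgue_PiM (-{i}))"
      "G3 \<in> sets (lebesgue_PiM (-{i}))" "G4 \<in> sets (lebesgue_PiM (-{i}))"
    and x: "\<bar>x3\<bar> = max \<bar>x1\<bar> \<bar>x2\<bar>" "\<bar>x4\<bar> = min \<bar>x1\<bar> \<bar>x2\<bar>"
    and closed: "\<And>y y'. y \<in> G1 \<Longrightarrow> y' \<in> G2 \<Longrightarrow>
      (\<lambda>k\<in>-{i}. abs_max (y k) (y' k)) \<in> G3 \<and> (\<lambda>k\<in>-{i}. abs_min (y k) (y' k)) \<in> G4"
  shows "(\<integral>\<^sup>+y. ennreal (folded Q (y(i := x1))) * indicator G1 y \<partial>lebesgue_PiM (-{i}))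
      * (\<integral>\<^sup>+y. ennreal (folded Q (y(i := x2))) * indicator G2 y \<partial>lebesgue_PiM (-{i}))
    \<le> (\<integral>\<^sup>+y. ennreal (folded Q (y(i := x3))) * indicator G3 y \<partial>lebesgue_PiM (-{i}))
      * (\<integral>\<^sup>+y. ennreal (folded Q (y(i := x4))) * indicator G4 y \<partial>lebesgue_PiM (-{i}))"
proof (rule four_functions)
  have comp: "(\<lambda>y. (y(i := x)) k) \<in> borel_measurable (lebesgue_PiM (-{i}))" for x k
  proof (cases "k = i")
    case False
    then show ?thesis by (auto intro!: measurable_component_singleton[of k _ "\<lambda>_. lborel", simplified])
  qed simp
  have [measurable]: "(\<lambda>y. folded Q (y(i := x))) \<in> borel_measurable (lebesgue_PiM (-{i}))" for x
    by (rule folded_measurable) (rule comp)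
  note G[measurable]
  show "(\<lambda>y. ennreal (folded Q (y(i := x1))) * indicator G1 y) \<in> borel_measurable (lebesgue_PiM (-{i}))"
    "(\<lambda>y. ennreal (folded Q (y(i := x2))) * indicator G2 y) \<in> borel_measurable (lebesgue_PiM (-{i}))"
    "(\<lambda>y. ennreal (folded Q (y(i := x3))) * indicator G3 y) \<in> borel_measurable (lebesgue_PiM (-{i}))"
    "(\<lambda>y. ennreal (folded Q (y(i := x4))) * indicator G4 y) \<in> borel_measurable (lebesgue_PiM (-{i}))"
    by measurable
  fix y y' :: "'n \<Rightarrow> real"
  let ?u = "\<lambda>k\<in>-{i}. abs_max (y k) (y' k)" and ?v = "\<lambda>k\<in>-{i}. abs_min (y k) (y' k)"
  have "folded Q (y(i := x1)) * folded Q (y'(i := x2)) \<le> folded Q (?u(i := x3)) * folded Q (?v(i := x4))"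
    by (rule folded_mtp2[OF d Q]) (auto simp: x abs_abs_max abs_abs_min)
  then have "ennreal (folded Q (y(i := x1))) * ennreal (folded Q (y'(i := x2)))
      \<le> ennreal (folded Q (?u(i := x3))) * ennreal (folded Q (?v(i := x4)))"
    by (simp add: folded_nonneg ennreal_leI flip: ennreal_mult del: fun_upd_apply)
  with closed[of y y'] show "ennreal (folded Q (y(i := x1))) * indicator G1 y * (ennreal (folded Q (y'(i := x2))) * indicator G2 y')
    \<le> ennreal (folded Q (?u(i := x3))) * indicator G3 ?u * (ennreal (folded Q (?v(i := x4))) * indicator G4 ?v)"
    by (auto simp: indicator_def simp del: fun_upd_apply restrict_apply)
qed simp

text \<open>For \<open>X\<close> normal with precision matrix \<open>Q\<close>: up to a constant factor, the density at \<open>x\<close> of \<open>X $ i\<close>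
  restricted to the event \<open>X / z \<in> E\<close>.\<close>

definition slice_mass :: "real ^ 'n ^ 'n \<Rightarrow> 'n::finite \<Rightarrow> (real ^ 'n) set \<Rightarrow> real \<Rightarrow> real \<Rightarrow> ennreal" where
  "slice_mass Q i E x z = (\<integral>\<^sup>+y. ennreal (exp (- quad_form Q (y(i := x)) / 2))
     * indicator E (inverse z *\<^sub>R (\<chi> k. (y(i := x)) k)) \<partial>lebesgue_PiM (-{i}))"

lemma slice_measurable:
  fixes i :: "'n::finite"
  assumes [measurable]: "E \<in> sets borel"
  shows "(\<lambda>q. inverse (snd (fst q)) *\<^sub>R (\<chi> k. ((snd q)(i := fst (fst q))) k) :: real ^ 'n)
      \<in> borel_measurable ((borel \<Otimes>\<^sub>M borel) \<Otimes>\<^sub>M lebesgue_PiM (-{i}))"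
    and "(\<lambda>q. ennreal (exp (- quad_form Q ((snd q)(i := fst (fst q))) / 2))
      * indicator E (inverse (snd (fst q)) *\<^sub>R (\<chi> k. ((snd q)(i := fst (fst q))) k) :: real ^ 'n))
      \<in> borel_measurable ((borel \<Otimes>\<^sub>M borel) \<Otimes>\<^sub>M lebesgue_PiM (-{i}))"
proof -
  have [measurable]: "(\<lambda>q. \<chi> k. ((snd q)(i := fst (fst q))) k :: real ^ 'n)
      \<in> borel_measurable ((borel \<Otimes>\<^sub>M borel) \<Otimes>\<^sub>M lebesgue_PiM (- {i}))"
    by (rule measurable_vec_lambda) (rule measurable_fun_upd_pair)
  have [measurable]: "(\<lambda>q. quad_form Q ((snd q)(i := fst (fst q))))
      \<in> borel_measurable ((borel \<Otimes>\<^sub>M borel) \<Otimes>\<^sub>M lebesgue_PiM (- {i}))"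
    by (rule quad_form_measurable) (rule measurable_fun_upd_pair)
  show scaled[measurable]: "(\<lambda>q. inverse (snd (fst q)) *\<^sub>R (\<chi> k. ((snd q)(i := fst (fst q))) k) :: real ^ 'n)
      \<in> borel_measurable ((borel \<Otimes>\<^sub>M borel) \<Otimes>\<^sub>M lebesgue_PiM (-{i}))"
    by measurable
  show "(\<lambda>q. ennreal (exp (- quad_form Q ((snd q)(i := fst (fst q))) / 2))
      * indicator E (inverse (snd (fst q)) *\<^sub>R (\<chi> k. ((snd q)(i := fst (fst q))) k) :: real ^ 'n))
      \<in> borel_measurable ((borel \<Otimes>\<^sub>M borel) \<Otimes>\<^sub>M lebesgue_PiM (-{i}))"
    by measurable
qed

lemma slice_measurable_section:
  fixes i :: "'n::finite" and x z :: real
  assumes "E \<in> sets borel"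
  shows "(\<lambda>y. inverse z *\<^sub>R (\<chi> k. (y(i := x)) k) :: real ^ 'n) \<in> borel_measurable (lebesgue_PiM (-{i}))"
    and "(\<lambda>y. ennreal (exp (- quad_form Q (y(i := x)) / 2))
      * indicator E (inverse z *\<^sub>R (\<chi> k. (y(i := x)) k) :: real ^ 'n)) \<in> borel_measurable (lebesgue_PiM (-{i}))"
proof -
  have "(x, z) \<in> space (borel \<Otimes>\<^sub>M borel)" by (simp add: space_pair_measure)
  note pair = measurable_Pair1'[OF this, of "lebesgue_PiM (-{i})"]
  show "(\<lambda>y. inverse z *\<^sub>R (\<chi> k. (y(i := x)) k) :: real ^ 'n) \<in> borel_measurable (lebesgue_PiM (-{i}))"
    using measurable_compose[OF pair slice_measurable(1)[OF assms, of i]] by (simp del: fun_upd_apply)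
  show "(\<lambda>y. ennreal (exp (- quad_form Q (y(i := x)) / 2))
      * indicator E (inverse z *\<^sub>R (\<chi> k. (y(i := x)) k) :: real ^ 'n)) \<in> borel_measurable (lebesgue_PiM (-{i}))"
    using measurable_compose[OF pair slice_measurable(2)[OF assms, of Q i]] by (simp del: fun_upd_apply)
qed

lemma slice_mass_measurable [measurable]:
  assumes "E \<in> sets borel"
  shows "case_prod (slice_mass Q i E) \<in> borel_measurable (borel \<Otimes>\<^sub>M borel)"
proof -
  interpret product_sigma_finite "\<lambda>_. lborel :: real measure" by (rule product_sigma_finite_lborel)
  interpret J: sigma_finite_measure "lebesgue_PiM (-{i})" by (rule sigma_finite) simp
  have "(\<lambda>p. slice_mass Q i E (fst p) (snd p)) \<in> borel_measurable (borel \<Otimes>\<^sub>M borel)"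
    unfolding slice_mass_def
    by (rule J.borel_measurable_nn_integral)
       (use slice_measurable(2)[OF assms, of Q i] in \<open>simp add: split_beta' del: fun_upd_apply\<close>)
  then show ?thesis by (simp add: split_beta')
qed

text \<open>A quadratic form does not distinguish \<open>e\<close> from \<open>- e\<close>, so each
  sign pattern can be multiplied by \<open>e i\<close> and then leaves coordinate \<open>i\<close>
  at \<open>x\<close>. The other signs reflect \<open>y\<close>, which preserves Lebesgue measure
  and the sign-symmetric set \<open>E\<close>; hence all patterns contribute the same mass.\<close>

lemma slice_mass_folded:
  fixes Q :: "real ^ 'n ^ 'n"
  assumes E: "E \<in> sets borel" and even: "\<And>e p. e \<in> signs \<Longrightarrow> p \<in> E \<Longrightarrow> (\<chi> k. e k * p $ k) \<in> E"
  shows "of_nat (card (signs :: ('n \<Rightarrow> real) set)) * slice_mass Q i E x z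
    = (\<integral>\<^sup>+y. ennreal (folded Q (y(i := x))) * indicator {y \<in> space (lebesgue_PiM (-{i})). inverse z *\<^sub>R (\<chi> k. (y(i := x)) k) \<in> E} y \<partial>lebesgue_PiM (-{i}))"
proof -
  let ?I = "\<lambda>y. indicator E (inverse z *\<^sub>R (\<chi> k. (y(i := x)) k)) :: ennreal"
  let ?h = "\<lambda>y. ennreal (exp (- quad_form Q (y(i := x)) / 2)) * ?I y"
  have h: "?h \<in> borel_measurable (lebesgue_PiM (-{i}))"
    by (rule slice_measurable_section(2)[OF E])
  have reflect: "(\<lambda>y. ennreal (exp (- quad_form Q (\<lambda>k. e k * (y(i := x)) k) / 2)) * ?I y)
      = (\<lambda>y. ?h (\<lambda>k\<in>-{i}. 0 + e i * e k * y k))" if e: "e \<in> signs" for e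
  proof
    fix y :: "'n \<Rightarrow> real"
    have upd: "(\<lambda>k\<in>-{i}. 0 + e i * e k * y k)(i := x) = (\<lambda>k. e i * e k * (y(i := x)) k)"
      using signs_square[OF e, of i] by (auto simp: restrict_def)
    have "quad_form Q (\<lambda>k. e i * e k * (y(i := x)) k) = (e i * e i) * quad_form Q (\<lambda>k. e k * (y(i := x)) k)"
      unfolding quad_form_def sum_distrib_left by (intro sum.cong refl) (simp add: mult_ac)
    then have q: "quad_form Q (\<lambda>k. e i * e k * (y(i := x)) k) = quad_form Q (\<lambda>k. e k * (y(i := x)) k)"
      by (simp add: signs_square[OF e])
    have s: "(\<lambda>k. e i * e k) \<in> signs" using e unfolding signs_iff by (metis mult_1 mult_minus1 minus_minus)
    have sq: "e i * e k * (e i * e k) = 1" for k using signs_square[OF s] .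
    let ?p = "inverse z *\<^sub>R (\<chi> k. (y(i := x)) k) :: real ^ 'n"
      and ?p' = "inverse z *\<^sub>R (\<chi> k. e i * e k * (y(i := x)) k) :: real ^ 'n"
    have "?p' = (\<chi> k. e i * e k * ?p $ k)" by (simp add: vec_eq_iff)
    moreover have "?p = (\<chi> k. e i * e k * ?p' $ k)"
    proof -
      have "e i * e k * (inverse z * (e i * e k * (y(i := x)) k)) = inverse z * (y(i := x)) k * (e i * e k * (e i * e k))" for k
        by (simp only: mult_ac)
      then show ?thesis unfolding sq by (simp add: vec_eq_iff del: fun_upd_apply)
    qed
    ultimately have "?p \<in> E \<longleftrightarrow> ?p' \<in> E" using even[OF s, of ?p] even[OF s, of ?p'] by metis
    then have I: "?I y = indicator E ?p'" by (simp add: indicator_def)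
    show "ennreal (exp (- quad_form Q (\<lambda>k. e k * (y(i := x)) k) / 2)) * ?I y = ?h (\<lambda>k\<in>-{i}. 0 + e i * e k * y k)"
      unfolding upd q I ..
  qed
  have each: "(\<integral>\<^sup>+y. ennreal (exp (- quad_form Q (\<lambda>k. e k * (y(i := x)) k) / 2)) * ?I y \<partial>lebesgue_PiM (-{i})) = slice_mass Q i E x z"
    if e: "e \<in> signs" for e
    unfolding reflect[OF e] slice_mass_def
    by (rule nn_integral_lebesgue_PiM_affine[of "-{i}" "\<lambda>k. e i * e k" ?h "\<lambda>_. 0"])
       (use h in \<open>simp_all add: abs_mult signs_abs[OF e]\<close>)
  have meas: "(\<lambda>y. ennreal (exp (- quad_form Q (\<lambda>k. e k * (y(i := x)) k) / 2)) * ?I y) \<in> borel_measurable (lebesgue_PiM (-{i}))"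
    if e: "e \<in> signs" for e
    unfolding reflect[OF e] by (rule measurable_compose[OF _ h]) measurable
  have "of_nat (card (signs :: ('n \<Rightarrow> real) set)) * slice_mass Q i E x z
      = (\<Sum>e\<in>(signs :: ('n \<Rightarrow> real) set). slice_mass Q i E x z)" by simp
  also have "\<dots> = (\<Sum>e\<in>signs. \<integral>\<^sup>+y. ennreal (exp (- quad_form Q (\<lambda>k. e k * (y(i := x)) k) / 2)) * ?I y \<partial>lebesgue_PiM (-{i}))"
    by (rule sum.cong[OF refl each[symmetric]])
  also have "\<dots> = (\<integral>\<^sup>+y. (\<Sum>e\<in>signs. ennreal (exp (- quad_form Q (\<lambda>k. e k * (y(i := x)) k) / 2)) * ?I y) \<partial>lebesgue_PiM (-{i}))"
    by (rule nn_integral_sum[symmetric]) (rule meas)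
  also have "\<dots> = (\<integral>\<^sup>+y. ennreal (folded Q (y(i := x))) * indicator {y \<in> space (lebesgue_PiM (-{i})). inverse z *\<^sub>R (\<chi> k. (y(i := x)) k) \<in> E} y \<partial>lebesgue_PiM (-{i}))"
    unfolding folded_def sum_distrib_right[symmetric]
    by (intro nn_integral_cong) (simp add: sum_ennreal indicator_def del: fun_upd_apply)
  finally show ?thesis .
qed

text \<open>After completing the square, translating the other coordinates by
  \<open>x * v $ k\<close> removes their dependence on \<open>x\<close>. What is left is the
  standard normal shape of the marginal of \<open>X $ i\<close>.\<close>

lemma slice_mass_UNIV:
  fixes Q :: "real ^ 'n ^ 'n"
  assumes "transpose Q = Q" "Q *v v = axis i 1" "v $ i = 1"
  shows "slice_mass Q i UNIV x z = ennreal (exp (- x\<^sup>2 / 2)) * slice_mass Q i UNIV 0 1"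
proof -
  let ?h = "\<lambda>y. ennreal (exp (- quad_form Q (y(i := 0)) / 2))"
  have h: "?h \<in> borel_measurable (lebesgue_PiM (-{i}))"
    using slice_measurable_section(2)[of UNIV Q i 0 1] by (simp del: fun_upd_apply)
  have upd: "(\<lambda>k. y k - x * v $ k)(i := 0) = (\<lambda>k\<in>-{i}. - x * v $ k + 1 * y k)(i := 0)" for y
    by (auto simp: restrict_def)
  have q: "quad_form Q (y(i := x)) = x\<^sup>2 + quad_form Q ((\<lambda>k\<in>-{i}. - x * v $ k + 1 * y k)(i := 0))" for y
    unfolding quad_form_column[OF assms, of y x] upd ..
  have "slice_mass Q i UNIV x z = (\<integral>\<^sup>+y. ennreal (exp (- x\<^sup>2 / 2)) * ?h (\<lambda>k\<in>-{i}. - x * v $ k + 1 * y k) \<partial>lebesgue_PiM (-{i}))"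
    unfolding slice_mass_def q
    by (simp add: ennreal_mult[symmetric] exp_add[symmetric] diff_divide_distrib del: fun_upd_apply)
  also have "\<dots> = ennreal (exp (- x\<^sup>2 / 2)) * (\<integral>\<^sup>+y. ?h (\<lambda>k\<in>-{i}. - x * v $ k + 1 * y k) \<partial>lebesgue_PiM (-{i}))"
    by (rule nn_integral_cmult, rule measurable_compose[OF _ h]) measurable
  also have "(\<integral>\<^sup>+y. ?h (\<lambda>k\<in>-{i}. - x * v $ k + 1 * y k) \<partial>lebesgue_PiM (-{i})) = integral\<^sup>N (lebesgue_PiM (-{i})) ?h"
    by (rule nn_integral_lebesgue_PiM_affine[of "-{i}" "\<lambda>_. 1" ?h "\<lambda>k. - x * v $ k"]) (use h in simp_all)
  also have "\<dots> = slice_mass Q i UNIV 0 1" by (simp add: slice_mass_def del: fun_upd_apply)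
  finally show ?thesis .
qed

section \<open>The inequalities\<close>

text \<open>Conditional probabilities of \<open>X / z \<in> E\<close> given
  \<open>X $ i = x\<close>, cross-multiplied by the unrestricted masses. If \<open>E\<close> is
  closed towards zero, \<open>x\<close> is the inner value and the coordinatewise
  \<open>abs_min\<close> inherits membership; if \<open>E\<close> is closed outward,
  \<open>x\<close> is the outer value and \<open>abs_max\<close> inherits it. The order of the
  scales \<open>z\<close> and \<open>z'\<close> works in the same direction.\<close>

lemma slice_mass_ratio:
  fixes Q :: "real ^ 'n ^ 'n" and i :: 'n
  assumes d: "d \<in> signs" and Q: "\<And>i j. i \<noteq> j \<Longrightarrow> d i * Q $ i $ j * d j \<le> 0"
    and E: "E \<in> sets borel" and z: "z > 0" "z' > 0"
    and closed: "(\<forall>p q. p \<in> E \<longrightarrow> (\<forall>k. \<bar>q $ k\<bar> \<le> \<bar>p $ k\<bar>) \<longrightarrow> q \<in> E) \<and> \<bar>x\<bar> \<le> \<bar>x'\<bar> \<and> z' \<le> z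
      \<or> (\<forall>p q. p \<in> E \<longrightarrow> (\<forall>k. \<bar>p $ k\<bar> \<le> \<bar>q $ k\<bar>) \<longrightarrow> q \<in> E) \<and> \<bar>x'\<bar> \<le> \<bar>x\<bar> \<and> z \<le> z'"
  shows "slice_mass Q i E x' z' * slice_mass Q i UNIV x 1 \<le> slice_mass Q i E x z * slice_mass Q i UNIV x' 1"
proof -
  let ?J = "lebesgue_PiM (-{i})" and ?N = "of_nat (card (signs :: ('n \<Rightarrow> real) set)) :: ennreal"
  define G where "G E x z = {y \<in> space ?J. inverse z *\<^sub>R (\<chi> k. (y(i := x)) k) \<in> E}" for E x z
  define F where "F x G = (\<integral>\<^sup>+y. ennreal (folded Q (y(i := x))) * indicator G y \<partial>?J)" for x G
  have even: "(\<chi> k. e k * p $ k) \<in> E" if "e \<in> signs" "p \<in> E" for e p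
    using closed that by (auto simp: abs_mult signs_abs)
  have FE: "?N * slice_mass Q i E x z = F x (G E x z)" for x z
    unfolding F_def G_def by (rule slice_mass_folded[OF E even])
  have FU: "?N * slice_mass Q i UNIV x z = F x (G UNIV x z)" for x z
    unfolding F_def G_def by (rule slice_mass_folded) auto
  have G: "G A x z \<in> sets ?J" if "A \<in> sets borel" for A x z
    unfolding G_def using measurable_sets[OF slice_measurable_section(1)[OF that, of z i x] that]
    by (simp add: vimage_def Int_def conj_commute del: fun_upd_apply)
  have space: "(\<lambda>k\<in>-{i}. f k) \<in> space ?J" for f by (simp add: space_PiM)
  have scale: "\<bar>(inverse z *\<^sub>R (\<chi> k. (y(i := x)) k) :: real ^ 'n) $ k\<bar> \<le> \<bar>(inverse z' *\<^sub>R (\<chi> k. (y'(i := x')) k) :: real ^ 'n) $ k\<bar>"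
    if "0 < z'" "z' \<le> z" "\<bar>x\<bar> \<le> \<bar>x'\<bar>" "k \<noteq> i \<Longrightarrow> \<bar>y k\<bar> \<le> \<bar>y' k\<bar>" for y y' :: "'n \<Rightarrow> real" and x x' z z' k
  proof -
    have "inverse z * \<bar>(y(i := x)) k\<bar> \<le> inverse z' * \<bar>(y'(i := x')) k\<bar>"
      using that by (intro mult_mono le_imp_inverse_le) auto
    then show ?thesis using that by (simp add: abs_mult del: fun_upd_apply)
  qed
  have "F x' (G E x' z') * F x (G UNIV x 1) \<le> F x (G E x z) * F x' (G UNIV x' 1)"
    using closed
  proof (elim disjE conjE)
    assume down: "\<forall>p q. p \<in> E \<longrightarrow> (\<forall>k. \<bar>q $ k\<bar> \<le> \<bar>p $ k\<bar>) \<longrightarrow> q \<in> E" and le: "\<bar>x\<bar> \<le> \<bar>x'\<bar>" "z' \<le> z"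
    \<comment> \<open>The factors on the right change places because the third function belongs to
      the larger absolute value, which is \<open>x'\<close> in this case.\<close>
    have "F x' (G E x' z') * F x (G UNIV x 1) \<le> F x' (G UNIV x' 1) * F x (G E x z)"
      unfolding F_def
    proof (rule folded_four_functions[OF d])
      show "G E x' z' \<in> sets ?J" "G UNIV x 1 \<in> sets ?J" "G UNIV x' 1 \<in> sets ?J" "G E x z \<in> sets ?J"
        by (rule G, simp add: E)+
      fix y y' :: "'n \<Rightarrow> real" assume y: "y \<in> G E x' z'" "y' \<in> G UNIV x 1"
      let ?y = "\<lambda>k\<in>-{i}. abs_min (y k) (y' k)"
      have "inverse z *\<^sub>R (\<chi> k. (?y(i := x)) k) \<in> E"
      proof (rule down[rule_format])
        show "inverse z' *\<^sub>R (\<chi> k. (y(i := x')) k) \<in> E" using y by (simp add: G_def)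
        show "\<bar>(inverse z *\<^sub>R (\<chi> k. (?y(i := x)) k) :: real ^ 'n) $ k\<bar> \<le> \<bar>(inverse z' *\<^sub>R (\<chi> k. (y(i := x')) k) :: real ^ 'n) $ k\<bar>" for k
          by (rule scale[OF z(2) le(2,1)]) (simp add: abs_abs_min)
      qed
      then show "(\<lambda>k\<in>-{i}. abs_max (y k) (y' k)) \<in> G UNIV x' 1 \<and> ?y \<in> G E x z"
        unfolding G_def by (simp only: mem_Collect_eq space UNIV_I simp_thms)
    qed (use le Q in auto)
    then show ?thesis by (simp add: mult.commute)
  next
    assume up: "\<forall>p q. p \<in> E \<longrightarrow> (\<forall>k. \<bar>p $ k\<bar> \<le> \<bar>q $ k\<bar>) \<longrightarrow> q \<in> E" and le: "\<bar>x'\<bar> \<le> \<bar>x\<bar>" "z \<le> z'"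
    show ?thesis
      unfolding F_def
    proof (rule folded_four_functions[OF d])
      show "G E x' z' \<in> sets ?J" "G UNIV x 1 \<in> sets ?J" "G E x z \<in> sets ?J" "G UNIV x' 1 \<in> sets ?J"
        by (rule G, simp add: E)+
      fix y y' :: "'n \<Rightarrow> real" assume y: "y \<in> G E x' z'" "y' \<in> G UNIV x 1"
      let ?y = "\<lambda>k\<in>-{i}. abs_max (y k) (y' k)"
      have "inverse z *\<^sub>R (\<chi> k. (?y(i := x)) k) \<in> E"
      proof (rule up[rule_format])
        show "inverse z' *\<^sub>R (\<chi> k. (y(i := x')) k) \<in> E" using y by (simp add: G_def)
        show "\<bar>(inverse z' *\<^sub>R (\<chi> k. (y(i := x')) k) :: real ^ 'n) $ k\<bar> \<le> \<bar>(inverse z *\<^sub>R (\<chi> k. (?y(i := x)) k) :: real ^ 'n) $ k\<bar>" for k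
          by (rule scale[OF z(1) le(2,1)]) (simp add: abs_abs_max)
      qed
      then show "?y \<in> G E x z \<and> (\<lambda>k\<in>-{i}. abs_min (y k) (y' k)) \<in> G UNIV x' 1"
        unfolding G_def by (simp only: mem_Collect_eq space UNIV_I simp_thms)
    qed (use le Q in auto)
  qed
  then have *: "(?N * ?N) * (slice_mass Q i E x' z' * slice_mass Q i UNIV x 1)
      \<le> (?N * ?N) * (slice_mass Q i E x z * slice_mass Q i UNIV x' 1)"
    unfolding FE[symmetric] FU[symmetric] by (simp only: mult_ac)
  have "(\<lambda>_. 1) \<in> (signs :: ('n \<Rightarrow> real) set)" by (simp add: signs_iff)
  then have "card (signs :: ('n \<Rightarrow> real) set) \<noteq> 0" by (auto simp: card_eq_0_iff)
  then have "?N * ?N \<noteq> 0" "?N * ?N \<noteq> \<top>" by (auto simp: ennreal_mult_eq_top_iff)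
  from iffD1[OF ennreal_mult_le_mult_iff[OF this] *] show ?thesis .
qed

context studentized
begin

text \<open>The kernel is Bayes' formula: the slice mass of \<open>E\<close> divided by the density
  of \<open>X $ i\<close>. The two alternatives in \<open>closed\<close> are the inner regions, used
  for lower bounds on \<open>\<bar>T\<bar>\<close>, and the outer regions, used for upper
  bounds.\<close>

lemma simes_two_sided:
  assumes n: "n \<ge> 1" and inv: "invertible S" and d: "d \<in> signs"
    and Q: "\<And>i j. i \<noteq> j \<Longrightarrow> d i * matrix_inv S $ i $ j * d j \<le> 0"
    and D: "\<And>k. D k \<in> sets borel"
    and nested: "\<And>j. 1 \<le> j \<Longrightarrow> j < n \<Longrightarrow> D j \<subseteq> D (Suc j)"
    and closed: "(\<forall>k s t. s \<in> D k \<longrightarrow> \<bar>t\<bar> \<le> \<bar>s\<bar> \<longrightarrow> t \<in> D k) \<or> (\<forall>k s t. s \<in> D k \<longrightarrow> \<bar>s\<bar> \<le> \<bar>t\<bar> \<longrightarrow> t \<in> D k)"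
    and mono: "\<And>i. mono_on {1..n} (\<lambda>j. prob {\<omega> \<in> space M. T \<omega> $ i \<in> D j} / real j)"
  shows "prob {\<omega> \<in> space M. T \<omega> \<in> rejection D n 1} \<le> (1 / real n) * (\<Sum>i\<in>UNIV. prob {\<omega> \<in> space M. T \<omega> $ i \<in> D n})"
proof (rule simes_T[OF n D nested _ mono])
  fix i :: 'n and j assume j: "1 \<le> j" "j < n"
  let ?Q = "matrix_inv S"
  define E :: "(real ^ 'n) set" where "E = rejection D n (Suc j)"
  have E: "E \<in> sets borel" unfolding E_def by (rule rejection_measurable[OF D])
  note [measurable] = E
  obtain c where c: "\<And>h. h \<in> borel_measurable borel \<Longrightarrow>
      (\<integral>\<^sup>+x. h x \<partial>distr M borel X)
      = c * (\<integral>\<^sup>+z. ennreal (exp (- quad_form ?Q z / 2)) * h (\<chi> k. z k) \<partial>lebesgue_PiM UNIV)"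
    by (rule multivariate_normal_density[OF normal inv]) (rule that)
  have slice: "(\<integral>\<^sup>+x. indicator A (inverse z *\<^sub>R x) * indicator C (x $ i / z) \<partial>distr M borel X)
      = c * (\<integral>\<^sup>+x. slice_mass ?Q i A x z * indicator C (x / z) \<partial>lborel)"
    if [measurable]: "A \<in> sets borel" "C \<in> sets borel" for A C z
  proof -
    note sec = slice_measurable_section(2)[OF that(1), of ?Q i]
    have "(\<integral>\<^sup>+x. indicator A (inverse z *\<^sub>R x) * indicator C (x $ i / z) \<partial>distr M borel X)
        = c * (\<integral>\<^sup>+y. ennreal (exp (- quad_form ?Q y / 2)) * (indicator A (inverse z *\<^sub>R (\<chi> k. y k)) * indicator C (y i / z)) \<partial>lebesgue_PiM UNIV)"
      by (subst c) auto
    also have "(\<integral>\<^sup>+y. ennreal (exp (- quad_form ?Q y / 2)) * (indicator A (inverse z *\<^sub>R (\<chi> k. y k)) * indicator C (y i / z)) \<partial>lebesgue_PiM UNIV)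
        = (\<integral>\<^sup>+x. \<integral>\<^sup>+y. ennreal (exp (- quad_form ?Q (y(i := x)) / 2)) * (indicator A (inverse z *\<^sub>R (\<chi> k. (y(i := x)) k)) * indicator C ((y(i := x)) i / z)) \<partial>lebesgue_PiM (-{i}) \<partial>lborel)"
      by (rule nn_integral_lebesgue_PiM_split) measurable
    also have "\<dots> = (\<integral>\<^sup>+x. slice_mass ?Q i A x z * indicator C (x / z) \<partial>lborel)"
      unfolding slice_mass_def
      by (intro nn_integral_cong, subst nn_integral_multc[symmetric, OF sec])
         (simp add: mult.assoc del: fun_upd_apply, simp)
    finally show ?thesis .
  qed
  define v where "v = S *v axis i 1"
  have "?Q *v v = axis i 1"
    unfolding v_def by (simp add: matrix_vector_mul_assoc matrix_inv_mult[OF inv])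
  moreover have "v $ i = 1"
    unfolding v_def by (simp add: matrix_vector_mult_basis column_def diag)
  moreover have "transpose ?Q = ?Q"
  proof -
    obtain A :: "real ^ 'n ^ 'n" where "A ** transpose A = S"
      using normal unfolding multivariate_normal_def by blast
    from invertible_factor(4)[OF this inv] show ?thesis .
  qed
  moreover define K where "K = slice_mass ?Q i UNIV 0 1"
  ultimately have total: "slice_mass ?Q i UNIV x z = ennreal (exp (- x\<^sup>2 / 2)) * K" for x z
    unfolding K_def by (intro slice_mass_UNIV)
  interpret PX: prob_space "distr M borel X" by (rule prob_space_distr) simp
  \<comment> \<open>Total mass one forces \<open>K\<close> to be nonzero and finite, so it can later
    be cancelled from the inequality between slice masses.\<close>
  have "1 = (\<integral>\<^sup>+x. indicator UNIV (inverse 1 *\<^sub>R x) * indicator UNIV (x $ i / 1) \<partial>distr M borel X)"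
    using PX.emeasure_space_1 by simp
  also have "\<dots> = c * (\<integral>\<^sup>+x. ennreal (exp (- x\<^sup>2 / 2)) * K \<partial>lborel)"
    by (subst slice) (auto simp: total[of _ 1])
  also have "\<dots> = c * ((\<integral>\<^sup>+x. ennreal (exp (- x\<^sup>2 / 2)) \<partial>lborel) * K)"
    by (simp add: nn_integral_multc)
  finally have one: "c * ((\<integral>\<^sup>+x. ennreal (exp (- x\<^sup>2 / 2)) \<partial>lborel) * K) = 1" ..
  have I0: "(\<integral>\<^sup>+x. ennreal (exp (- x\<^sup>2 / 2)) \<partial>lborel) \<noteq> 0"
    by (subst nn_integral_0_iff_AE) (auto simp: AE_iff_null not_le)
  have K: "K \<noteq> 0" "K \<noteq> \<top>"
    using one I0 by (auto simp: ennreal_mult_eq_top_iff ennreal_top_mult ennreal_mult_top split: if_splits)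
  define \<kappa> where "\<kappa> x z = c * (ennreal (1 / std_normal_density x) * slice_mass ?Q i E x z)" for x z
  have inv_dens: "ennreal (std_normal_density x) * ennreal (1 / std_normal_density x) = 1" for x
    using normal_density_pos[of 1 0 x] by (simp flip: ennreal_mult)
  have "kernel i E \<kappa>"
    unfolding kernel_def
  proof (intro conjI allI impI ballI)
    show "case_prod \<kappa> \<in> borel_measurable (borel \<Otimes>\<^sub>M borel)"
      unfolding \<kappa>_def by measurable
    fix z :: real and C :: "real set" assume [measurable]: "C \<in> sets borel"
    have "ennreal (std_normal_density x) * (\<kappa> x z * indicator C (x / z)) = c * (slice_mass ?Q i E x z * indicator C (x / z))" for x
    proof -
      have "ennreal (std_normal_density x) * (\<kappa> x z * indicator C (x / z))
          = (ennreal (std_normal_density x) * ennreal (1 / std_normal_density x)) * (c * (slice_mass ?Q i E x z * indicator C (x / z)))"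
        unfolding \<kappa>_def by (simp only: mult_ac)
      then show ?thesis by (simp add: inv_dens)
    qed
    then show "(\<integral>\<^sup>+x. indicator E (inverse z *\<^sub>R x) * indicator C (x $ i / z) \<partial>distr M borel X)
        = (\<integral>\<^sup>+x. ennreal (std_normal_density x) * (\<kappa> x z * indicator C (x / z)) \<partial>lborel)"
      by (subst slice) (auto simp: nn_integral_cmult)
  qed
  moreover have "\<kappa> (v * zeta \<nu> v r) (zeta \<nu> v r) \<le> \<kappa> (u * zeta \<nu> u r) (zeta \<nu> u r)"
    if u: "u \<in> D j" and v: "v \<in> D (Suc j) - D j" and r: "r > 0" for u v r
  proof -
    let ?zu = "zeta \<nu> u r" and ?zv = "zeta \<nu> v r"
    let ?xu = "u * ?zu" and ?xv = "v * ?zv"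
    have "slice_mass ?Q i E ?xv ?zv * slice_mass ?Q i UNIV ?xu 1 \<le> slice_mass ?Q i E ?xu ?zu * slice_mass ?Q i UNIV ?xv 1"
    proof (rule slice_mass_ratio[OF d _ E zeta_pos[OF \<nu> r] zeta_pos[OF \<nu> r]])
      show "(\<forall>p q. p \<in> E \<longrightarrow> (\<forall>k. \<bar>q $ k\<bar> \<le> \<bar>p $ k\<bar>) \<longrightarrow> q \<in> E) \<and> \<bar>?xu\<bar> \<le> \<bar>?xv\<bar> \<and> ?zv \<le> ?zu
          \<or> (\<forall>p q. p \<in> E \<longrightarrow> (\<forall>k. \<bar>p $ k\<bar> \<le> \<bar>q $ k\<bar>) \<longrightarrow> q \<in> E) \<and> \<bar>?xv\<bar> \<le> \<bar>?xu\<bar> \<and> ?zu \<le> ?zv"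
        using closed
      proof
        assume down: "\<forall>k s t. s \<in> D k \<longrightarrow> \<bar>t\<bar> \<le> \<bar>s\<bar> \<longrightarrow> t \<in> D k"
        then have "\<bar>u\<bar> \<le> \<bar>v\<bar>" using u v by (metis DiffD2 linear)
        moreover have "q \<in> E" if "p \<in> E" "\<And>k. \<bar>q $ k\<bar> \<le> \<bar>p $ k\<bar>" for p q
          using that(1) unfolding E_def by (rule rejection_mono) (use down that(2) in blast)
        ultimately show ?thesis using abs_mult_zeta_mono[OF \<nu> r] zeta_antimono[OF \<nu> r] by blast
      next
        assume up: "\<forall>k s t. s \<in> D k \<longrightarrow> \<bar>s\<bar> \<le> \<bar>t\<bar> \<longrightarrow> t \<in> D k"
        then have "\<bar>v\<bar> \<le> \<bar>u\<bar>" using u v by (metis DiffD2 linear)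
        moreover have "q \<in> E" if "p \<in> E" "\<And>k. \<bar>p $ k\<bar> \<le> \<bar>q $ k\<bar>" for p q
          using that(1) unfolding E_def by (rule rejection_mono) (use up that(2) in blast)
        ultimately show ?thesis using abs_mult_zeta_mono[OF \<nu> r] zeta_antimono[OF \<nu> r] by blast
      qed
    qed (rule Q)
    then have "K * (slice_mass ?Q i E ?xv ?zv * ennreal (exp (- ?xu\<^sup>2 / 2))) \<le> K * (slice_mass ?Q i E ?xu ?zu * ennreal (exp (- ?xv\<^sup>2 / 2)))"
      unfolding total[of ?xu 1] total[of ?xv 1] by (simp only: mult_ac)
    then have le: "slice_mass ?Q i E ?xv ?zv * ennreal (exp (- ?xu\<^sup>2 / 2)) \<le> slice_mass ?Q i E ?xu ?zu * ennreal (exp (- ?xv\<^sup>2 / 2))"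
      using K by (subst (asm) ennreal_mult_le_mult_iff) (auto simp: less_top)
    \<comment> \<open>A common factor that rewrites the reciprocal normal density at one point as
      the exponential at the other, matching the cross-multiplied inequality
      \<open>le\<close>.\<close>
    define a where "a = sqrt (2 * pi) * exp (?xu\<^sup>2 / 2) * exp (?xv\<^sup>2 / 2)"
    have rec: "ennreal (1 / std_normal_density ?xv) = ennreal a * ennreal (exp (- ?xu\<^sup>2 / 2))"
      "ennreal (1 / std_normal_density ?xu) = ennreal a * ennreal (exp (- ?xv\<^sup>2 / 2))"
      by (simp_all add: a_def normal_density_def exp_minus field_simps flip: ennreal_mult)
    have "(c * ennreal a) * (slice_mass ?Q i E ?xv ?zv * ennreal (exp (- ?xu\<^sup>2 / 2)))
        \<le> (c * ennreal a) * (slice_mass ?Q i E ?xu ?zu * ennreal (exp (- ?xv\<^sup>2 / 2)))"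
      using le by (rule mult_left_mono) simp
    then show ?thesis unfolding \<kappa>_def rec by (simp only: mult_ac)
  qed
  ultimately show "\<exists>\<kappa>. kernel i (rejection D n (Suc j)) \<kappa> \<and>
      (\<forall>u v r. u \<in> D j \<longrightarrow> v \<in> D (Suc j) - D j \<longrightarrow> r > 0 \<longrightarrow>
        \<kappa> (v * zeta \<nu> v r) (zeta \<nu> v r) \<le> \<kappa> (u * zeta \<nu> u r) (zeta \<nu> u r))"
    unfolding E_def by blast
qed

end

section \<open>From critical regions back to ordered values and distribution functions\<close>

context studentized
begin

lemma cdf_T:
  assumes [measurable]: "g \<in> borel_measurable borel"
  shows "cdf (distr M borel (\<lambda>\<omega>. g (T \<omega> $ i))) c = prob {\<omega> \<in> space M. T \<omega> $ i \<in> {s. g s \<le> c}}"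
    and "1 - cdf (distr M borel (\<lambda>\<omega>. g (T \<omega> $ i))) c = prob {\<omega> \<in> space M. T \<omega> $ i \<in> {s. c < g s}}"
proof -
  show *: "cdf (distr M borel (\<lambda>\<omega>. g (T \<omega> $ i))) c = prob {\<omega> \<in> space M. T \<omega> $ i \<in> {s. g s \<le> c}}"
    unfolding cdf_def by (subst measure_distr) (auto intro!: arg_cong[where f = prob])
  have "prob {\<omega> \<in> space M. \<not> g (T \<omega> $ i) \<le> c} = 1 - prob {\<omega> \<in> space M. g (T \<omega> $ i) \<le> c}"
    by (rule prob_neg) measurable
  then show "1 - cdf (distr M borel (\<lambda>\<omega>. g (T \<omega> $ i))) c = prob {\<omega> \<in> space M. T \<omega> $ i \<in> {s. c < g s}}"
    unfolding * by (simp add: not_le)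
qed

text \<open>The event on the ordered values and the complement of the rejection event may differ
  through ties at a critical value, so only an inclusion is asked for; \<open>event\<close> provides
  measurability.\<close>

lemma prob_order_stats:
  assumes [measurable]: "\<And>k. D k \<in> sets borel" "\<And>j. P j \<in> sets borel"
    and simes: "prob {\<omega> \<in> space M. T \<omega> \<in> rejection D n 1} \<le> r"
    and event: "\<And>\<omega>. Q \<omega> \<longleftrightarrow> (\<forall>j\<in>{1..n}. \<not> m j \<le> card {i. T \<omega> $ i \<in> P j})"
    and sub: "\<And>\<omega>. T \<omega> \<notin> rejection D n 1 \<Longrightarrow> Q \<omega>"
  shows "prob {\<omega> \<in> space M. Q \<omega>} \<ge> 1 - r"
proof -
  have "1 - r \<le> 1 - prob {\<omega> \<in> space M. T \<omega> \<in> rejection D n 1}" using simes by simp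
  also have "\<dots> = prob {\<omega> \<in> space M. T \<omega> \<notin> rejection D n 1}"
    by (rule prob_neg[symmetric]) measurable
  also have "\<dots> \<le> prob {\<omega> \<in> space M. Q \<omega>}"
  proof (rule finite_measure_mono)
    show "{\<omega> \<in> space M. Q \<omega>} \<in> events" unfolding event by measurable
  qed (use sub in auto)
  finally show ?thesis .
qed

lemma prob_order_stats_ge:
  fixes g :: "real \<Rightarrow> real"
  assumes [measurable]: "g \<in> borel_measurable borel" and n: "n = CARD('n)"
    and simes: "prob {\<omega> \<in> space M. T \<omega> \<in> rejection (\<lambda>k. {s. g s \<le> a k}) n 1}
      \<le> (1 / real n) * (\<Sum>i\<in>UNIV. prob {\<omega> \<in> space M. T \<omega> $ i \<in> {s. g s \<le> a n}})"
  shows "prob {\<omega> \<in> space M. \<forall>j\<in>{1..n}. order_stat (\<lambda>i. g (T \<omega> $ i)) j \<ge> a j}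
    \<ge> 1 - (1 / real n) * (\<Sum>i\<in>UNIV. cdf (distr M borel (\<lambda>\<omega>. g (T \<omega> $ i))) (a n))"
  unfolding cdf_T(1)[OF assms(1)]
proof (rule prob_order_stats[OF _ _ simes, where P = "\<lambda>j. {s. g s < a j}" and m = "\<lambda>j. j"])
  fix \<omega>
  \<comment> \<open>The ordered values violate the bound through entries strictly below
    \<open>a j\<close>, while distribution functions count those at \<open>a j\<close> too. The weak
    regions are larger, so avoiding them is the stronger condition.\<close>
  have "card {i. g (T \<omega> $ i) < a j} \<le> card {i. g (T \<omega> $ i) \<le> a j}" for j
    by (intro card_mono) auto
  note card = order_trans[OF _ this]
  show *: "(\<forall>j\<in>{1..n}. a j \<le> order_stat (\<lambda>i. g (T \<omega> $ i)) j)
      \<longleftrightarrow> (\<forall>j\<in>{1..n}. \<not> j \<le> card {i. T \<omega> $ i \<in> {s. g s < a j}})"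
    using order_stat_ge_iff[of _ _ "\<lambda>i. g (T \<omega> $ i)"] unfolding n by (auto simp: not_le)
  show "\<forall>j\<in>{1..n}. a j \<le> order_stat (\<lambda>i. g (T \<omega> $ i)) j"
    if "T \<omega> \<notin> rejection (\<lambda>k. {s. g s \<le> a k}) n 1"
    using that card unfolding * rejection_def by fastforce
qed measurable

lemma prob_order_stats_le:
  fixes g :: "real \<Rightarrow> real"
  assumes [measurable]: "g \<in> borel_measurable borel" and n: "n = CARD('n)"
    and simes: "prob {\<omega> \<in> space M. T \<omega> \<in> rejection (\<lambda>k. {s. b (n - k + 1) < g s}) n 1}
      \<le> (1 / real n) * (\<Sum>i\<in>UNIV. prob {\<omega> \<in> space M. T \<omega> $ i \<in> {s. b (n - n + 1) < g s}})"
  shows "prob {\<omega> \<in> space M. \<forall>j\<in>{1..n}. order_stat (\<lambda>i. g (T \<omega> $ i)) j \<le> b j}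
    \<ge> (1 / real n) * (\<Sum>i\<in>UNIV. cdf (distr M borel (\<lambda>\<omega>. g (T \<omega> $ i))) (b 1))"
proof -
  have "1 - (1 / real n) * (\<Sum>i\<in>UNIV. prob {\<omega> \<in> space M. T \<omega> $ i \<in> {s. b (n - n + 1) < g s}})
      \<le> prob {\<omega> \<in> space M. \<forall>j\<in>{1..n}. order_stat (\<lambda>i. g (T \<omega> $ i)) j \<le> b j}"
  \<comment> \<open>The \<open>j\<close>-th smallest value exceeds \<open>b j\<close> exactly when
    \<open>n - j + 1\<close> values do, so the \<open>k\<close>-th critical region is cut off at
    \<open>b (n - k + 1)\<close>.\<close>
  proof (rule prob_order_stats[OF _ _ simes, where P = "\<lambda>j. {s. b j < g s}" and m = "\<lambda>j. n - j + 1"])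
    fix \<omega>
    show *: "(\<forall>j\<in>{1..n}. order_stat (\<lambda>i. g (T \<omega> $ i)) j \<le> b j)
        \<longleftrightarrow> (\<forall>j\<in>{1..n}. \<not> n - j + 1 \<le> card {i. T \<omega> $ i \<in> {s. b j < g s}})"
      using order_stat_le_iff[of _ "\<lambda>i. g (T \<omega> $ i)"] unfolding n by (auto simp: not_le)
    show "\<forall>j\<in>{1..n}. order_stat (\<lambda>i. g (T \<omega> $ i)) j \<le> b j"
      if *: "T \<omega> \<notin> rejection (\<lambda>k. {s. b (n - k + 1) < g s}) n 1"
      unfolding \<open>(\<forall>j\<in>{1..n}. order_stat (\<lambda>i. g (T \<omega> $ i)) j \<le> b j) \<longleftrightarrow> _\<close>
    proof
      fix j assume j: "j \<in> {1..n}"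
      then have k: "n - j + 1 \<in> {1..n}" and eq: "n - (n - j + 1) + 1 = j" by auto
      from * k have "\<not> n - j + 1 \<le> card {i. T \<omega> $ i \<in> {s. b (n - (n - j + 1) + 1) < g s}}"
        unfolding rejection_def by blast
      then show "\<not> n - j + 1 \<le> card {i. T \<omega> $ i \<in> {s. b j < g s}}" unfolding eq .
    qed
  qed measurable
  moreover have "(\<Sum>i\<in>(UNIV :: 'n set). prob {\<omega> \<in> space M. T \<omega> $ i \<in> {s. b (n - n + 1) < g s}})
      = real n - (\<Sum>i\<in>UNIV. cdf (distr M borel (\<lambda>\<omega>. g (T \<omega> $ i))) (b 1))"
    unfolding cdf_T(2)[OF assms(1), symmetric] by (simp add: sum_subtractf n)
  moreover have "real n > 0" unfolding n by simp
  ultimately show ?thesis by (simp add: field_simps)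
qed

end

lemma diagonal_conjugate:
  fixes D Q :: "real ^ 'n ^ 'n"
  assumes "\<And>i j. i \<noteq> j \<Longrightarrow> D $ i $ j = 0"
  shows "(D ** Q ** D) $ i $ j = D $ i $ i * Q $ i $ j * D $ j $ j"
proof -
  have D: "D $ k $ l = (if k = l then D $ k $ k else 0)" for k l using assms by auto
  have "(D ** Q) $ i $ k = D $ i $ i * Q $ i $ k" for k
    unfolding matrix_matrix_mult_def by (subst D) (simp add: if_distrib[of "\<lambda>x. x * _"] cong: if_cong)
  then have "(D ** Q ** D) $ i $ j = (\<Sum>k\<in>UNIV. D $ i $ i * Q $ i $ k * D $ k $ j)"
    by (simp add: matrix_matrix_mult_def)
  also have "\<dots> = D $ i $ i * Q $ i $ j * D $ j $ j"
    by (subst D) (simp add: if_distrib[of "\<lambda>x. _ * x"] cong: if_cong)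
  finally show ?thesis .
qed

theorem theorem3p1:
  fixes M :: "'a measure"
    and X :: "'a \<Rightarrow> real ^ 'n"
    and Z :: "'a \<Rightarrow> real"
    and S :: "real ^ 'n ^ 'n"
    and \<nu> :: real
    and T :: "'n \<Rightarrow> 'a \<Rightarrow> real"
    and F H :: "'n \<Rightarrow> real \<Rightarrow> real"
    and n :: nat
  assumes "prob_space M"
    and "n = CARD('n)"
    and "multivariate_normal M X 0 S"
    and "\<And>i. S $ i $ i = 1"
    and "\<nu> > 0"
    and "scaled_chi M Z \<nu>"
    and "independent_rv M X Z"
    and T: "\<And>i \<omega>. T i \<omega> = inverse (Z \<omega>) * X \<omega> $ i"
    and F: "\<And>i. F i = cdf (distr M borel (T i))"
    and H: "\<And>i. H i = cdf (distr M borel (\<lambda>\<omega>. \<bar>T i \<omega>\<bar>))"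
  shows
    "((\<forall>i j. i \<noteq> j \<longrightarrow> S $ i $ j \<ge> 0) \<longrightarrow>
       (\<forall>a :: nat \<Rightarrow> real.
          mono_on {1..n} a \<and> a n \<le> 0 \<and> (\<forall>i. mono_on {1..n} (\<lambda>j. F i (a j) / real j)) \<longrightarrow>
          measure M {\<omega> \<in> space M. \<forall>j\<in>{1..n}. order_stat (\<lambda>i. T i \<omega>) j \<ge> a j}
            \<ge> 1 - (1 / real n) * (\<Sum>i\<in>UNIV. F i (a n))) \<and>
       (\<forall>b :: nat \<Rightarrow> real.
          mono_on {1..n} b \<and> b 1 \<ge> 0 \<and>
          (\<forall>i. mono_on {1..n} (\<lambda>j. (1 - F i (b (n - j + 1))) / real j)) \<longrightarrow>
          measure M {\<omega> \<in> space M. \<forall>j\<in>{1..n}. order_stat (\<lambda>i. T i \<omega>) j \<le> b j}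
            \<ge> (1 / real n) * (\<Sum>i\<in>UNIV. F i (b 1))))
     \<and>
     (invertible S \<and>
      (\<exists>D :: real ^ 'n ^ 'n.
         (\<forall>i j. i \<noteq> j \<longrightarrow> D $ i $ j = 0) \<and> (\<forall>i. D $ i $ i = 1 \<or> D $ i $ i = -1) \<and>
         (\<forall>i j. i \<noteq> j \<longrightarrow> (- (D ** matrix_inv S ** D)) $ i $ j \<ge> 0)) \<longrightarrow>
       (\<forall>a :: nat \<Rightarrow> real.
          mono_on {1..n} a \<and> (\<forall>i. mono_on {1..n} (\<lambda>j. H i (a j) / real j)) \<longrightarrow>
          measure M {\<omega> \<in> space M. \<forall>j\<in>{1..n}. order_stat (\<lambda>i. \<bar>T i \<omega>\<bar>) j \<ge> a j}
            \<ge> 1 - (1 / real n) * (\<Sum>i\<in>UNIV. H i (a n))) \<and>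
       (\<forall>b :: nat \<Rightarrow> real.
          mono_on {1..n} b \<and>
          (\<forall>i. mono_on {1..n} (\<lambda>j. (1 - H i (b (n - j + 1))) / real j)) \<longrightarrow>
          measure M {\<omega> \<in> space M. \<forall>j\<in>{1..n}. order_stat (\<lambda>i. \<bar>T i \<omega>\<bar>) j \<le> b j}
            \<ge> (1 / real n) * (\<Sum>i\<in>UNIV. H i (b 1))))"
proof -
  interpret st: studentized M X Z S \<nu>
    using assms(1,3-7) by (simp add: studentized_def studentized_axioms_def)
  have n: "n = CARD('n)" and n1: "n \<ge> 1" using assms(2) by (auto simp: Suc_le_eq)
  have T_eq: "T = (\<lambda>i \<omega>. st.T \<omega> $ i)" by (simp add: fun_eq_iff st.T_def T)
  have F_eq: "F i = cdf (distr M borel (\<lambda>\<omega>. st.T \<omega> $ i))" for i by (simp add: F T_eq)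
  have H_eq: "H i = cdf (distr M borel (\<lambda>\<omega>. \<bar>st.T \<omega> $ i\<bar>))" for i by (simp add: H T_eq)
  have id: "(\<lambda>s. s) \<in> borel_measurable borel" and abs: "(\<lambda>s. \<bar>s\<bar>) \<in> borel_measurable (borel :: real measure)"
    by measurable
  note F_le = st.cdf_T(1)[OF id, folded F_eq] and F_gt = st.cdf_T(2)[OF id, folded F_eq]
  note H_le = st.cdf_T(1)[OF abs, folded H_eq] and H_gt = st.cdf_T(2)[OF abs, folded H_eq]
  have index: "n - j + 1 \<in> {1..n}" "n - Suc j + 1 \<in> {1..n}" "n - Suc j + 1 \<le> n - j + 1"
    if "1 \<le> j" "j < n" for j using that by auto
  show ?thesis
  proof (intro conjI impI allI; (elim conjE exE)?)
    fix a :: "nat \<Rightarrow> real"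
    assume "\<forall>i j. i \<noteq> j \<longrightarrow> S $ i $ j \<ge> 0" and a: "mono_on {1..n} a" "a n \<le> 0"
      and mono: "\<forall>i. mono_on {1..n} (\<lambda>j. F i (a j) / real j)"
    then have S: "S $ i $ j \<ge> 0" for i j using assms(4)[of i] by (cases "i = j") auto
    have a0: "a k \<le> 0" if "k \<in> {1..n}" for k
      using mono_onD[OF a(1) that, of n] that a(2) by auto
    show "measure M {\<omega> \<in> space M. \<forall>j\<in>{1..n}. order_stat (\<lambda>i. T i \<omega>) j \<ge> a j} \<ge> 1 - (1 / real n) * (\<Sum>i\<in>UNIV. F i (a n))"
      unfolding T_eq F_eq
    proof (rule st.prob_order_stats_ge[OF id n], rule st.simes_one_sided[OF n1 S, of "-1"])
      show "mono_on {1..n} (\<lambda>j. st.prob {\<omega> \<in> space M. st.T \<omega> $ i \<in> {s. s \<le> a j}} / real j)" for i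
        using mono by (simp add: F_le)
      show "{s. s \<le> a j} \<subseteq> {s. s \<le> a (Suc j)}" if "1 \<le> j" "j < n" for j
        using mono_onD[OF a(1), of j "Suc j"] that by auto
      show "0 \<le> -1 * s" if "k \<in> {1..n}" "s \<in> {s. s \<le> a k}" for k s
        using a0[OF that(1)] that(2) by simp
    qed auto
  next
    fix b :: "nat \<Rightarrow> real"
    assume "\<forall>i j. i \<noteq> j \<longrightarrow> S $ i $ j \<ge> 0" and b: "mono_on {1..n} b" "b 1 \<ge> 0"
      and mono: "\<forall>i. mono_on {1..n} (\<lambda>j. (1 - F i (b (n - j + 1))) / real j)"
    then have S: "S $ i $ j \<ge> 0" for i j using assms(4)[of i] by (cases "i = j") auto
    have b0: "0 \<le> b (n - k + 1)" if "k \<in> {1..n}" for k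
    proof -
      have "1 \<in> {1..n}" "n - k + 1 \<in> {1..n}" "1 \<le> n - k + 1" using that by auto
      from mono_onD[OF b(1) this] b(2) show ?thesis by simp
    qed
    have bm: "b (n - Suc j + 1) \<le> b (n - j + 1)" if "1 \<le> j" "j < n" for j
      using mono_onD[OF b(1)] index[OF that] by blast
    show "measure M {\<omega> \<in> space M. \<forall>j\<in>{1..n}. order_stat (\<lambda>i. T i \<omega>) j \<le> b j} \<ge> (1 / real n) * (\<Sum>i\<in>UNIV. F i (b 1))"
      unfolding T_eq F_eq
    proof (rule st.prob_order_stats_le[OF id n], rule st.simes_one_sided[OF n1 S, of 1])
      show "mono_on {1..n} (\<lambda>j. st.prob {\<omega> \<in> space M. st.T \<omega> $ i \<in> {s. b (n - j + 1) < s}} / real j)" for i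
        using mono by (simp add: F_gt)
      show "{s. b (n - j + 1) < s} \<subseteq> {s. b (n - Suc j + 1) < s}" if "1 \<le> j" "j < n" for j
        using bm[OF that] by auto
      show "0 \<le> 1 * s" if "k \<in> {1..n}" "s \<in> {s. b (n - k + 1) < s}" for k s
        using b0[OF that(1)] that(2) by simp
    qed auto
  next
    fix a :: "nat \<Rightarrow> real" and D :: "real ^ 'n ^ 'n"
    assume inv: "invertible S" and D: "\<forall>i j. i \<noteq> j \<longrightarrow> D $ i $ j = 0" "\<forall>i. D $ i $ i = 1 \<or> D $ i $ i = -1"
        "\<forall>i j. i \<noteq> j \<longrightarrow> (- (D ** matrix_inv S ** D)) $ i $ j \<ge> 0"
      and a: "mono_on {1..n} a" and mono: "\<forall>i. mono_on {1..n} (\<lambda>j. H i (a j) / real j)"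
    have d: "(\<lambda>i. D $ i $ i) \<in> signs" using D(2) by (auto simp: signs_iff)
    have Q: "D $ i $ i * matrix_inv S $ i $ j * D $ j $ j \<le> 0" if "i \<noteq> j" for i j
      using D(3)[rule_format, OF that] diagonal_conjugate[of D "matrix_inv S" i j] D(1) by simp
    \<comment> \<open>The critical regions are intervals around zero, closed under shrinking the
      absolute value; a negative \<open>a j\<close> gives the empty region, which is closed as
      well.\<close>
    show "measure M {\<omega> \<in> space M. \<forall>j\<in>{1..n}. order_stat (\<lambda>i. \<bar>T i \<omega>\<bar>) j \<ge> a j} \<ge> 1 - (1 / real n) * (\<Sum>i\<in>UNIV. H i (a n))"
      unfolding T_eq H_eq
    proof (rule st.prob_order_stats_ge[OF abs n], rule st.simes_two_sided[OF n1 inv d Q])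
      show "mono_on {1..n} (\<lambda>j. st.prob {\<omega> \<in> space M. st.T \<omega> $ i \<in> {s. \<bar>s\<bar> \<le> a j}} / real j)" for i
        using mono by (simp add: H_le)
      show "{s. \<bar>s\<bar> \<le> a j} \<subseteq> {s. \<bar>s\<bar> \<le> a (Suc j)}" if "1 \<le> j" "j < n" for j
        using mono_onD[OF a, of j "Suc j"] that by auto
    qed auto
  next
    fix b :: "nat \<Rightarrow> real" and D :: "real ^ 'n ^ 'n"
    assume inv: "invertible S" and D: "\<forall>i j. i \<noteq> j \<longrightarrow> D $ i $ j = 0" "\<forall>i. D $ i $ i = 1 \<or> D $ i $ i = -1"
        "\<forall>i j. i \<noteq> j \<longrightarrow> (- (D ** matrix_inv S ** D)) $ i $ j \<ge> 0"
      and b: "mono_on {1..n} b" and mono: "\<forall>i. mono_on {1..n} (\<lambda>j. (1 - H i (b (n - j + 1))) / real j)"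
    have d: "(\<lambda>i. D $ i $ i) \<in> signs" using D(2) by (auto simp: signs_iff)
    have Q: "D $ i $ i * matrix_inv S $ i $ j * D $ j $ j \<le> 0" if "i \<noteq> j" for i j
      using D(3)[rule_format, OF that] diagonal_conjugate[of D "matrix_inv S" i j] D(1) by simp
    have bm: "b (n - Suc j + 1) \<le> b (n - j + 1)" if "1 \<le> j" "j < n" for j
      using mono_onD[OF b] index[OF that] by blast
    show "measure M {\<omega> \<in> space M. \<forall>j\<in>{1..n}. order_stat (\<lambda>i. \<bar>T i \<omega>\<bar>) j \<le> b j} \<ge> (1 / real n) * (\<Sum>i\<in>UNIV. H i (b 1))"
      unfolding T_eq H_eq
    proof (rule st.prob_order_stats_le[OF abs n], rule st.simes_two_sided[OF n1 inv d Q])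
      show "mono_on {1..n} (\<lambda>j. st.prob {\<omega> \<in> space M. st.T \<omega> $ i \<in> {s. b (n - j + 1) < \<bar>s\<bar>}} / real j)" for i
        using mono by (simp add: H_gt)
      show "{s. b (n - j + 1) < \<bar>s\<bar>} \<subseteq> {s. b (n - Suc j + 1) < \<bar>s\<bar>}" if "1 \<le> j" "j < n" for j
        using bm[OF that] by auto
    qed auto
  qed
qed

end
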